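(* For $i=1,2$, let $(\mathcal{C}_i,\mathcal{D}_i)$ be regular $C^*$-inclusions, let $\mathcal{A}_i$ be norm-closed subalgebras with $\mathcal{D}_i\subseteq\mathcal{A}_i\subseteq\mathcal{C}_i$, and suppose $\theta:\mathcal{A}_1\to\mathcal{A}_2$ is a bounded algebra isomorphism with $\theta(\mathcal{D}_1)=\mathcal{D}_2$. There exists a bicontinuous isomorphism of coordinate systems $\gamma:\mathcal{E}^1(\mathcal{A}_1)\to\mathcal{E}^1(\mathcal{A}_2)$ given by $$\gamma(\phi)=\frac{\phi\circ\theta^{-1}}{\|\phi\circ\theta^{-1}\|}.$$ Moreover, if $\phi\in\mathcal{E}^1(\mathcal{A}_1)$ is written as $\phi=[v,\rho]$ with $v\in\mathcal{N}(\mathcal{A}_1)$, then $(\rho\circ\theta^{-1})(\theta(v)^*\theta(v))$ is nonzero, and $\gamma(\phi)=[\theta(v),\rho\circ\theta^{-1}]$.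
   Context: Let $\mathcal{C}$ be a unital $C^*$-algebra and $\mathcal{D}\subseteq\mathcal{C}$ an abelian $C^*$-subalgebra containing the unit. For a subspace $\mathcal{M}\subseteq\mathcal{C}$, $\mathcal{N}(\mathcal{M})=\{v\in\mathcal{M}:v\mathcal{D}v^*\cup v^*\mathcal{D}v\subseteq\mathcal{D}\}$ (normalizers). $\mathcal{D}$ has the extension property in $\mathcal{C}$ if every pure state of $\mathcal{D}$ has a unique extension to a state of $\mathcal{C}$ and no pure state of $\mathcal{C}$ annihilates $\mathcal{D}$. $(\mathcal{C},\mathcal{D})$ is a regular $C^*$-inclusion if $\mathcal{D}$ is a maximal abelian $C^*$-subalgebra of the unital $C^*$-algebra $\mathcal{C}$, $\mathcal{D}$ has the extension property in $\mathcal{C}$, and the closed linear span of $\mathcal{N}(\mathcal{C})$ is $\mathcal{C}$; then there is a unique conditional expectation $E:\mathcal{C}\to\mathcal{D}$. $\hat{\mathcal{D}}$ is the character space of $\mathcal{D}$; each $\rho\in\hat{\mathcal{D}}$ is also regarded as the state $\rho\circ E$ of $\mathcal{C}$. (In particular $\rho\circ\theta^{-1}$, for $\rho\in\hat{\mathcal{D}}_1$, is the character $\rho\circ(\theta|_{\mathcal{D}_1})^{-1}$ of $\mathcal{D}_2$.) For a norm-closed algebra $\mathcal{A}$ with $\mathcal{D}\subseteq\mathcal{A}\subseteq\mathcal{C}$, $\mathcal{E}^1(\mathcal{A})$ is the set of norm-one bounded functionals $\phi$ on $\mathcal{A}$ such that for each $d\in\mathcal{D}$ the functionals $x\mapsto\phi(dx)$,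 $x\mapsto\phi(xd)$ are multiples of $\phi$; then $\phi(dx)=r(\phi)(d)\phi(x)$ and $\phi(xd)=\phi(x)s(\phi)(d)$ for unique $r(\phi),s(\phi)\in\hat{\mathcal{D}}$ (range and source). For $v\in\mathcal{N}(\mathcal{A})$ and $\rho\in\hat{\mathcal{D}}$ with $\rho(v^*v)>0$, $[v,\rho]$ denotes the functional $x\mapsto\rho(v^*x)/\rho(v^*v)^{1/2}$ (restricted to $\mathcal{A}$); every $\phi\in\mathcal{E}^1(\mathcal{A})$ has this form, with $\rho=s(\phi)$. $\mathcal{E}^1(\mathcal{A})$ is a coordinate system: it has the relative weak-$*$ topology, the action of the circle group $\mathbb{T}$ by scalar multiplication, the maps $r,s$, and the partial product, defined when $s(\phi_1)=r(\phi_2)$ by $[v_1,\rho_1][v_2,\rho_2]=[v_1v_2,\rho_2]$ ($v_i\in\mathcal{N}(\mathcal{A})$). A bicontinuous isomorphism of coordinate systems $\gamma:\mathcal{E}^1(\mathcal{A}_1)\to\mathcal{E}^1(\mathcal{A}_2)$ is a homeomorphism commuting with the $\mathbb{T}$-actions, for which there is a homeomorphism $h:\hat{\mathcal{D}}_1\to\hat{\mathcal{D}}_2$ with $r(\gamma(\phi))=h(r(\phi))$ and $s(\gamma(\phi))=h(s(\phi))$, and such that $\gamma(\phi\psi)=\gamma(\phi)\gamma(\psi)$ for composable $\phi,\psi$. *)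

theory Defs
  imports "HOL-Analysis.Analysis" "HOL-Library.Complex_Order"
begin

section \<open>Unital C*-algebras\<close>

(* real_normed_algebra_1 and banach provide the complete normed ring together with its real
   scalars; scaleC_of_real makes the complex scalars extend the real ones. *)
class cstar_algebra = real_normed_algebra_1 + banach +
  fixes scaleC :: "complex \<Rightarrow> 'a \<Rightarrow> 'a"  (infixr \<open>*\<^sub>C\<close> 75)
    and adj :: "'a \<Rightarrow> 'a"
  assumes scaleC_add_right: "c *\<^sub>C (x + y) = c *\<^sub>C x + c *\<^sub>C y"
    and scaleC_add_left: "(c + c') *\<^sub>C x = c *\<^sub>C x + c' *\<^sub>C x"
    and scaleC_scaleC: "c *\<^sub>C (c' *\<^sub>C x) = (c * c') *\<^sub>C x"
    and scaleC_of_real: "complex_of_real t *\<^sub>C x = scaleR t x"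
    and norm_scaleC: "norm (c *\<^sub>C x) = cmod c * norm x"
    and mult_scaleC_left: "(c *\<^sub>C x) * y = c *\<^sub>C (x * y)"
    and mult_scaleC_right: "x * (c *\<^sub>C y) = c *\<^sub>C (x * y)"
    and adj_adj: "adj (adj x) = x"
    and adj_add: "adj (x + y) = adj x + adj y"
    and adj_scaleC: "adj (c *\<^sub>C x) = cnj c *\<^sub>C adj x"
    and adj_mult: "adj (x * y) = adj y * adj x"
    and cstar_identity: "norm (adj x * x) = (norm x)\<^sup>2"

lemma scaleC_one: "1 *\<^sub>C x = (x :: 'a :: cstar_algebra)"
  using scaleC_of_real[of 1 x] by simp

global_interpretation cvs: vector_space "scaleC :: complex \<Rightarrow> 'a \<Rightarrow> 'a :: cstar_algebra"
  defines csubspace = cvs.subspace and cspan = cvs.span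
  by unfold_locales
    (simp_all add: scaleC_add_right scaleC_add_left scaleC_scaleC scaleC_one)

instantiation complex :: cstar_algebra
begin

definition scaleC_complex :: "complex \<Rightarrow> complex \<Rightarrow> complex" where
  "scaleC_complex c z = c * z"

definition adj_complex :: "complex \<Rightarrow> complex" where
  "adj_complex = cnj"

instance
  by standard
    (simp_all add: scaleC_complex_def adj_complex_def algebra_simps scaleR_conv_of_real
      norm_mult power2_eq_square)

end


section \<open>Linear maps defined on a subset\<close>

(* With 'b = complex this is complex linearity of a functional on A. *)
definition clinear_on :: "'a::cstar_algebra set \<Rightarrow> ('a \<Rightarrow> 'b::cstar_algebra) \<Rightarrow> bool" where
  "clinear_on A f \<longleftrightarrow>
     (\<forall>x\<in>A. \<forall>y\<in>A. f (x + y) = f x + f y) \<and> (\<forall>c. \<forall>x\<in>A. f (c *\<^sub>C x) = c *\<^sub>C f x)"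

definition bounded_on :: "'a::cstar_algebra set \<Rightarrow> ('a \<Rightarrow> 'b::cstar_algebra) \<Rightarrow> bool" where
  "bounded_on A f \<longleftrightarrow> (\<exists>K. \<forall>x\<in>A. norm (f x) \<le> K * norm x)"

(* Functionals on A are functions that are undefined outside A, so that equality of functions is
   equality on A. *)
definition bounded_functionals :: "'a::cstar_algebra set \<Rightarrow> ('a \<Rightarrow> complex) set" where
  "bounded_functionals A = {\<phi> \<in> extensional A. clinear_on A \<phi> \<and> bounded_on A \<phi>}"

(* The operator norm if phi is bounded on A; an unspecified real otherwise. *)
definition functional_norm :: "'a::cstar_algebra set \<Rightarrow> ('a \<Rightarrow> complex) \<Rightarrow> real" where
  "functional_norm A \<phi> = Sup {cmod (\<phi> x) | x. x \<in> A \<and> norm x \<le> 1}"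

(* For F a set of functionals on A: the relative weak-* topology on F. *)
definition weak_star_topology ::
    "'a::cstar_algebra set \<Rightarrow> ('a \<Rightarrow> complex) set \<Rightarrow> ('a \<Rightarrow> complex) topology" where
  "weak_star_topology A F = subtopology (product_topology (\<lambda>_. euclidean) A) F"


section \<open>Regular inclusions\<close>

definition norm_closed_subalgebra :: "'a::cstar_algebra set \<Rightarrow> bool" where
  "norm_closed_subalgebra A \<longleftrightarrow>
     csubspace A \<and> closed A \<and> (\<forall>x\<in>A. \<forall>y\<in>A. x * y \<in> A)"

definition abelian_cstar_subalgebra :: "'a::cstar_algebra set \<Rightarrow> bool" where
  "abelian_cstar_subalgebra D \<longleftrightarrow>
     norm_closed_subalgebra D \<and> (\<forall>x\<in>D. adj x \<in> D) \<and> (\<forall>x\<in>D. \<forall>y\<in>D. x * y = y * x)"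

definition maximal_abelian_cstar_subalgebra :: "'a::cstar_algebra set \<Rightarrow> bool" where
  "maximal_abelian_cstar_subalgebra D \<longleftrightarrow>
     abelian_cstar_subalgebra D \<and>
     (\<forall>D'. abelian_cstar_subalgebra D' \<longrightarrow> D \<subseteq> D' \<longrightarrow> D' = D)"

definition normalizers :: "'a::cstar_algebra set \<Rightarrow> 'a set \<Rightarrow> 'a set" where
  "normalizers D M = {v \<in> M. \<forall>d\<in>D. v * d * adj v \<in> D \<and> adj v * d * v \<in> D}"

(* For B a C*-subalgebra; the order on complex is that of Complex_Order, so 0 \<le> z means that z
   is real and nonnegative. *)
definition states :: "'a::cstar_algebra set \<Rightarrow> ('a \<Rightarrow> complex) set" where
  "states B = {\<phi> \<in> bounded_functionals B.
     (\<forall>x\<in>B. 0 \<le> \<phi> (adj x * x)) \<and> functional_norm B \<phi> = 1}"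

(* Extreme points of the state space. *)
definition pure_states :: "'a::cstar_algebra set \<Rightarrow> ('a \<Rightarrow> complex) set" where
  "pure_states B = {\<phi> \<in> states B.
     \<forall>\<psi>1\<in>states B. \<forall>\<psi>2\<in>states B. \<forall>t::real. 0 < t \<longrightarrow> t < 1 \<longrightarrow>
       (\<forall>x\<in>B. \<phi> x = of_real t * \<psi>1 x + of_real (1 - t) * \<psi>2 x) \<longrightarrow> \<psi>1 = \<phi> \<and> \<psi>2 = \<phi>}"

definition extension_property :: "'a::cstar_algebra set \<Rightarrow> bool" where
  "extension_property D \<longleftrightarrow>
     (\<forall>\<rho>\<in>pure_states D. \<exists>!\<phi>. \<phi> \<in> states UNIV \<and> restrict \<phi> D = \<rho>) \<and>
     (\<forall>\<phi>\<in>pure_states UNIV. \<exists>d\<in>D. \<phi> d \<noteq> 0)"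

definition regular_inclusion :: "'a::cstar_algebra set \<Rightarrow> bool" where
  "regular_inclusion D \<longleftrightarrow>
     1 \<in> D \<and> maximal_abelian_cstar_subalgebra D \<and> extension_property D \<and>
     closure (cspan (normalizers D UNIV)) = UNIV"

(* An element of D is positive iff it has the form adj d * d with d in D. *)
definition is_conditional_expectation :: "'a::cstar_algebra set \<Rightarrow> ('a \<Rightarrow> 'a) \<Rightarrow> bool" where
  "is_conditional_expectation D E \<longleftrightarrow>
     clinear_on UNIV E \<and> (\<forall>x. E x \<in> D) \<and> (\<forall>d\<in>D. E d = d) \<and>
     (\<forall>x. norm (E x) \<le> norm x) \<and>
     (\<forall>x. \<exists>d\<in>D. E (adj x * x) = adj d * d) \<and>
     (\<forall>x. \<forall>d\<in>D. E (d * x) = d * E x \<and> E (x * d) = E x * d)"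

definition cond_exp :: "'a::cstar_algebra set \<Rightarrow> 'a \<Rightarrow> 'a" where
  "cond_exp D = (THE E. is_conditional_expectation D E)"

definition characters :: "'a::cstar_algebra set \<Rightarrow> ('a \<Rightarrow> complex) set" where
  "characters D = {\<rho> \<in> extensional D.
     clinear_on D \<rho> \<and> (\<forall>x\<in>D. \<forall>y\<in>D. \<rho> (x * y) = \<rho> x * \<rho> y) \<and> (\<exists>x\<in>D. \<rho> x \<noteq> 0)}"

(* The character rho of D, regarded as a state of the whole algebra. *)
definition char_state :: "'a::cstar_algebra set \<Rightarrow> ('a \<Rightarrow> complex) \<Rightarrow> 'a \<Rightarrow> complex" where
  "char_state D \<rho> = (\<lambda>x. \<rho> (cond_exp D x))"


section \<open>The coordinate system of norm-one eigenfunctionals\<close>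

definition eigenfunctionals1 ::
    "'a::cstar_algebra set \<Rightarrow> 'a set \<Rightarrow> ('a \<Rightarrow> complex) set" where
  "eigenfunctionals1 D A = {\<phi> \<in> bounded_functionals A.
     functional_norm A \<phi> = 1 \<and>
     (\<forall>d\<in>D. (\<exists>c. \<forall>x\<in>A. \<phi> (d * x) = c * \<phi> x) \<and> (\<exists>c. \<forall>x\<in>A. \<phi> (x * d) = c * \<phi> x))}"

definition eig_range ::
    "'a::cstar_algebra set \<Rightarrow> 'a set \<Rightarrow> ('a \<Rightarrow> complex) \<Rightarrow> 'a \<Rightarrow> complex" where
  "eig_range D A \<phi> = (THE \<rho>. \<rho> \<in> characters D \<and> (\<forall>d\<in>D. \<forall>x\<in>A. \<phi> (d * x) = \<rho> d * \<phi> x))"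

definition eig_source ::
    "'a::cstar_algebra set \<Rightarrow> 'a set \<Rightarrow> ('a \<Rightarrow> complex) \<Rightarrow> 'a \<Rightarrow> complex" where
  "eig_source D A \<phi> = (THE \<rho>. \<rho> \<in> characters D \<and> (\<forall>d\<in>D. \<forall>x\<in>A. \<phi> (x * d) = \<phi> x * \<rho> d))"

(* The functional [v, rho] on A; meant for v a normalizer in A and rho a character of D with
   rho(v* v) > 0. *)
definition coord ::
    "'a::cstar_algebra set \<Rightarrow> 'a set \<Rightarrow> 'a \<Rightarrow> ('a \<Rightarrow> complex) \<Rightarrow> 'a \<Rightarrow> complex" where
  "coord D A v \<rho> =
     (\<lambda>x\<in>A. char_state D \<rho> (adj v * x) / csqrt (char_state D \<rho> (adj v * v)))"

definition circle_action ::
    "'a::cstar_algebra set \<Rightarrow> complex \<Rightarrow> ('a \<Rightarrow> complex) \<Rightarrow> 'a \<Rightarrow> complex" where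
  "circle_action A c \<phi> = (\<lambda>x\<in>A. c * \<phi> x)"

(* Meant for eigenfunctionals with eig_source phi1 = eig_range phi2. *)
definition eig_mult ::
    "'a::cstar_algebra set \<Rightarrow> 'a set \<Rightarrow> ('a \<Rightarrow> complex) \<Rightarrow> ('a \<Rightarrow> complex) \<Rightarrow> 'a \<Rightarrow> complex"
  where
  "eig_mult D A \<phi>1 \<phi>2 = (THE \<psi>. \<exists>v1\<in>normalizers D A. \<exists>v2\<in>normalizers D A.
     \<exists>\<rho>1\<in>characters D. \<exists>\<rho>2\<in>characters D.
       0 < char_state D \<rho>1 (adj v1 * v1) \<and> \<phi>1 = coord D A v1 \<rho>1 \<and>
       0 < char_state D \<rho>2 (adj v2 * v2) \<and> \<phi>2 = coord D A v2 \<rho>2 \<and>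
       \<psi> = coord D A (v1 * v2) \<rho>2)"

definition bicontinuous_isomorphism ::
    "'a::cstar_algebra set \<Rightarrow> 'a set \<Rightarrow> 'b::cstar_algebra set \<Rightarrow> 'b set \<Rightarrow>
     (('a \<Rightarrow> complex) \<Rightarrow> 'b \<Rightarrow> complex) \<Rightarrow> bool" where
  "bicontinuous_isomorphism D1 A1 D2 A2 \<gamma> \<longleftrightarrow>
     homeomorphic_map (weak_star_topology A1 (eigenfunctionals1 D1 A1))
       (weak_star_topology A2 (eigenfunctionals1 D2 A2)) \<gamma> \<and>
     (\<forall>c. \<forall>\<phi>\<in>eigenfunctionals1 D1 A1. cmod c = 1 \<longrightarrow>
        \<gamma> (circle_action A1 c \<phi>) = circle_action A2 c (\<gamma> \<phi>)) \<and>
     (\<exists>h. homeomorphic_map (weak_star_topology D1 (characters D1))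
            (weak_star_topology D2 (characters D2)) h \<and>
        (\<forall>\<phi>\<in>eigenfunctionals1 D1 A1.
           eig_range D2 A2 (\<gamma> \<phi>) = h (eig_range D1 A1 \<phi>) \<and>
           eig_source D2 A2 (\<gamma> \<phi>) = h (eig_source D1 A1 \<phi>))) \<and>
     (\<forall>\<phi>\<in>eigenfunctionals1 D1 A1. \<forall>\<psi>\<in>eigenfunctionals1 D1 A1.
        eig_source D1 A1 \<phi> = eig_range D1 A1 \<psi> \<longrightarrow>
        \<gamma> (eig_mult D1 A1 \<phi> \<psi>) = eig_mult D2 A2 (\<gamma> \<phi>) (\<gamma> \<psi>))"


section \<open>Bounded isomorphisms\<close>

definition bounded_algebra_isomorphism ::
    "'a::cstar_algebra set \<Rightarrow> 'b::cstar_algebra set \<Rightarrow> ('a \<Rightarrow> 'b) \<Rightarrow> bool" where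
  "bounded_algebra_isomorphism A B \<theta> \<longleftrightarrow>
     clinear_on A \<theta> \<and> (\<forall>x\<in>A. \<forall>y\<in>A. \<theta> (x * y) = \<theta> x * \<theta> y) \<and>
     bij_betw \<theta> A B \<and> bounded_on A \<theta>"

(* phi o theta^(-1), where phi is a functional on A and theta maps A injectively. *)
definition pullback_inv ::
    "('a::cstar_algebra \<Rightarrow> 'b::cstar_algebra) \<Rightarrow> 'a set \<Rightarrow> ('a \<Rightarrow> complex) \<Rightarrow> 'b \<Rightarrow> complex" where
  "pullback_inv \<theta> A \<phi> = (\<lambda>y\<in>\<theta> ` A. \<phi> (inv_into A \<theta> y))"

end

theory Submission
  imports Defs
begin

text \<open>
  Let \<open>\<phi>\<close> be a norm-one eigenfunctional on \<open>A\<close> with source \<open>\<rho>\<close>. If \<open>v \<in> A\<close> is a normalizer with \<open>\<phi>(v) > 0\<close>, then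
  \<open>\<phi> = [v, \<rho>]\<close>; so \<open>\<phi>\<close> is determined by its source and one such normalizer (lemma
  \<open>eigenfunctional_is_coord\<close>). An isomorphism \<open>\<theta>\<close> as in the theorem maps \<open>D\<^sub>1\<close> to \<open>D\<^sub>2\<close>, where it is automatically
  a *-isomorphism, since characters are hermitian and separate points (\<open>\<theta>_adj\<close>). It also maps normalizers to
  normalizers (\<open>\<theta>_normalizer\<close>). Therefore the normalized functional \<open>\<phi> \<circ> \<theta>\<^sup>-\<^sup>1\<close> is an eigenfunctional with source
  \<open>\<rho> \<circ> \<theta>\<^sup>-\<^sup>1\<close> that is positive at the normalizer \<open>\<theta>(v)\<close>; that is, it equals \<open>[\<theta>(v), \<rho> \<circ> \<theta>\<^sup>-\<^sup>1]\<close>. From this the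
  product formula follows, and so does continuity: the normalizing constant can be computed from the value of
  the source at \<open>\<theta>(v)\<^sup>* \<theta>(v)\<close> (\<open>transport_formula\<close>). The same applies to \<open>\<theta>\<^sup>-\<^sup>1\<close>, which is bounded by the open
  mapping argument.

  Normalizers are preserved for the following reason. For a normalizer \<open>v\<close> and hermitian \<open>h \<in> D\<^sub>1\<close> the relation
  \<open>v (h v\<^sup>* v) = (v h v\<^sup>*) v\<close> intertwines two hermitian elements of \<open>D\<^sub>1\<close>, and it survives the application of \<open>\<theta>\<close>
  although \<open>v\<^sup>*\<close> need not belong to \<open>A\<^sub>1\<close>. Conversely, for an element \<open>w\<close> with enough relations of this kind,
  \<open>w\<^sup>* e w\<close> commutes with \<open>D\<^sub>2\<close> for every \<open>e \<in> D\<^sub>2\<close>, and so belongs to the maximal abelian algebra \<open>D\<^sub>2\<close>.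

  The identity \<open>\<phi> = [v, \<rho>]\<close> comes from averaging: the conditional expectation satisfies
  \<open>E(y) = lim \<Sum> g y g\<close>, with hermitian \<open>g \<in> D\<close> and \<open>\<Sum> g\<^sup>2 = 1\<close> (\<open>expectation_averaging\<close>). Applied to \<open>y = v\<^sup>* x\<close>, it
  yields \<open>\<phi>(v) \<rho>(E(v\<^sup>* x)) = \<rho>(v\<^sup>* v) \<phi>(x)\<close>, because \<open>v g v\<^sup>* x g\<close> arises from \<open>x\<close> by multiplication with elements of
  \<open>D\<close> on both sides. It has to be shown as well that \<open>\<phi>\<close> does not vanish at all normalizers in \<open>A\<close>. A
  norm-preserving extension of \<open>\<phi>\<close> to the whole algebra is again an eigenfunctional
  (\<open>eigenfunctional_extension\<close>), so by regularity it is nonzero at a normalizer \<open>v\<close> of the whole algebra; by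
  averaging, \<open>v E(v\<^sup>* x)\<close> is then a suitable normalizer in \<open>A\<close>.

  Averaging in turn rests on the uniqueness of state extensions. For hermitian \<open>x\<close> let \<open>p(x)\<close> be the infimum of
  the numbers \<open>t\<close> for which \<open>h (t - x) h\<close> is positive for some hermitian \<open>h \<in> D\<close> with \<open>\<rho>(h) \<noteq> 0\<close>. Every linear
  functional below \<open>p\<close> comes from a state that extends \<open>\<rho>\<close>. So there is only one, and by the Hahn--Banach theorem
  \<open>p\<close> coincides with it (\<open>compression_inf_ext_state\<close>). Thus compressions bring \<open>y\<close> close to a scalar near every
  character, and a partition of unity combines them.

  The positivity and the Gelfand theory behind these arguments are built from the norm alone. Characters of an
  abelian C*-algebra arise from maximal preorderings of its hermitian part, which exist by Zorn's lemma, and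
  the positivity of \<open>x\<^sup>* x\<close> follows from the abelian theory applied to bicommutants.
\<close>

section \<open>Adjoints and complex scalars\<close>

lemma adj_zero [simp]: "adj (0 :: 'a::cstar_algebra) = 0"
  using adj_add[of "0::'a" 0] by simp

lemma adj_minus [simp]: "adj (- x) = - adj (x :: 'a::cstar_algebra)"
proof -
  have "adj x + adj (- x) = 0"
    by (simp flip: adj_add)
  then show ?thesis
    by (simp add: eq_neg_iff_add_eq_0 add.commute)
qed

lemma adj_diff: "adj (x - y) = adj x - adj (y :: 'a::cstar_algebra)"
  using adj_add[of x "- y"] by simp

lemma adj_one [simp]: "adj (1 :: 'a::cstar_algebra) = 1"
proof -
  have "adj (1::'a) = adj 1 * adj (adj 1)"
    by (simp add: adj_adj)
  also have "\<dots> = adj (adj 1 * 1)"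
    by (simp only: adj_mult)
  also have "\<dots> = 1"
    by (simp add: adj_adj)
  finally show ?thesis .
qed

lemma adj_scaleR [simp]: "adj (t *\<^sub>R x) = t *\<^sub>R adj (x :: 'a::cstar_algebra)"
  using adj_scaleC[of "complex_of_real t" x] by (simp add: scaleC_of_real)

lemma adj_of_real [simp]: "adj (of_real t :: 'a::cstar_algebra) = of_real t"
  by (simp add: of_real_def)

lemma norm_adj [simp]: "norm (adj x) = norm (x :: 'a::cstar_algebra)"
proof -
  have le: "norm y \<le> norm (adj y)" for y :: 'a
  proof (cases "y = 0")
    case False
    have "(norm y)\<^sup>2 \<le> norm (adj y) * norm y"
      using norm_mult_ineq[of "adj y" y] by (simp add: cstar_identity)
    then show ?thesis
      using False by (simp add: power2_eq_square)
  qed simp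
  show ?thesis
    using le[of x] le[of "adj x"] by (simp add: adj_adj)
qed

lemma cstar_identity': "norm (x * adj x) = (norm (x :: 'a::cstar_algebra))\<^sup>2"
  using cstar_identity[of "adj x"] by (simp add: adj_adj)

lemma bounded_linear_adj: "bounded_linear (adj :: 'a::cstar_algebra \<Rightarrow> 'a)"
  by (rule bounded_linear_intro[where K = 1]) (simp_all add: adj_add)

lemmas tendsto_adj [tendsto_intros] = bounded_linear.tendsto[OF bounded_linear_adj]
lemmas continuous_on_adj [continuous_intros] =
  bounded_linear.continuous_on[OF bounded_linear_adj]

lemma bounded_linear_scaleC: "bounded_linear ((*\<^sub>C) c :: 'a::cstar_algebra \<Rightarrow> 'a)"
proof (rule bounded_linear_intro[where K = "cmod c"])
  show "c *\<^sub>C (r *\<^sub>R x) = r *\<^sub>R (c *\<^sub>C x)" for r and x :: 'a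
    by (simp add: scaleC_scaleC mult.commute flip: scaleC_of_real)
qed (simp_all add: scaleC_add_right norm_scaleC mult.commute)

lemma scaleR_eq_scaleC: "t *\<^sub>R x = complex_of_real t *\<^sub>C (x :: 'a::cstar_algebra)"
  by (simp add: scaleC_of_real)

lemma of_real_eq_scaleC: "(of_real t :: 'a::cstar_algebra) = complex_of_real t *\<^sub>C 1"
  by (simp only: of_real_def[where 'a = 'a] scaleC_of_real)

lemma of_real_mult_eq_scaleR: "of_real t * x = t *\<^sub>R (x :: 'a::cstar_algebra)"
  by (simp add: of_real_def)

lemma mult_of_real_eq_scaleR: "x * of_real t = t *\<^sub>R (x :: 'a::cstar_algebra)"
  by (simp add: of_real_def)

definition re_part :: "'a::cstar_algebra \<Rightarrow> 'a" where
  "re_part x = (1/2) *\<^sub>R (x + adj x)"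

definition im_part :: "'a::cstar_algebra \<Rightarrow> 'a" where
  "im_part x = re_part ((- \<i>) *\<^sub>C x)"

lemma adj_re_part [simp]: "adj (re_part x) = re_part x"
  by (simp add: re_part_def adj_add adj_adj add.commute)

lemma adj_im_part [simp]: "adj (im_part x) = im_part x"
  by (simp add: im_part_def)

lemma re_im_decomp: "x = re_part x + \<i> *\<^sub>C im_part x"
proof -
  have "\<i> *\<^sub>C im_part x = (1/2) *\<^sub>R (x - adj x)"
    by (simp add: im_part_def re_part_def adj_scaleC scaleR_eq_scaleC scaleC_add_right scaleC_scaleC
        cvs.scale_right_diff_distrib)
  then show ?thesis
    by (simp add: re_part_def flip: scaleR_right_distrib scaleR_2)
qed

lemma re_part_herm [simp]: "adj x = x \<Longrightarrow> re_part x = x"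
  by (simp add: re_part_def flip: scaleR_2)

lemma im_part_herm [simp]: "adj x = x \<Longrightarrow> im_part x = 0"
  by (simp add: im_part_def re_part_def adj_scaleC flip: scaleC_add_left)

lemma re_im_part_unique:
  assumes "adj a = a" "adj b = b"
  shows "re_part (a + \<i> *\<^sub>C b) = a" "im_part (a + \<i> *\<^sub>C b) = b"
proof -
  have re: "re_part (c + \<i> *\<^sub>C d) = c" if "adj c = c" "adj d = d" for c d :: 'a
    using that by (simp add: re_part_def adj_add adj_scaleC flip: scaleR_2)
  show "re_part (a + \<i> *\<^sub>C b) = a"
    using re assms by blast
  have "(- \<i>) *\<^sub>C (a + \<i> *\<^sub>C b) = b + \<i> *\<^sub>C (- a)"
    by (simp add: scaleC_add_right scaleC_scaleC)
  then show "im_part (a + \<i> *\<^sub>C b) = b"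
    using re[of b "- a"] assms by (simp only: im_part_def adj_minus)
qed

lemma re_part_add: "re_part (x + y) = re_part x + re_part y"
  by (simp add: re_part_def adj_add algebra_simps)

lemma im_part_add: "im_part (x + y) = im_part x + im_part y"
  by (simp only: im_part_def scaleC_add_right re_part_add)

lemma re_part_scaleR: "re_part (t *\<^sub>R x) = t *\<^sub>R re_part x"
  by (simp add: re_part_def algebra_simps)

lemma re_part_minus: "re_part (- x) = - re_part x"
  using re_part_scaleR[of "-1" x] by simp

lemma norm_re_part: "norm (re_part x) \<le> norm x"
proof -
  have "norm (re_part x) = (1/2) * norm (x + adj x)"
    by (simp add: re_part_def)
  also have "\<dots> \<le> (1/2) * (norm x + norm (adj x))"
    by (intro mult_left_mono norm_triangle_ineq) simp
  finally show ?thesis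
    by simp
qed

lemma norm_im_part: "norm (im_part x) \<le> norm x"
  unfolding im_part_def by (rule order_trans[OF norm_re_part]) (simp add: norm_scaleC)

text \<open>
  For commuting hermitian \<open>a\<close> and \<open>b\<close> the element \<open>a + \<i> b\<close> is normal, and the C*-identity turns
  the norm of \<open>a\<^sup>2 + b\<^sup>2\<close> into a bound for both parts.
\<close>

lemma norm_herm_plus_ii:
  fixes a b :: "'a::cstar_algebra"
  assumes "adj a = a" "adj b = b" "a * b = b * a"
  shows "(norm (a + \<i> *\<^sub>C b))\<^sup>2 = norm (a * a + b * b)"
proof -
  have "adj (a + \<i> *\<^sub>C b) * (a + \<i> *\<^sub>C b) = a * a + b * b"
    using assms
    by (simp add: adj_add adj_scaleC algebra_simps mult_scaleC_left mult_scaleC_right scaleC_scaleC)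
  then show ?thesis
    by (metis cstar_identity)
qed

lemma norm_le_norm_sum_squares:
  fixes a b :: "'a::cstar_algebra"
  assumes "adj a = a" "adj b = b" "a * b = b * a"
  shows "(norm a)\<^sup>2 \<le> norm (a * a + b * b)" and "(norm b)\<^sup>2 \<le> norm (a * a + b * b)"
proof -
  have re: "re_part (a + \<i> *\<^sub>C b) = a"
    using assms by (simp add: re_part_def adj_add adj_scaleC flip: scaleR_2)
  show le: "(norm a)\<^sup>2 \<le> norm (a * a + b * b)"
    unfolding norm_herm_plus_ii[OF assms, symmetric]
    using norm_re_part[of "a + \<i> *\<^sub>C b"] unfolding re by (intro power_mono) auto
  have re': "re_part (b + \<i> *\<^sub>C a) = b"
    using assms by (simp add: re_part_def adj_add adj_scaleC flip: scaleR_2)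
  have "(norm b)\<^sup>2 \<le> (norm (b + \<i> *\<^sub>C a))\<^sup>2"
    using norm_re_part[of "b + \<i> *\<^sub>C a"] unfolding re' by (intro power_mono) auto
  also have "\<dots> = norm (a * a + b * b)"
    using assms by (subst norm_herm_plus_ii) (auto simp: add.commute)
  finally show "(norm b)\<^sup>2 \<le> norm (a * a + b * b)" .
qed


section \<open>The positive cone\<close>

text \<open>
  Positivity means that the element is hermitian and lies in the ball of some radius \<open>t\<close> around \<open>t\<close>; for real
  functions this is pointwise nonnegativity. The definition mentions only the norm, so it does not depend on a
  spectrum or on a surrounding subalgebra, and sums of positive elements are positive by the triangle
  inequality.
\<close>

definition pos :: "'a::cstar_algebra \<Rightarrow> bool" where
  "pos a \<longleftrightarrow> adj a = a \<and> (\<exists>t\<ge>0. norm (of_real t - a) \<le> t)"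

lemma pos_herm: "pos a \<Longrightarrow> adj a = a"
  by (simp add: pos_def)

lemma pos_norm_upward:
  fixes a :: "'a::cstar_algebra"
  assumes "norm (of_real s - a) \<le> s" "s \<le> t"
  shows "norm (of_real t - a) \<le> t"
proof -
  have "norm (of_real t - a) = norm (of_real (t - s) + (of_real s - a))"
    by (simp add: algebra_simps)
  also have "\<dots> \<le> (t - s) + s"
    using assms norm_triangle_ineq[of "of_real (t - s)" "of_real s - a"]
    by (simp del: of_real_diff add: norm_of_real)
  finally show ?thesis
    by simp
qed

lemma posE:
  assumes "pos a"
  obtains t where "t \<ge> c" "t > 0" "norm (of_real t - a) \<le> t"
proof -
  obtain t where t: "t \<ge> 0" "norm (of_real t - a) \<le> t"
    using assms by (auto simp: pos_def)
  have "norm (of_real (max (max 1 c) t) - a) \<le> max (max 1 c) t"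
    by (rule pos_norm_upward[OF t(2)]) simp
  then show thesis
    using that[of "max (max 1 c) t"] by auto
qed

lemma pos_add:
  assumes "pos a" "pos b"
  shows "pos (a + b)"
proof -
  obtain s t where s: "s > 0" "norm (of_real s - a) \<le> s" and t: "t > 0" "norm (of_real t - b) \<le> t"
    using assms posE[of _ 0] by metis
  have "norm (of_real (s + t) - (a + b)) = norm ((of_real s - a) + (of_real t - b))"
    by (simp add: algebra_simps)
  also have "\<dots> \<le> s + t"
    using norm_triangle_ineq[of "of_real s - a" "of_real t - b"] s t by linarith
  finally show ?thesis
    using assms s t unfolding pos_def by (auto simp: adj_add intro!: exI[of _ "s + t"])
qed

lemma pos_scaleR:
  fixes a :: "'a::cstar_algebra"
  assumes "pos a" "c \<ge> 0"
  shows "pos (c *\<^sub>R a)"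
proof -
  obtain t where t: "t > 0" "norm (of_real t - a) \<le> t"
    using assms posE[of _ 0] by metis
  have "norm (of_real (c * t) - c *\<^sub>R a) = norm (c *\<^sub>R (of_real t - a))"
    by (simp add: of_real_def algebra_simps)
  also have "\<dots> \<le> c * t"
    using assms t by (simp add: mult_left_mono)
  finally show ?thesis
    using assms t unfolding pos_def by (auto intro!: exI[of _ "c * t"])
qed

lemma pos_of_real [simp]: "t \<ge> 0 \<Longrightarrow> pos (of_real t)"
  by (auto simp: pos_def intro!: exI[of _ t])

lemma pos_0 [simp]: "pos 0"
  using pos_of_real[of 0] by simp

lemma pos_1 [simp]: "pos 1"
  using pos_of_real[of 1] by simp

lemma pos_sum: "(\<And>i. i \<in> I \<Longrightarrow> pos (f i)) \<Longrightarrow> pos (\<Sum>i\<in>I. f i)"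
  by (induction I rule: infinite_finite_induct) (simp_all add: pos_add)

lemma pos_norm_minus:
  fixes a :: "'a::cstar_algebra"
  assumes "adj a = a" "norm a \<le> c"
  shows "pos (of_real c - a)" "pos (of_real c + a)"
proof -
  have "c \<ge> 0"
    using assms norm_ge_zero order_trans by blast
  then show "pos (of_real c - a)" "pos (of_real c + a)"
    using assms unfolding pos_def by (auto simp: adj_diff adj_add intro!: exI[of _ c])
qed


section \<open>Unital abelian C*-subalgebras\<close>

locale abelian_cstar =
  fixes B :: "'a::cstar_algebra set"
  assumes abelian: "abelian_cstar_subalgebra B" and one_mem [simp]: "1 \<in> B"
begin

lemma closed_B: "closed B"
  using abelian by (simp add: abelian_cstar_subalgebra_def norm_closed_subalgebra_def)

lemma csubspace_B: "csubspace B"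
  using abelian by (simp add: abelian_cstar_subalgebra_def norm_closed_subalgebra_def)

lemma zero_mem [simp]: "0 \<in> B"
  by (rule cvs.subspace_0[OF csubspace_B])

lemma add_mem [simp]: "x \<in> B \<Longrightarrow> y \<in> B \<Longrightarrow> x + y \<in> B"
  by (rule cvs.subspace_add[OF csubspace_B])

lemma scaleC_mem [simp]: "x \<in> B \<Longrightarrow> c *\<^sub>C x \<in> B"
  by (rule cvs.subspace_scale[OF csubspace_B])

lemma mult_mem [simp]: "x \<in> B \<Longrightarrow> y \<in> B \<Longrightarrow> x * y \<in> B"
  using abelian by (simp add: abelian_cstar_subalgebra_def norm_closed_subalgebra_def)

lemma adj_mem [simp]: "x \<in> B \<Longrightarrow> adj x \<in> B"
  using abelian by (simp add: abelian_cstar_subalgebra_def)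

lemma commute: "x \<in> B \<Longrightarrow> y \<in> B \<Longrightarrow> x * y = y * x"
  using abelian by (simp add: abelian_cstar_subalgebra_def)

lemma left_commute: "x \<in> B \<Longrightarrow> y \<in> B \<Longrightarrow> x * (y * z) = y * (x * z)"
  by (metis commute mult.assoc)

lemma scaleR_mem [simp]: "x \<in> B \<Longrightarrow> t *\<^sub>R x \<in> B"
  by (simp add: scaleR_eq_scaleC)

lemma of_real_mem [simp]: "of_real t \<in> B"
  by (simp add: of_real_def)

lemma minus_mem [simp]: "x \<in> B \<Longrightarrow> - x \<in> B"
  using scaleR_mem[of x "-1"] by simp

lemma diff_mem [simp]: "x \<in> B \<Longrightarrow> y \<in> B \<Longrightarrow> x - y \<in> B"
  using add_mem[of x "- y"] by simp

lemma sum_mem: "(\<And>i. i \<in> I \<Longrightarrow> f i \<in> B) \<Longrightarrow> (\<Sum>i\<in>I. f i) \<in> B"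
  by (induction I rule: infinite_finite_induct) simp_all

lemma power_mem [simp]: "x \<in> B \<Longrightarrow> x ^ n \<in> B"
  by (induction n) simp_all

lemma re_part_mem [simp]: "x \<in> B \<Longrightarrow> re_part x \<in> B"
  by (simp add: re_part_def)

lemma im_part_mem [simp]: "x \<in> B \<Longrightarrow> im_part x \<in> B"
  by (simp add: im_part_def)

lemma adj_mult_herm: "x \<in> B \<Longrightarrow> y \<in> B \<Longrightarrow> adj x = x \<Longrightarrow> adj y = y \<Longrightarrow> adj (x * y) = x * y"
  by (simp add: adj_mult commute)

text \<open>
  The Neumann series and the binomial series of the square root are replaced by fixed points of the
  contractions \<open>x \<mapsto> 1 + z x\<close> and \<open>y \<mapsto> (z + y\<^sup>2)/2\<close>, the root of \<open>1 - z\<close> being \<open>1 - y\<close>; the fixed points lie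
  in \<open>B\<close> because \<open>B\<close> is complete.
\<close>

lemma inverse_one_minus:
  assumes "z \<in> B" "norm z < 1"
  obtains x where "x \<in> B" "x * (1 - z) = 1"
proof -
  have "\<exists>!x\<in>B. 1 + z * x = x"
  proof (rule Banach_fix)
    show "complete B"
      using closed_B by (simp add: complete_eq_closed)
    show "dist (1 + z * x) (1 + z * y) \<le> norm z * dist x y" if "x \<in> B" "y \<in> B" for x y
      by (simp add: dist_norm norm_mult_ineq flip: right_diff_distrib)
  qed (use assms zero_mem in auto)
  then obtain x where x: "x \<in> B" "1 + z * x = x"
    by blast
  then have "x * (1 - z) = 1"
    using commute[of x z] assms by (simp add: right_diff_distrib) (metis add_diff_cancel_right')
  then show thesis
    using that x by blast
qed

lemma sqrt_one_minus:
  assumes "z \<in> B" "adj z = z" "norm z < 1"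
  obtains s where "s \<in> B" "pos s" "s * s = 1 - z"
proof -
  define r where "r = norm z"
  define C where "C = {y \<in> B. adj y = y \<and> norm y \<le> r}"
  have "closed {y. adj y = y}"
    by (intro closed_Collect_eq continuous_intros)
  then have "closed C"
    using closed_Int[OF closed_Int[OF closed_B, of "{y. adj y = y}"] closed_cball[of 0 r]]
    by (simp add: C_def Collect_conj_eq Int_assoc cball_def)
  have "\<exists>!y\<in>C. (1/2) *\<^sub>R (z + y * y) = y"
  proof (rule Banach_fix)
    show "complete C"
      using \<open>closed C\<close> by (simp add: complete_eq_closed)
    show "C \<noteq> {}"
      by (auto simp: C_def r_def intro!: exI[of _ 0])
    show "0 \<le> r" "r < 1"
      using assms by (auto simp: r_def)
    show "(\<lambda>y. (1/2) *\<^sub>R (z + y * y)) ` C \<subseteq> C"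
    proof safe
      fix y assume y: "y \<in> C"
      then have "norm (y * y) \<le> r * r"
        using norm_mult_ineq[of y y] mult_mono[of "norm y" r "norm y" r] by (auto simp: C_def)
      also have "\<dots> \<le> r * 1"
        using \<open>r < 1\<close> by (intro mult_left_mono) (auto simp: r_def)
      finally have "norm (z + y * y) \<le> r + r"
        using norm_triangle_ineq[of z "y * y"] by (simp add: r_def)
      then show "(1/2) *\<^sub>R (z + y * y) \<in> C"
        using y assms by (simp add: C_def adj_add adj_mult)
    qed
    fix x y assume xy: "x \<in> C" "y \<in> C"
    then have eq: "x * x - y * y = (x + y) * (x - y)"
      using commute[of x y] by (simp add: C_def algebra_simps)
    have "norm (x + y) \<le> r + r"
      using xy norm_triangle_ineq[of x y] by (auto simp: C_def)
    then have "norm (x * x - y * y) \<le> (r + r) * norm (x - y)"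
      unfolding eq using norm_mult_ineq[of "x + y" "x - y"] mult_right_mono norm_ge_zero order_trans
      by metis
    then show "dist ((1/2) *\<^sub>R (z + x * x)) ((1/2) *\<^sub>R (z + y * y)) \<le> r * dist x y"
      by (simp add: dist_norm flip: scaleR_diff_right)
  qed
  then obtain y where y: "y \<in> B" "adj y = y" "norm y \<le> r" and fp: "(1/2) *\<^sub>R (z + y * y) = y"
    unfolding C_def by blast
  have "z + y * y = 2 *\<^sub>R ((1/2) *\<^sub>R (z + y * y))"
    by simp
  then have "z + y * y = y + y"
    unfolding fp by (simp add: scaleR_2)
  then have "(1 - y) * (1 - y) = 1 - z"
    by (simp add: algebra_simps)
  moreover have "pos (1 - y)"
    using pos_norm_minus(1)[of y 1] y assms by (simp add: r_def)
  ultimately show thesis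
    using that[of "1 - y"] y by simp
qed

text \<open>
  After scaling \<open>h\<close> into the unit ball there is a root \<open>k\<close> of \<open>1 - h\<^sup>2\<close>. Then \<open>h + \<i> k\<close> is unitary, so
  \<open>\<parallel>1 - h\<^sup>2\<parallel> = \<parallel>k\<parallel>\<^sup>2 \<le> 1\<close>, which says that \<open>h\<^sup>2\<close> lies in the unit ball around 1.
\<close>

lemma pos_square:
  assumes "h \<in> B" "adj h = h"
  shows "pos (h * h)"
proof -
  define c where "c = norm h + 1"
  have "c > 0"
    by (simp add: c_def add_nonneg_pos)
  define g where "g = (1/c) *\<^sub>R h"
  have g: "g \<in> B" "adj g = g"
    using assms by (auto simp: g_def)
  have "norm g < 1"
    using \<open>c > 0\<close> by (simp add: g_def c_def divide_simps)
  then have "norm (g * g) < 1"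
    using norm_mult_ineq[of g g] mult_strict_mono[of "norm g" 1 "norm g" 1]
    by (smt (verit) mult_left_le_one_le norm_ge_zero)
  then obtain k where k: "k \<in> B" "pos k" "k * k = 1 - g * g"
    using sqrt_one_minus[of "g * g"] g by (auto simp: adj_mult)
  have "(norm k)\<^sup>2 \<le> norm (g * g + k * k)"
    using g k by (intro norm_le_norm_sum_squares) (auto simp: pos_herm commute)
  then have "norm (1 - g * g) \<le> 1"
    using k pos_herm[OF k(2)] cstar_identity[of k] by simp
  then have "pos (g * g)"
    unfolding pos_def using g by (auto simp: adj_mult intro!: exI[of _ 1])
  then have "pos ((c * c) *\<^sub>R (g * g))"
    using \<open>c > 0\<close> by (intro pos_scaleR) auto
  then show ?thesis
    using \<open>c > 0\<close> by (simp add: g_def)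
qed

text \<open>
  The distance of \<open>a + \<delta>\<close> from \<open>u = t + \<delta>\<close> is \<open>\<parallel>t - a\<parallel> \<le> t < u\<close>; so \<open>a + \<delta> = u (1 - z)\<close> with \<open>\<parallel>z\<parallel> < 1\<close>.
\<close>

lemma strictly_pos_sqrt:
  assumes "a \<in> B" "pos a" "\<delta> > 0"
  obtains s where "s \<in> B" "pos s" "s * s = a + of_real \<delta>"
proof -
  obtain t where t: "t > 0" "norm (of_real t - a) \<le> t"
    using assms posE[of a 0] by metis
  define u where "u = t + \<delta>"
  define z where "z = (1/u) *\<^sub>R (of_real t - a)"
  have u: "u > 0"
    using t assms by (simp add: u_def)
  have z: "z \<in> B" "adj z = z"
    using assms by (auto simp: z_def adj_diff pos_herm)
  have "norm z < 1"
    using t u assms by (simp add: z_def u_def divide_simps)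
  then obtain s where s: "s \<in> B" "pos s" "s * s = 1 - z"
    using z sqrt_one_minus by metis
  have "(sqrt u *\<^sub>R s) * (sqrt u *\<^sub>R s) = u *\<^sub>R (1 - z)"
    using u s by simp
  also have "\<dots> = of_real u - (of_real t - a)"
    using u by (simp add: z_def of_real_def scaleR_diff_right)
  also have "\<dots> = a + of_real \<delta>"
    by (simp add: u_def)
  finally have eq: "(sqrt u *\<^sub>R s) * (sqrt u *\<^sub>R s) = a + of_real \<delta>" .
  show thesis
    by (rule that[OF _ _ eq]) (use s u in \<open>auto intro: pos_scaleR\<close>)
qed

lemma strictly_pos_inverse:
  assumes "a \<in> B" "pos a" "\<delta> > 0"
  obtains x where "x \<in> B" "pos x" "x * (a + of_real \<delta>) = 1"
proof -
  obtain s where s: "s \<in> B" "pos s" "s * s = a + of_real \<delta>"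
    using strictly_pos_sqrt[OF assms] .
  obtain t where t: "t > 0" "norm (of_real t - a) \<le> t"
    using assms posE[of a 0] by metis
  define u where "u = t + \<delta>"
  define z where "z = (1/u) *\<^sub>R (of_real t - a)"
  have u: "u > 0"
    using t assms by (simp add: u_def)
  have z: "z \<in> B" "adj z = z"
    using assms by (auto simp: z_def adj_diff pos_herm)
  have "norm z < 1"
    using t u assms by (simp add: z_def u_def divide_simps)
  then obtain y where y: "y \<in> B" "y * (1 - z) = 1"
    using z inverse_one_minus by metis
  define x where "x = (1/u) *\<^sub>R y"
  have "u *\<^sub>R (1 - z) = of_real u - (of_real t - a)"
    using u by (simp add: z_def of_real_def scaleR_diff_right)
  then have "a + of_real \<delta> = u *\<^sub>R (1 - z)"
    by (simp add: u_def)
  then have x: "x \<in> B" "x * (a + of_real \<delta>) = 1"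
    using y u by (auto simp: x_def)
  define m where "m = a + of_real \<delta>"
  have m: "m \<in> B" "adj m = m"
    using assms by (auto simp: m_def adj_add pos_herm)
  have xm: "x * m = 1" "m * x = 1"
    using x m commute[of x m] by (auto simp: m_def)
  have "adj (x * m) = 1"
    by (simp add: xm)
  then have "m * adj x = 1"
    using m by (simp add: adj_mult)
  then have herm: "adj x = x"
    by (metis xm(1) mult.assoc mult.left_neutral mult.right_neutral)
  have "x = x * (s * s) * x"
    using xm s by (simp add: m_def mult.assoc)
  also have "\<dots> = (x * s) * (x * s)"
    by (metis commute mult.assoc s(1) x(1))
  finally have "pos x"
    using pos_square[of "x * s"] x s herm adj_mult_herm[of x s] by (simp add: pos_herm)
  then show thesis
    using that x by blast
qed

text \<open>
  If \<open>c \<plusminus> a \<ge> 0\<close>, then \<open>c\<^sup>2 - a\<^sup>2\<close> is, up to a small constant, the square of some \<open>z\<close>, and the norm of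
  \<open>a\<^sup>2 + z\<^sup>2 \<approx> c\<^sup>2\<close> dominates that of \<open>a\<^sup>2\<close>.
\<close>

lemma norm_le_if_pos:
  assumes "a \<in> B" "pos (of_real c - a)" "pos (of_real c + a)" "c \<ge> 0"
  shows "norm a \<le> c"
proof (rule field_le_epsilon)
  fix \<delta> :: real assume "\<delta> > 0"
  define d where "d = c + \<delta>"
  obtain s where s: "s \<in> B" "pos s" "s * s = of_real c - a + of_real \<delta>"
    using strictly_pos_sqrt[of "of_real c - a"] assms \<open>\<delta> > 0\<close> by auto
  obtain u where u: "u \<in> B" "pos u" "u * u = of_real c + a + of_real \<delta>"
    using strictly_pos_sqrt[of "of_real c + a"] assms \<open>\<delta> > 0\<close> by auto
  have "adj (of_real c - (of_real c - a)) = of_real c - (of_real c - a)"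
    using assms pos_herm by (metis adj_diff adj_of_real)
  then have herm: "adj a = a"
    by simp
  have "(s * u) * (s * u) = (s * s) * (u * u)"
    using s(1) u(1) by (metis commute mult.assoc)
  also have "\<dots> = (of_real d - a) * (of_real d + a)"
    by (simp add: s u d_def algebra_simps)
  also have "\<dots> = of_real (d * d) - a * a"
    using commute[of a "of_real d"] assms by (simp add: algebra_simps)
  finally have "a * a + (s * u) * (s * u) = of_real (d * d)"
    by simp
  moreover have "(norm a)\<^sup>2 \<le> norm (a * a + (s * u) * (s * u))"
    using assms herm s u by (intro norm_le_norm_sum_squares) (auto simp: adj_mult_herm pos_herm commute)
  ultimately have "(norm a)\<^sup>2 \<le> d\<^sup>2"
    by (simp add: power2_eq_square flip: of_real_mult)
  then show "norm a \<le> c + \<delta>"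
    using assms \<open>\<delta> > 0\<close> by (simp add: d_def abs_le_square_iff flip: abs_le_square_iff)
qed

text \<open>
  The radius that witnesses positivity may be any number that is at least half the norm. A radius that
  depends only on the norm makes positivity pass to limits.
\<close>

lemma pos_norm_ge:
  assumes "a \<in> B" "pos a" "norm a \<le> 2 * t"
  shows "norm (of_real t - a) \<le> t"
proof (rule norm_le_if_pos)
  have "pos (of_real (t + t) - a)"
    using assms by (intro pos_norm_minus) (auto simp: pos_herm)
  moreover have "of_real (t + t) - a = of_real t + (of_real t - a)"
    by (simp only: of_real_add add_diff_eq)
  ultimately show "pos (of_real t + (of_real t - a))"
    by (simp only:)
  show "t \<ge> 0"
    using assms norm_ge_zero[of a] by linarith
qed (use assms in auto)

lemma pos_limit:
  assumes "a \<in> B" "\<And>\<delta>. \<delta> > 0 \<Longrightarrow> pos (a + of_real \<delta>)"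
  shows "pos a"
proof -
  define t where "t = norm a + 1"
  have t: "t \<ge> 1"
    by (simp add: t_def)
  have "norm (of_real t - a) \<le> t + \<delta>" if "\<delta> > 0" "\<delta> < 1" for \<delta>
  proof -
    have "norm (a + of_real \<delta>) \<le> norm a + \<delta>"
      using norm_triangle_ineq[of a "of_real \<delta>"] that by simp
    also have "\<dots> \<le> 2 * t"
      using that norm_ge_zero[of a] unfolding t_def distrib_left by linarith
    finally have "norm (a + of_real \<delta>) \<le> 2 * t" .
    then have "norm (of_real t - (a + of_real \<delta>)) \<le> t"
      using assms that by (intro pos_norm_ge) auto
    moreover have "norm (of_real t - a) \<le> norm (of_real t - (a + of_real \<delta>)) + norm (of_real \<delta> :: 'a)"
      using norm_triangle_ineq[of "of_real t - (a + of_real \<delta>)" "of_real \<delta>"] by (simp add: algebra_simps)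
    ultimately show ?thesis
      using that by simp
  qed
  note le = this
  have "norm (of_real t - a) \<le> t"
  proof (rule field_le_epsilon)
    fix e :: real assume "e > 0"
    then show "norm (of_real t - a) \<le> t + e"
      using le[of "min e (1/2)"] by linarith
  qed
  moreover have "adj a = a"
    using pos_herm[OF assms(2)[of 1]] by (simp add: adj_add)
  ultimately show ?thesis
    using t unfolding pos_def by (auto intro!: exI[of _ t])
qed

text \<open>
  The elements \<open>a + \<delta>\<close> and \<open>b + \<delta>\<close> are squares of commuting hermitian elements, so their product is a square;
  then \<open>\<delta>\<close> tends to 0.
\<close>

lemma pos_mult:
  assumes "a \<in> B" "b \<in> B" "pos a" "pos b"
  shows "pos (a * b)"
proof -
  have eps: "pos ((a + of_real \<delta>) * (b + of_real \<delta>))" if \<delta>: "\<delta> > 0" for \<delta>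
  proof -
    obtain s where s: "s \<in> B" "pos s" "s * s = a + of_real \<delta>"
      using strictly_pos_sqrt assms \<delta> by metis
    obtain u where u: "u \<in> B" "pos u" "u * u = b + of_real \<delta>"
      using strictly_pos_sqrt assms \<delta> by metis
    have "(a + of_real \<delta>) * (b + of_real \<delta>) = (s * u) * (s * u)"
      unfolding s(3)[symmetric] u(3)[symmetric] using s(1) u(1) by (metis commute mult.assoc)
    then show ?thesis
      using s u pos_square[of "s * u"] adj_mult_herm by (simp add: pos_herm)
  qed
  show ?thesis
  proof (rule pos_limit)
    fix \<delta> :: real assume "\<delta> > 0"
    define M where "M = norm (a + b) + 1"
    \<comment> \<open>The error term \<open>e (a + b) + e\<^sup>2\<close> of the product is at most \<open>\<delta>\<close> for this choice.\<close>
    define e where "e = min 1 (\<delta> / M)"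
    have M: "M > 0"
      by (simp add: M_def add_nonneg_pos)
    have e: "e > 0" "e \<le> 1" "e * M \<le> \<delta>"
      using \<open>\<delta> > 0\<close> M by (auto simp: e_def min_def field_simps)
    have "pos (of_real (norm (a + b)) - (a + b))"
      using assms by (intro pos_norm_minus) (auto simp: adj_add pos_herm)
    then have 1: "pos (e *\<^sub>R (of_real (norm (a + b)) - (a + b)))"
      using e by (intro pos_scaleR) auto
    have "e * norm (a + b) + e * e \<le> e * M"
      using e by (simp add: M_def algebra_simps mult_left_le)
    then have 2: "pos (of_real (\<delta> - (e * norm (a + b) + e * e)))"
      using e by (intro pos_of_real) linarith
    have "pos ((a + of_real e) * (b + of_real e) + e *\<^sub>R (of_real (norm (a + b)) - (a + b))
      + of_real (\<delta> - (e * norm (a + b) + e * e)))"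
      by (intro pos_add eps 1 2 e)
    also have "(a + of_real e) * (b + of_real e) + e *\<^sub>R (of_real (norm (a + b)) - (a + b))
      + of_real (\<delta> - (e * norm (a + b) + e * e)) = a * b + of_real \<delta>"
      by (simp add: of_real_def algebra_simps)
    finally show "pos (a * b + of_real \<delta>)" .
  qed (use assms in auto)
qed

end

section \<open>Characters of unital abelian C*-subalgebras\<close>

context abelian_cstar
begin

lemma re_part_mult:
  assumes "x \<in> B" "y \<in> B"
  shows "re_part (x * y) = re_part x * re_part y - im_part x * im_part y"
    and "im_part (x * y) = re_part x * im_part y + im_part x * re_part y"
proof -
  have "x * y = (re_part x + \<i> *\<^sub>C im_part x) * (re_part y + \<i> *\<^sub>C im_part y)"
    using re_im_decomp[of x] re_im_decomp[of y] by simp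
  also have "\<dots> = (re_part x * re_part y - im_part x * im_part y)
      + \<i> *\<^sub>C (re_part x * im_part y + im_part x * re_part y)"
    by (simp add: distrib_left distrib_right mult_scaleC_left mult_scaleC_right scaleC_scaleC
        scaleC_add_right)
  finally have eq: "x * y = \<dots>" .
  show "re_part (x * y) = re_part x * re_part y - im_part x * im_part y"
    and "im_part (x * y) = re_part x * im_part y + im_part x * re_part y"
    unfolding eq
    by (rule re_im_part_unique; use assms in \<open>simp add: adj_diff adj_add adj_mult_herm\<close>)+
qed

subsection \<open>Maximal preorderings are characters\<close>

text \<open>
  Preorderings of the real algebra of hermitian elements. As \<open>-1\<close> is excluded, they behave like proper ideals,
  with the advantage that the order is available from the start: the maximal ones are the sets
  \<open>{a. \<rho>(a) \<ge> 0}\<close> for characters \<open>\<rho>\<close>.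
\<close>

definition preordering :: "'a set \<Rightarrow> bool" where
  "preordering T \<longleftrightarrow> (\<forall>a\<in>T. a \<in> B \<and> adj a = a) \<and> (\<forall>a\<in>B. pos a \<longrightarrow> a \<in> T) \<and>
     (\<forall>a\<in>T. \<forall>b\<in>T. a + b \<in> T \<and> a * b \<in> T) \<and> - 1 \<notin> T"

lemma maximal_preordering:
  assumes "preordering T0"
  obtains T where "preordering T" "T0 \<subseteq> T" "\<And>S. preordering S \<Longrightarrow> T \<subseteq> S \<Longrightarrow> S = T"
proof -
  define \<A> where "\<A> = {S. preordering S \<and> T0 \<subseteq> S}"
  have "\<exists>M\<in>\<A>. \<forall>X\<in>\<A>. M \<subseteq> X \<longrightarrow> X = M"
  proof (rule subset_Zorn_nonempty)
    show "\<A> \<noteq> {}"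
      using assms by (auto simp: \<A>_def)
    fix C assume C: "C \<noteq> {}" "subset.chain \<A> C"
    then have mem: "\<And>S. S \<in> C \<Longrightarrow> preordering S \<and> T0 \<subseteq> S"
      by (auto simp: \<A>_def subset_chain_def)
    have "preordering (\<Union>C)"
      unfolding preordering_def
    proof (intro conjI ballI impI)
      fix a b assume "a \<in> \<Union>C" "b \<in> \<Union>C"
      then obtain S S' where "S \<in> C" "a \<in> S" "S' \<in> C" "b \<in> S'"
        by blast
      moreover have "S \<subseteq> S' \<or> S' \<subseteq> S"
        using C \<open>S \<in> C\<close> \<open>S' \<in> C\<close> unfolding subset_chain_def by blast
      ultimately obtain U where U: "U \<in> C" "a \<in> U" "b \<in> U"
        by blast
      then have "a + b \<in> U" "a * b \<in> U"
        using mem[OF U(1)] unfolding preordering_def by auto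
      then show "a + b \<in> \<Union>C" "a * b \<in> \<Union>C"
        using U by auto
    next
      fix a assume "a \<in> B" "pos a"
      then show "a \<in> \<Union>C"
        using mem C(1) unfolding preordering_def by blast
    next
      fix a assume "a \<in> \<Union>C"
      then show "a \<in> B" "adj a = a"
        using mem unfolding preordering_def by auto
    next
      show "- 1 \<notin> \<Union>C"
        using mem unfolding preordering_def by auto
    qed
    then show "\<Union>C \<in> \<A>"
      using mem C(1) by (auto simp: \<A>_def)
  qed
  then obtain M where "M \<in> \<A>" "\<forall>X\<in>\<A>. M \<subseteq> X \<longrightarrow> X = M"
    by blast
  then show thesis
    by (intro that[of M]) (auto simp: \<A>_def)
qed

context
  fixes T :: "'a set"
  assumes T: "preordering T" and maximal: "\<And>S. preordering S \<Longrightarrow> T \<subseteq> S \<Longrightarrow> S = T"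
begin

lemma T_mem: "a \<in> T \<Longrightarrow> a \<in> B" and T_herm: "a \<in> T \<Longrightarrow> adj a = a"
  and T_pos: "a \<in> B \<Longrightarrow> pos a \<Longrightarrow> a \<in> T"
  and T_add: "a \<in> T \<Longrightarrow> b \<in> T \<Longrightarrow> a + b \<in> T"
  and T_mult: "a \<in> T \<Longrightarrow> b \<in> T \<Longrightarrow> a * b \<in> T"
  and T_proper: "- 1 \<notin> T"
  using T unfolding preordering_def by blast+

lemma T_of_real_iff: "of_real r \<in> T \<longleftrightarrow> r \<ge> 0"
proof
  assume r: "of_real r \<in> T"
  show "r \<ge> 0"
  proof (rule ccontr)
    assume "\<not> r \<ge> 0"
    then have "of_real (- 1 / r) \<in> T"
      by (intro T_pos pos_of_real) (auto simp: divide_simps)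
    then have "of_real (- 1 / r) * of_real r \<in> T"
      using r by (rule T_mult)
    then show False
      using \<open>\<not> r \<ge> 0\<close> T_proper by (simp flip: of_real_mult)
  qed
qed (auto intro: T_pos)

lemma T_scaleR: "a \<in> T \<Longrightarrow> t \<ge> 0 \<Longrightarrow> t *\<^sub>R a \<in> T"
  using T_mult[of "of_real t" a] by (simp add: T_of_real_iff of_real_mult_eq_scaleR)

text \<open>
  The sums \<open>s + a t\<close> with \<open>s, t \<in> T\<close> are closed under addition, and under multiplication because \<open>a\<^sup>2\<close> is
  positive. If \<open>a \<notin> T\<close>, they properly enlarge \<open>T\<close>, so by maximality \<open>-1\<close> must be one of them.
\<close>

lemma T_adjoin:
  assumes a: "a \<in> B" "adj a = a" "a \<notin> T"
  obtains s t where "s \<in> T" "t \<in> T" "- 1 = s + a * t"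
proof -
  define S where "S = {s + a * t | s t. s \<in> T \<and> t \<in> T}"
  have sub: "T \<subseteq> S"
    using T_of_real_iff[of 0] by (force simp: S_def)
  have "a = 0 + a * 1"
    by simp
  moreover have "0 \<in> T" "1 \<in> T"
    using T_of_real_iff[of 0] T_of_real_iff[of 1] by auto
  ultimately have "a \<in> S"
    unfolding S_def by blast
  then have "S \<noteq> T"
    using a by blast
  then have "\<not> preordering S"
    using maximal sub by blast
  moreover have "x \<in> B \<and> adj x = x" if "x \<in> S" for x
    using that a T_mem T_herm by (auto simp: S_def adj_add adj_mult_herm)
  moreover have "x \<in> S" if "x \<in> B" "pos x" for x
    using that sub T_pos by auto
  moreover have "x + y \<in> S \<and> x * y \<in> S" if xyS: "x \<in> S" "y \<in> S" for x y
  proof -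
    obtain s t s' t' where st: "s \<in> T" "t \<in> T" "s' \<in> T" "t' \<in> T"
      and xy: "x = s + a * t" "y = s' + a * t'"
      using xyS unfolding S_def by blast
    have "x + y = (s + s') + a * (t + t')"
      by (simp add: xy algebra_simps)
    then have 1: "x + y \<in> S"
      using st T_add unfolding S_def by blast
    have "x * y = (s * s' + (a * a) * (t * t')) + a * (s * t' + t * s')"
      using st a T_mem left_commute commute by (simp add: xy algebra_simps)
    moreover have "s * s' + (a * a) * (t * t') \<in> T" "s * t' + t * s' \<in> T"
      using st a T_add T_mult T_pos[of "a * a"] pos_square by auto
    ultimately show ?thesis
      using 1 unfolding S_def by blast
  qed
  ultimately have "- 1 \<in> S"
    unfolding preordering_def by blast
  then show thesis
    using that unfolding S_def by blast
qed

text \<open>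
  If neither \<open>a\<close> nor \<open>-a\<close> could be added to \<open>T\<close>, then \<open>1 + s = -a t\<close> and \<open>1 + s' = a t'\<close>, and the product
  of the two equations puts \<open>-1\<close> into \<open>T\<close>.
\<close>

lemma T_total:
  assumes a: "a \<in> B" "adj a = a"
  shows "a \<in> T \<or> - a \<in> T"
proof (rule ccontr)
  assume "\<not> ?thesis"
  then obtain s t s' t' where st: "s \<in> T" "t \<in> T" "s' \<in> T" "t' \<in> T"
    and eq: "- 1 = s + a * t" "- 1 = s' + (- a) * t'"
    using a T_adjoin[of a] T_adjoin[of "- a"] by (metis adj_minus minus_mem)
  have B: "s \<in> B" "t \<in> B" "s' \<in> B" "t' \<in> B"
    using st T_mem by auto
  have "1 + (s + a * t) = 0" "1 + (s' + (- a) * t') = 0"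
    unfolding eq[symmetric] by simp_all
  then have "1 + s = - (a * t)" "1 + s' = - ((- a) * t')"
    by (simp_all only: eq_neg_iff_add_eq_0 add.assoc)
  then have "(1 + s) * (1 + s') = - (a * t) * (a * t')"
    by simp
  also have "\<dots> = - ((a * a) * (t * t'))"
    using B a left_commute[of t a] by (simp add: mult.assoc)
  also have "(1 + s) * (1 + s') = 1 + (s + s' + s * s')"
    by (simp add: algebra_simps)
  finally have "1 + (s + s' + s * s' + (a * a) * (t * t')) = 0"
    by (simp only: add.assoc[symmetric] eq_neg_iff_add_eq_0)
  then have "- 1 = s + s' + s * s' + (a * a) * (t * t')"
    by (rule minus_unique)
  moreover have "\<dots> \<in> T"
    using st a T_add T_mult T_pos[of "a * a"] pos_square by auto
  ultimately show False
    using T_proper by simp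
qed

text \<open>
  A maximal preordering orders the hermitian elements totally, and every element is bounded by its norm. The
  Dedekind cut that \<open>a\<close> determines on the reals is therefore a number \<open>c\<close>, up to which \<open>a\<close> is infinitesimal;
  this number is the value of the character at \<open>a\<close>.
\<close>

definition cut :: "'a \<Rightarrow> real \<Rightarrow> bool" where
  "cut a c \<longleftrightarrow> (\<forall>\<epsilon>>0. of_real (c + \<epsilon>) - a \<in> T \<and> a - of_real (c - \<epsilon>) \<in> T)"

lemma cut_exists:
  assumes a: "a \<in> B" "adj a = a"
  shows "\<exists>c. cut a c"
proof -
  define R where "R = {r. of_real r - a \<in> T}"
  have "norm a \<in> R"
    using a pos_norm_minus(1)[of a "norm a"] by (auto simp: R_def intro: T_pos)
  have low: "- norm a \<le> r" if "r \<in> R" for r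
  proof -
    have "of_real (norm a) + a \<in> T"
      using a pos_norm_minus(2)[of a "norm a"] by (intro T_pos) auto
    then have "(of_real r - a) + (of_real (norm a) + a) \<in> T"
      using that by (intro T_add[of "of_real r - a"]) (simp_all add: R_def)
    moreover have "(of_real r - a) + (of_real (norm a) + a) = of_real (r + norm a)"
      by simp
    ultimately have "of_real (r + norm a) \<in> T"
      by (simp only:)
    then show ?thesis
      by (simp only: T_of_real_iff)
  qed
  have bdd: "bdd_below R"
    using low by (auto simp: bdd_below_def)
  have "cut a (Inf R)"
    unfolding cut_def
  proof (intro allI impI conjI)
    fix \<epsilon> :: real assume "\<epsilon> > 0"
    then obtain r where r: "r \<in> R" "r < Inf R + \<epsilon>"
      using \<open>norm a \<in> R\<close> cInf_lessD[of R "Inf R + \<epsilon>"] by auto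
    have "(of_real r - a) + of_real (Inf R + \<epsilon> - r) \<in> T"
      using r by (intro T_add) (auto simp: R_def T_of_real_iff simp del: of_real_add of_real_diff)
    then show "of_real (Inf R + \<epsilon>) - a \<in> T"
      by (simp add: algebra_simps)
    have "Inf R - \<epsilon> \<notin> R"
      using cInf_lower[OF _ bdd, of "Inf R - \<epsilon>"] \<open>\<epsilon> > 0\<close> by auto
    then have "- (of_real (Inf R - \<epsilon>) - a) \<in> T"
      using T_total[of "of_real (Inf R - \<epsilon>) - a"] a by (auto simp: R_def adj_diff)
    then show "a - of_real (Inf R - \<epsilon>) \<in> T"
      by simp
  qed
  then show ?thesis ..
qed

lemma cut_le:
  assumes "cut a c" "cut a d"
  shows "d \<le> c"
proof (rule ccontr)
  assume "\<not> d \<le> c"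
  define \<epsilon> where "\<epsilon> = (d - c) / 3"
  have \<epsilon>: "\<epsilon> > 0"
    using \<open>\<not> d \<le> c\<close> by (simp add: \<epsilon>_def)
  have "(of_real (c + \<epsilon>) - a) + (a - of_real (d - \<epsilon>)) \<in> T"
    using assms \<epsilon> by (intro T_add) (auto simp: cut_def)
  also have "(of_real (c + \<epsilon>) - a) + (a - of_real (d - \<epsilon>)) = of_real ((c + \<epsilon>) - (d - \<epsilon>))"
    by (simp only: of_real_diff) simp
  finally have "(c + \<epsilon>) - (d - \<epsilon>) \<ge> 0"
    by (simp only: T_of_real_iff)
  then show False
    using \<open>\<not> d \<le> c\<close> by (simp add: \<epsilon>_def field_simps)
qed

lemma cut_unique: "cut a c \<Longrightarrow> cut a d \<Longrightarrow> c = d"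
  by (rule order_antisym) (rule cut_le; assumption)+

lemma cut_add:
  assumes "cut a c" "cut b d"
  shows "cut (a + b) (c + d)"
  unfolding cut_def
proof (intro allI impI conjI)
  fix \<epsilon> :: real assume "\<epsilon> > 0"
  then have "(of_real (c + \<epsilon>/2) - a) + (of_real (d + \<epsilon>/2) - b) \<in> T"
    using assms by (intro T_add) (auto simp: cut_def)
  also have "(of_real (c + \<epsilon>/2) - a) + (of_real (d + \<epsilon>/2) - b)
      = of_real ((c + \<epsilon>/2) + (d + \<epsilon>/2)) - (a + b)"
    by (simp only: of_real_add) (simp add: algebra_simps)
  finally show "of_real (c + d + \<epsilon>) - (a + b) \<in> T"
    by (simp only: add.assoc add.left_commute field_sum_of_halves)
  have "(a - of_real (c - \<epsilon>/2)) + (b - of_real (d - \<epsilon>/2)) \<in> T"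
    using assms \<open>\<epsilon> > 0\<close> by (intro T_add) (auto simp: cut_def)
  also have "(a - of_real (c - \<epsilon>/2)) + (b - of_real (d - \<epsilon>/2))
      = (a + b) - of_real ((c - \<epsilon>/2) + (d - \<epsilon>/2))"
    by (simp only: of_real_add) (simp add: algebra_simps)
  also have "(c - \<epsilon>/2) + (d - \<epsilon>/2) = c + d - \<epsilon>"
    by simp
  finally show "(a + b) - of_real (c + d - \<epsilon>) \<in> T" .
qed

lemma cut_of_real: "cut (of_real r) r"
  unfolding cut_def of_real_diff[symmetric] T_of_real_iff by simp

lemma cut_minus:
  assumes "cut a c"
  shows "cut (- a) (- c)"
  unfolding cut_def
proof (intro allI impI)
  fix \<epsilon> :: real assume "\<epsilon> > 0"
  then have "of_real (c + \<epsilon>) - a \<in> T \<and> a - of_real (c - \<epsilon>) \<in> T"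
    using assms by (simp only: cut_def)
  moreover have "of_real (- c + \<epsilon>) - (- a) = a - of_real (c - \<epsilon>)"
    "- a - of_real (- c - \<epsilon>) = of_real (c + \<epsilon>) - a"
    by simp_all
  ultimately show "of_real (- c + \<epsilon>) - (- a) \<in> T \<and> - a - of_real (- c - \<epsilon>) \<in> T"
    by (simp only:)
qed

lemma cut_diff: "cut a c \<Longrightarrow> cut b d \<Longrightarrow> cut (a - b) (c - d)"
  using cut_add[OF _ cut_minus, of a c b d] by simp

text \<open>
  With \<open>\<plusminus>a \<le> \<delta>\<close> and \<open>\<plusminus>b \<le> N\<close> in the order given by \<open>T\<close>, the bounds for \<open>a b\<close> follow from the identity
  \<open>(\<delta> - a)(N + b) + (\<delta> + a)(N - b) = 2 (\<delta> N - a b)\<close> and the same identity for \<open>-a\<close>.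
\<close>

lemma cut_null_mult:
  assumes a: "cut a 0" "a \<in> B" and b: "b \<in> B" "adj b = b"
  shows "cut (a * b) 0"
  unfolding cut_def
proof (intro allI impI conjI)
  fix \<epsilon> :: real assume "\<epsilon> > 0"
  define N where "N = norm b + 1"
  define \<delta> where "\<delta> = \<epsilon> / N"
  have N: "N > 0"
    by (simp add: N_def add_nonneg_pos)
  then have "\<delta> > 0"
    using \<open>\<epsilon> > 0\<close> by (simp add: \<delta>_def)
  have a': "of_real \<delta> - a \<in> T" "of_real \<delta> + a \<in> T"
    using a \<open>\<delta> > 0\<close> unfolding cut_def by (force simp: algebra_simps)+
  have b': "of_real N - b \<in> T" "of_real N + b \<in> T"
    using b pos_norm_minus[of b N] by (auto simp: N_def simp del: of_real_add intro!: T_pos)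
  have N\<delta>: "of_real \<delta> * of_real N = (of_real \<epsilon> :: 'a)"
    using N by (simp add: \<delta>_def flip: of_real_mult)
  have comm: "of_real N * a = a * of_real N"
    using a by (intro commute) auto
  have "(1/2) *\<^sub>R ((of_real \<delta> - a) * (of_real N + b) + (of_real \<delta> + a) * (of_real N - b)) \<in> T"
    using T_scaleR[OF T_add[OF T_mult[OF a'(1) b'(2)] T_mult[OF a'(2) b'(1)]], of "1/2"] by simp
  also have "(of_real \<delta> - a) * (of_real N + b) + (of_real \<delta> + a) * (of_real N - b)
      = 2 *\<^sub>R (of_real \<epsilon> - a * b)"
    by (simp add: distrib_left distrib_right left_diff_distrib right_diff_distrib N\<delta> scaleR_2)
  finally show "of_real (0 + \<epsilon>) - a * b \<in> T"
    by simp
  have "(1/2) *\<^sub>R ((of_real \<delta> + a) * (of_real N + b) + (of_real \<delta> - a) * (of_real N - b)) \<in> T"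
    using T_scaleR[OF T_add[OF T_mult[OF a'(2) b'(2)] T_mult[OF a'(1) b'(1)]], of "1/2"] by simp
  also have "(of_real \<delta> + a) * (of_real N + b) + (of_real \<delta> - a) * (of_real N - b)
      = 2 *\<^sub>R (of_real \<epsilon> + a * b)"
    by (simp add: distrib_left distrib_right left_diff_distrib right_diff_distrib N\<delta> scaleR_2)
  finally show "a * b - of_real (0 - \<epsilon>) \<in> T"
    by (simp add: add.commute)
qed

lemma cut_scaleR:
  assumes "cut a c" "a \<in> B" "adj a = a"
  shows "cut (t *\<^sub>R a) (t * c)"
proof -
  have "cut (a - of_real c) 0"
    using cut_diff[OF assms(1) cut_of_real[of c]] by simp
  then have "cut ((a - of_real c) * of_real t) 0"
    using assms by (intro cut_null_mult) auto
  then have "cut ((a - of_real c) * of_real t + of_real (t * c)) (0 + t * c)"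
    by (rule cut_add[OF _ cut_of_real])
  then show ?thesis
    by (simp add: of_real_def algebra_simps)
qed

lemma cut_mult:
  assumes a: "cut a c" "a \<in> B" "adj a = a" and b: "cut b d" "b \<in> B" "adj b = b"
  shows "cut (a * b) (c * d)"
proof -
  have "cut (a - of_real c) 0"
    using cut_diff[OF a(1) cut_of_real[of c]] by simp
  then have "cut ((a - of_real c) * b) 0"
    using assms by (intro cut_null_mult) auto
  then have "cut ((a - of_real c) * b + c *\<^sub>R b) (0 + c * d)"
    using b by (intro cut_add cut_scaleR)
  then show ?thesis
    by (simp add: of_real_def algebra_simps)
qed

lemma cut_T:
  assumes "cut a c" "a \<in> T"
  shows "c \<ge> 0"
proof (rule ccontr)
  assume "\<not> c \<ge> 0"
  then have "of_real (c + (- c / 2)) - a \<in> T"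
    using assms(1)[unfolded cut_def, rule_format, of "- c / 2"] by auto
  from T_add[OF this assms(2)] have "of_real (c + (- c / 2)) \<in> T"
    by (simp only: diff_add_cancel)
  then show False
    using \<open>\<not> c \<ge> 0\<close> by (simp only: T_of_real_iff)
qed

lemma maximal_preordering_character:
  "\<exists>\<rho>\<in>characters B. \<forall>a\<in>T. 0 \<le> Re (\<rho> a)"
proof -
  define g where "g a = (THE c. cut a c)" for a
  have g: "cut a (g a)" if "a \<in> B" "adj a = a" for a
    unfolding g_def using cut_exists[OF that] cut_unique by (rule_tac theI') blast
  have g_eq: "g a = c" if "cut a c" for a c
    unfolding g_def using that cut_unique by blast
  define \<rho> where "\<rho> = (\<lambda>x\<in>B. Complex (g (re_part x)) (g (im_part x)))"
  have add: "g (a + b) = g a + g b" and diff: "g (a - b) = g a - g b"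
    and mult: "g (a * b) = g a * g b"
    if "a \<in> B" "adj a = a" "b \<in> B" "adj b = b" for a b
    using that by (auto intro!: g_eq cut_add cut_diff cut_mult g)
  have scale: "g (t *\<^sub>R a) = t * g a" if "a \<in> B" "adj a = a" for a t
    using that by (auto intro!: g_eq cut_scaleR g)
  have \<rho>_add: "\<rho> (x + y) = \<rho> x + \<rho> y" if "x \<in> B" "y \<in> B" for x y
    using that by (simp add: \<rho>_def re_part_add im_part_add add complex_eq_iff)
  have \<rho>_mult: "\<rho> (x * y) = \<rho> x * \<rho> y" if "x \<in> B" "y \<in> B" for x y
    using that
    by (simp add: \<rho>_def re_part_mult add diff mult adj_mult_herm complex_eq_iff)
  have g1: "g (of_real r) = r" for r
    by (intro g_eq cut_of_real)
  have im: "im_part (of_real r :: 'a) = 0" "re_part (of_real r :: 'a) = of_real r" for r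
    by (auto intro!: re_part_herm im_part_herm)
  have 1: "\<rho> 1 = 1"
    using g1[of 1] g1[of 0] im[of 1] by (simp add: \<rho>_def complex_eq_iff)
  have \<rho>_scalar: "\<rho> (c *\<^sub>C 1) = c" for c
  proof -
    have eq: "c *\<^sub>C (1 :: 'a) = of_real (Re c) + \<i> *\<^sub>C of_real (Im c)"
    proof -
      have "c = complex_of_real (Re c) + \<i> * complex_of_real (Im c)"
        by (rule complex_eq)
      then have "c *\<^sub>C (1 :: 'a) = (complex_of_real (Re c) + \<i> * complex_of_real (Im c)) *\<^sub>C 1"
        by simp
      then show ?thesis
        by (simp only: scaleC_add_left of_real_eq_scaleC[where 'a = 'a] scaleC_scaleC)
    qed
    have "re_part (c *\<^sub>C (1 :: 'a)) = of_real (Re c)" "im_part (c *\<^sub>C (1 :: 'a)) = of_real (Im c)"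
      unfolding eq by (simp_all add: re_im_part_unique)
    then show ?thesis
      by (simp add: \<rho>_def g1)
  qed
  have \<rho>_scale: "\<rho> (c *\<^sub>C x) = c * \<rho> x" if "x \<in> B" for c x
    using \<rho>_mult[of "c *\<^sub>C 1" x] that by (simp add: \<rho>_scalar mult_scaleC_left)
  have "\<rho> \<in> extensional B"
    by (simp add: \<rho>_def)
  moreover have "clinear_on B \<rho>"
    using \<rho>_add \<rho>_scale by (simp add: clinear_on_def scaleC_complex_def)
  moreover have "\<exists>x\<in>B. \<rho> x \<noteq> 0"
    using 1 by (intro bexI[of _ 1]) auto
  ultimately have \<rho>: "\<rho> \<in> characters B"
    using \<rho>_mult by (simp add: characters_def)
  have nonneg: "0 \<le> Re (\<rho> a)" if "a \<in> T" for a
    using cut_T[OF g] that by (simp add: \<rho>_def T_mem T_herm)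
  show ?thesis
    by (intro bexI[OF _ \<rho>] ballI nonneg)
qed

end

lemma preordering_character:
  assumes "preordering T"
  obtains \<rho> where "\<rho> \<in> characters B" "\<And>a. a \<in> T \<Longrightarrow> 0 \<le> Re (\<rho> a)"
proof -
  obtain M where M: "preordering M" "T \<subseteq> M" "\<And>S. preordering S \<Longrightarrow> M \<subseteq> S \<Longrightarrow> S = M"
    using maximal_preordering[OF assms] by metis
  obtain \<rho> where "\<rho> \<in> characters B" "\<forall>a\<in>M. 0 \<le> Re (\<rho> a)"
    using maximal_preordering_character[OF M(1,3)] by auto
  then show thesis
    using M(2) by (intro that[of \<rho>]) auto
qed

subsection \<open>Basic properties of characters\<close>

context
  fixes \<rho> :: "'a \<Rightarrow> complex"
  assumes \<rho>: "\<rho> \<in> characters B"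
begin

lemma char_add: "x \<in> B \<Longrightarrow> y \<in> B \<Longrightarrow> \<rho> (x + y) = \<rho> x + \<rho> y"
  using \<rho> by (simp add: characters_def clinear_on_def)

lemma char_scaleC: "x \<in> B \<Longrightarrow> \<rho> (c *\<^sub>C x) = c * \<rho> x"
  using \<rho> by (simp add: characters_def clinear_on_def scaleC_complex_def)

lemma char_mult: "x \<in> B \<Longrightarrow> y \<in> B \<Longrightarrow> \<rho> (x * y) = \<rho> x * \<rho> y"
  using \<rho> by (simp add: characters_def)

lemma char_one: "\<rho> 1 = 1"
proof -
  obtain x where x: "x \<in> B" "\<rho> x \<noteq> 0"
    using \<rho> by (auto simp: characters_def)
  then show ?thesis
    using char_mult[of 1 x] by simp
qed

lemma char_scaleR: "x \<in> B \<Longrightarrow> \<rho> (t *\<^sub>R x) = of_real t * \<rho> x"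
  by (simp add: scaleR_eq_scaleC char_scaleC)

lemma char_zero: "\<rho> 0 = 0"
  using char_scaleR[of 0 0] by simp

lemma char_of_real: "\<rho> (of_real t) = of_real t"
  using char_scaleR[of 1 t] by (simp add: of_real_def[where 'a = 'a] char_one)

lemma char_minus: "x \<in> B \<Longrightarrow> \<rho> (- x) = - \<rho> x"
  using char_scaleR[of x "-1"] by simp

lemma char_diff: "x \<in> B \<Longrightarrow> y \<in> B \<Longrightarrow> \<rho> (x - y) = \<rho> x - \<rho> y"
  using char_add[of x "- y"] by (simp add: char_minus)

lemma char_sum: "(\<And>i. i \<in> I \<Longrightarrow> f i \<in> B) \<Longrightarrow> \<rho> (\<Sum>i\<in>I. f i) = (\<Sum>i\<in>I. \<rho> (f i))"
  by (induction I rule: infinite_finite_induct) (simp_all add: char_zero char_add sum_mem)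

lemma char_power: "x \<in> B \<Longrightarrow> \<rho> (x ^ n) = \<rho> x ^ n"
  by (induction n) (simp_all add: char_one char_mult)

text \<open>
  If \<open>|\<rho>(x)| > \<parallel>x\<parallel>\<close>, then \<open>1 - x/\<rho>(x)\<close> is invertible, although \<open>\<rho>\<close> vanishes there.
\<close>

lemma char_norm_le:
  assumes "x \<in> B"
  shows "cmod (\<rho> x) \<le> norm x"
proof (rule ccontr)
  assume less: "\<not> cmod (\<rho> x) \<le> norm x"
  then have nz: "\<rho> x \<noteq> 0"
    using norm_ge_zero[of x] by auto
  define z where "z = (1 / \<rho> x) *\<^sub>C x"
  have "norm z < 1"
    using less nz by (simp add: z_def norm_scaleC norm_divide)
  moreover have z: "z \<in> B"
    using assms by (simp add: z_def)
  ultimately obtain y where y: "y \<in> B" "y * (1 - z) = 1"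
    using inverse_one_minus by blast
  then have "\<rho> y * \<rho> (1 - z) = 1"
    using z char_mult[of y "1 - z"] by (simp add: char_one)
  moreover have "\<rho> (1 - z) = 0"
    using z nz assms by (simp add: char_diff char_one) (simp add: z_def char_scaleC)
  ultimately show False
    by simp
qed

text \<open>
  If \<open>\<rho>(x)\<close> has imaginary part \<open>\<beta>\<close>, then \<open>(\<beta> + t)\<^sup>2 \<le> |\<rho>(x + \<i> t)|\<^sup>2 \<le> \<parallel>x\<parallel>\<^sup>2 + t\<^sup>2\<close> for every real \<open>t\<close>, which
  forces \<open>\<beta> = 0\<close>.
\<close>

lemma char_herm_real:
  assumes "x \<in> B" "adj x = x"
  shows "\<rho> x = of_real (Re (\<rho> x))"
proof -
  define \<beta> where "\<beta> = Im (\<rho> x)"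
  have "\<beta>\<^sup>2 + 2 * \<beta> * t \<le> (norm x)\<^sup>2" for t
  proof -
    have "(\<beta> + t)\<^sup>2 \<le> (cmod (\<rho> (x + \<i> *\<^sub>C of_real t)))\<^sup>2"
      using assms by (simp add: char_add char_scaleC char_of_real \<beta>_def cmod_power2)
    also have "\<dots> \<le> (norm (x + \<i> *\<^sub>C of_real t))\<^sup>2"
      using assms by (intro power_mono char_norm_le) auto
    also have "\<dots> = norm (x * x + of_real (t * t))"
      using assms by (subst norm_herm_plus_ii) (auto intro: commute)
    also have "\<dots> \<le> norm (x * x) + norm (of_real (t * t) :: 'a)"
      by (rule norm_triangle_ineq)
    also have "\<dots> \<le> (norm x)\<^sup>2 + t\<^sup>2"
      using cstar_identity[of x] assms by (simp add: power2_eq_square del: of_real_mult)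
    finally show ?thesis
      by (simp add: power2_sum)
  qed
  note le = this
  have "\<beta> = 0"
  proof (rule ccontr)
    assume "\<beta> \<noteq> 0"
    then have "\<beta>\<^sup>2 + 2 * \<beta> * (((norm x)\<^sup>2 + 1) / (2 * \<beta>)) = \<beta>\<^sup>2 + (norm x)\<^sup>2 + 1"
      by simp
    then show False
      using le[of "((norm x)\<^sup>2 + 1) / (2 * \<beta>)"] zero_le_power2[of \<beta>] by linarith
  qed
  then show ?thesis
    by (simp add: \<beta>_def complex_eq_iff)
qed

lemma char_adj: 
  assumes "x \<in> B"
  shows "\<rho> (adj x) = cnj (\<rho> x)"
proof -
  have x: "x = re_part x + \<i> *\<^sub>C im_part x"
    by (rule re_im_decomp)
  have "adj x = adj (re_part x + \<i> *\<^sub>C im_part x)"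
    using arg_cong[OF x, of adj] .
  also have "\<dots> = re_part x - \<i> *\<^sub>C im_part x"
    by (simp add: adj_add adj_scaleC)
  finally have "adj x = re_part x - \<i> *\<^sub>C im_part x" .
  moreover have "\<rho> (re_part x - \<i> *\<^sub>C im_part x) = \<rho> (re_part x) - \<i> * \<rho> (im_part x)"
    using assms by (simp add: char_diff char_scaleC)
  ultimately have "\<rho> (adj x) = \<rho> (re_part x) - \<i> * \<rho> (im_part x)"
    by (simp only:)
  moreover have "\<rho> x = \<rho> (re_part x) + \<i> * \<rho> (im_part x)"
    by (rule trans[OF arg_cong[OF x, of \<rho>]]) (use assms in \<open>simp add: char_add char_scaleC\<close>)
  moreover obtain s t where "\<rho> (re_part x) = of_real s" "\<rho> (im_part x) = of_real t"
    using char_herm_real[of "re_part x"] char_herm_real[of "im_part x"] assms by fastforce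
  ultimately show ?thesis
    by simp
qed

lemma char_pos:
  assumes "x \<in> B" "pos x"
  shows "0 \<le> Re (\<rho> x)"
proof -
  obtain t where t: "t > 0" "norm (of_real t - x) \<le> t"
    using assms posE[of x 0] by metis
  have "cmod (of_real t - \<rho> x) \<le> t"
    using char_norm_le[of "of_real t - x"] t assms by (simp add: char_diff char_of_real)
  then have "\<bar>t - Re (\<rho> x)\<bar> \<le> t"
    using abs_Re_le_cmod[of "of_real t - \<rho> x"] by simp
  then show ?thesis
    by simp
qed

end

subsection \<open>Characters detect positivity and norm\<close>

text \<open>
  For \<open>b = a + \<delta>\<close> the elements \<open>p - b q\<close> with positive \<open>p\<close> and \<open>q\<close> cannot form a preordering, since this would
  give a character with \<open>\<rho>(b) \<le> 0\<close>. So \<open>-1\<close> is one of them, and \<open>b q = 1 + p\<close> exhibits a positive inverse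
  \<open>q (1 + p)\<^sup>-\<^sup>1\<close> of \<open>b\<close>; hence \<open>b = b\<^sup>2 b\<^sup>-\<^sup>1\<close> is positive.
\<close>

lemma pos_if_char_nonneg:
  assumes a: "a \<in> B" "adj a = a" and nonneg: "\<And>\<rho>. \<rho> \<in> characters B \<Longrightarrow> 0 \<le> Re (\<rho> a)"
  shows "pos a"
proof (rule pos_limit)
  fix \<delta> :: real assume "\<delta> > 0"
  define b where "b = a + of_real \<delta>"
  have b: "b \<in> B" "adj b = b"
    using a by (auto simp: b_def adj_add)
  define T where "T = {p - b * q | p q. p \<in> B \<and> q \<in> B \<and> pos p \<and> pos q}"
  have sub: "x \<in> T" if "x \<in> B" "pos x" for x
  proof -
    have "x = x - b * 0"
      by simp
    then show ?thesis
      using that zero_mem pos_0 unfolding T_def by blast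
  qed
  have "x \<in> B \<and> adj x = x" if "x \<in> T" for x
    using that b by (auto simp: T_def adj_diff adj_mult_herm pos_herm)
  moreover have "x + y \<in> T \<and> x * y \<in> T" if xy: "x \<in> T" "y \<in> T" for x y
  proof -
    obtain p q p' q' where pq: "p \<in> B" "q \<in> B" "pos p" "pos q" "p' \<in> B" "q' \<in> B" "pos p'" "pos q'"
      and x: "x = p - b * q" and y: "y = p' - b * q'"
      using xy unfolding T_def by blast
    have "x + y = (p + p') - b * (q + q')"
      by (simp add: x y algebra_simps)
    moreover have "pos (p + p')" "pos (q + q')"
      using pq pos_add by auto
    ultimately have 1: "x + y \<in> T"
      using pq add_mem unfolding T_def by blast
    have "p * (b * q') = b * (p * q')" "b * q * p' = b * (q * p')" "b * q * (b * q') = b * b * (q * q')"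
      using pq b left_commute by (auto simp: mult.assoc)
    then have "x * y = (p * p' + (b * b) * (q * q')) - b * (p * q' + q * p')"
      by (simp add: x y left_diff_distrib right_diff_distrib distrib_left)
    moreover have "pos (p * p' + (b * b) * (q * q'))" "pos (p * q' + q * p')"
      using pq b by (auto intro!: pos_add pos_mult pos_square)
    moreover have "p * p' + (b * b) * (q * q') \<in> B" "p * q' + q * p' \<in> B"
      using pq b by auto
    ultimately have "x * y \<in> T"
      unfolding T_def by blast
    then show ?thesis
      using 1 by blast
  qed
  moreover have "- 1 \<in> T" if "\<not> preordering T"
    using that sub calculation unfolding preordering_def by blast
  moreover have "\<not> preordering T"
  proof
    assume "preordering T"
    then obtain \<rho> where \<rho>: "\<rho> \<in> characters B" "\<And>x. x \<in> T \<Longrightarrow> 0 \<le> Re (\<rho> x)"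
      using preordering_character by metis
    have "0 - b * 1 \<in> T"
      unfolding T_def using zero_mem one_mem pos_0 pos_1 by blast
    then have "0 \<le> Re (\<rho> (- b))"
      using \<rho>(2) by simp
    moreover have "\<rho> (- b) = - \<rho> a - of_real \<delta>"
      using \<rho> a b by (simp add: char_minus) (simp add: b_def char_add char_of_real)
    ultimately show False
      using nonneg[OF \<rho>(1)] \<open>\<delta> > 0\<close> by simp
  qed
  ultimately have "- 1 \<in> T"
    by blast
  then obtain p q where pq: "p \<in> B" "q \<in> B" "pos p" "pos q" and "- 1 = p - b * q"
    unfolding T_def by blast
  then have bq: "b * q = p + of_real 1"
    by (simp add: algebra_simps eq_neg_iff_add_eq_0)
  obtain r where r: "r \<in> B" "pos r" "r * (p + of_real 1) = 1"
    using strictly_pos_inverse[of p 1] pq by auto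
  have "b = b * (r * (b * q))"
    using r bq by simp
  also have "\<dots> = (b * b) * (q * r)"
    using b pq r by (metis commute mult.assoc)
  finally have eq: "b = (b * b) * (q * r)" .
  have "pos ((b * b) * (q * r))"
    using b pq r by (intro pos_mult pos_square) auto
  then have "pos b"
    by (simp only: eq[symmetric])
  then show "pos (a + of_real \<delta>)"
    by (simp only: b_def)
qed (use a in auto)

lemma norm_le_if_char_le:
  assumes "a \<in> B" "c \<ge> 0" "\<And>\<rho>. \<rho> \<in> characters B \<Longrightarrow> cmod (\<rho> a) \<le> c"
  shows "norm a \<le> c"
proof -
  have herm: "norm b \<le> d"
    if b: "b \<in> B" "adj b = b" "d \<ge> 0" "\<And>\<rho>. \<rho> \<in> characters B \<Longrightarrow> cmod (\<rho> b) \<le> d" for b d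
  proof (rule norm_le_if_pos)
    have re: "\<bar>Re (\<rho> b)\<bar> \<le> d" if "\<rho> \<in> characters B" for \<rho>
      using b(4)[OF that] abs_Re_le_cmod[of "\<rho> b"] by linarith
    show "pos (of_real d - b)"
      using b re by (intro pos_if_char_nonneg) (force simp: adj_diff char_diff char_of_real)+
    show "pos (of_real d + b)"
      using b re by (intro pos_if_char_nonneg) (force simp: adj_add char_add char_of_real)+
  qed (use that in auto)
  have "norm (adj a * a) \<le> c\<^sup>2"
  proof (rule herm)
    fix \<rho> assume \<rho>: "\<rho> \<in> characters B"
    then have "cmod (\<rho> (adj a * a)) = (cmod (\<rho> a))\<^sup>2"
      using assms by (simp add: char_mult char_adj norm_mult power2_eq_square)
    then show "cmod (\<rho> (adj a * a)) \<le> c\<^sup>2"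
      using assms(3)[OF \<rho>] by (simp add: power_mono)
  qed (use assms in \<open>auto simp: adj_mult adj_adj\<close>)
  then show ?thesis
    using assms by (simp add: cstar_identity abs_le_square_iff[symmetric])
qed

lemma eq_if_char_eq:
  assumes "a \<in> B" "b \<in> B" "\<And>\<rho>. \<rho> \<in> characters B \<Longrightarrow> \<rho> a = \<rho> b"
  shows "a = b"
proof -
  have "norm (a - b) \<le> 0"
    using assms by (intro norm_le_if_char_le) (auto simp: char_diff)
  then show ?thesis
    by simp
qed

text \<open>
  The roots of \<open>a + 1/n\<close> form a Cauchy sequence, because \<open>sqrt (r + e) - sqrt r \<le> sqrt e\<close> can be applied at
  every character.
\<close>

lemma pos_sqrt:
  assumes a: "a \<in> B" "pos a"
  obtains s where "s \<in> B" "pos s" "s * s = a"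
proof -
  have "\<exists>s\<in>B. pos s \<and> s * s = a + of_real (inverse (real (Suc n)))" for n
    using strictly_pos_sqrt[OF a, of "inverse (real (Suc n))"] by auto
  then obtain s where s: "\<And>n. s n \<in> B" "\<And>n. pos (s n)"
    and ss: "\<And>n. s n * s n = a + of_real (inverse (real (Suc n)))"
    by metis
  have char_s: "\<rho> (s n) = of_real (sqrt (Re (\<rho> a) + inverse (real (Suc n))))"
    if \<rho>: "\<rho> \<in> characters B" for \<rho> n
  proof -
    have real: "\<rho> (s n) = of_real (Re (\<rho> (s n)))" "\<rho> a = of_real (Re (\<rho> a))"
      using \<rho> s a pos_herm by (auto intro!: char_herm_real)
    have "\<rho> (s n) * \<rho> (s n) = \<rho> a + of_real (inverse (real (Suc n)))"
      using \<rho> s a by (simp add: ss char_add char_of_real del: of_nat_Suc flip: char_mult)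
    then have "Re (\<rho> (s n)) * Re (\<rho> (s n)) = Re (\<rho> a) + inverse (real (Suc n))"
      by (subst (asm) (1 2) real(1), subst (asm) real(2))
        (simp del: of_nat_Suc of_real_inverse flip: of_real_mult of_real_add of_real_inverse)
    moreover have "0 \<le> Re (\<rho> (s n))"
      using \<rho> s by (intro char_pos)
    ultimately have "sqrt (Re (\<rho> a) + inverse (real (Suc n))) = Re (\<rho> (s n))"
      by (intro real_sqrt_unique) (simp_all add: power2_eq_square)
    then show ?thesis
      using real(1) by simp
  qed
  have dist: "norm (s n - s m) \<le> sqrt (inverse (real (Suc n)))" if "n \<le> m" for n m
  proof (rule norm_le_if_char_le)
    fix \<rho> assume \<rho>: "\<rho> \<in> characters B"
    have r: "0 \<le> Re (\<rho> a)"
      using \<rho> a by (intro char_pos)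
    have le: "inverse (real (Suc m)) \<le> inverse (real (Suc n))"
      using that by (simp add: divide_simps)
    have "sqrt (Re (\<rho> a) + inverse (real (Suc n))) \<le> sqrt (Re (\<rho> a) + inverse (real (Suc m))) + sqrt (inverse (real (Suc n)))"
      using sqrt_add_le_add_sqrt[of "Re (\<rho> a) + inverse (real (Suc m))" "inverse (real (Suc n))"] r
      by (smt (verit) real_sqrt_le_mono inverse_nonnegative_iff_nonnegative of_nat_0_le_iff)
    moreover have "sqrt (Re (\<rho> a) + inverse (real (Suc m))) \<le> sqrt (Re (\<rho> a) + inverse (real (Suc n)))"
      using le by simp
    ultimately show "cmod (\<rho> (s n - s m)) \<le> sqrt (inverse (real (Suc n)))"
      using \<rho> s by (simp add: char_diff char_s del: of_nat_Suc flip: of_real_diff)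
  qed (use s in auto)
  have lim0: "(\<lambda>n. sqrt (inverse (real (Suc n)))) \<longlonglongrightarrow> 0"
    using tendsto_real_sqrt[OF LIMSEQ_inverse_real_of_nat] by simp
  have "Cauchy s"
    unfolding Cauchy_altdef
  proof (intro allI impI)
    fix e :: real assume "e > 0"
    then obtain N where N: "sqrt (inverse (real (Suc n))) < e" if "n \<ge> N" for n
      using order_tendstoD(2)[OF lim0] by (auto simp: eventually_sequentially)
    show "\<exists>M. \<forall>m\<ge>M. \<forall>n>m. dist (s m) (s n) < e"
    proof (intro exI allI impI)
      fix m n assume "N \<le> m" "m < n"
      then show "dist (s m) (s n) < e"
        using dist[of m n] N[of m] by (simp add: dist_norm)
    qed
  qed
  then obtain l where l: "s \<longlonglongrightarrow> l"
    using Cauchy_convergent convergent_def by blast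
  have lB: "l \<in> B"
    using closed_sequentially[OF closed_B] s l by blast
  have "(\<lambda>n. adj (s n)) \<longlonglongrightarrow> adj l"
    by (intro tendsto_intros l)
  then have herm: "adj l = l"
    using l s pos_herm LIMSEQ_unique by (metis (no_types, lifting) ext)
  have "pos l"
  proof (rule pos_if_char_nonneg[OF lB herm])
    fix \<rho> assume \<rho>: "\<rho> \<in> characters B"
    have "(\<lambda>n. \<rho> (s n) - \<rho> l) \<longlonglongrightarrow> 0"
    proof (rule Lim_null_comparison)
      show "(\<lambda>n. norm (s n - l)) \<longlonglongrightarrow> 0"
        using l by (simp add: LIM_zero tendsto_norm_zero)
      show "\<forall>\<^sub>F n in sequentially. norm (\<rho> (s n) - \<rho> l) \<le> norm (s n - l)"
        using \<rho> s lB char_norm_le[OF \<rho>, of "s _ - l"] by (simp add: char_diff)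
    qed
    then have "(\<lambda>n. Re (\<rho> (s n))) \<longlonglongrightarrow> Re (\<rho> l)"
      by (intro tendsto_Re) (simp add: LIM_zero_iff)
    then show "0 \<le> Re (\<rho> l)"
      by (rule LIMSEQ_le_const) (use \<rho> s char_pos in blast)
  qed
  have "(\<lambda>n. a + of_real (inverse (real (Suc n)))) \<longlonglongrightarrow> a + of_real 0"
    by (intro tendsto_intros LIMSEQ_inverse_real_of_nat)
  moreover have "(\<lambda>n. s n * s n) \<longlonglongrightarrow> l * l"
    by (intro tendsto_intros l)
  ultimately have "l * l = a"
    unfolding ss using LIMSEQ_unique by fastforce
  then show thesis
    using that lB \<open>pos l\<close> by blast
qed

lemma pos_neg_parts:
  assumes a: "a \<in> B" "adj a = a"
  obtains p m where "p \<in> B" "m \<in> B" "pos p" "pos m" "a = p - m" "p * m = 0"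
proof -
  obtain s where s: "s \<in> B" "pos s" "s * s = a * a"
    using pos_sqrt[of "a * a"] a pos_square by auto
  define p where "p = (1/2) *\<^sub>R (s + a)"
  define m where "m = (1/2) *\<^sub>R (s - a)"
  have herm: "adj p = p" "adj m = m"
    using a s by (auto simp: p_def m_def adj_add adj_diff pos_herm)
  have "\<bar>Re (\<rho> a)\<bar> \<le> Re (\<rho> s)" if \<rho>: "\<rho> \<in> characters B" for \<rho>
  proof -
    have "\<rho> s * \<rho> s = \<rho> a * \<rho> a"
      using \<rho> s a by (simp flip: char_mult)
    then have "Re (\<rho> s) * Re (\<rho> s) = Re (\<rho> a) * Re (\<rho> a)"
      using char_herm_real[OF \<rho> s(1) pos_herm[OF s(2)]] char_herm_real[OF \<rho> a]
      by (metis of_real_mult Re_complex_of_real)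
    then have "\<bar>Re (\<rho> s)\<bar> = \<bar>Re (\<rho> a)\<bar>"
      by (simp add: power2_eq_iff abs_eq_iff flip: power2_eq_square)
    then show ?thesis
      using char_pos[OF \<rho> s(1,2)] by simp
  qed
  then have "pos p" "pos m"
    using a s herm
    by (auto intro!: pos_if_char_nonneg simp: p_def m_def char_scaleR char_add char_diff abs_le_iff)
      (smt (verit))+
  moreover have "p * m = (1/4) *\<^sub>R ((s + a) * (s - a))"
    by (simp add: p_def m_def)
  then have "p * m = 0"
    using s commute[of a s] a by (simp add: algebra_simps)
  moreover have "a = p - m"
    by (simp add: p_def m_def algebra_simps flip: scaleR_2)
  moreover have "p \<in> B" "m \<in> B"
    using s a by (simp_all add: p_def m_def)
  ultimately show thesis
    by (intro that[of p m])
qed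

end

text \<open>
  An algebraic form of the compactness of the character space. The elements that become positive after adding
  a multiple of a finite sum of squares from \<open>H\<close> are closed under sums and products and include all \<open>-h\<^sup>2\<close>. A
  character that is nonnegative on them would vanish on \<open>H\<close>; so they do not form a preordering and contain
  \<open>-1\<close>.
\<close>

lemma (in abelian_cstar) finite_square_sum_bounded_below:
  assumes H: "\<And>h. h \<in> H \<Longrightarrow> h \<in> B \<and> adj h = h"
    and nonvanishing: "\<And>\<rho>. \<rho> \<in> characters B \<Longrightarrow> \<exists>h\<in>H. \<rho> h \<noteq> 0"
  obtains F c where "finite F" "F \<subseteq> H" "c > 0" "pos ((\<Sum>h\<in>F. h * h) - of_real c)"
proof -
  define S where "S F = (\<Sum>h\<in>F. h * h)" for F :: "'a set"
  have S: "S F \<in> B" "pos (S F)" if "F \<subseteq> H" for F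
    using that H by (auto simp: S_def intro!: sum_mem pos_sum pos_square)
  have S_mono: "pos (S G - S F)" if "F \<subseteq> G" "G \<subseteq> H" "finite G" for F G
  proof -
    have "S G - S F = S (G - F)"
      using that by (simp add: S_def sum_diff)
    then show ?thesis
      using S(2)[of "G - F"] that by auto
  qed
  define T where "T = {a \<in> B. adj a = a \<and>
    (\<exists>F c. finite F \<and> F \<subseteq> H \<and> c \<ge> 0 \<and> pos (a + c *\<^sub>R S F))}"
  have T_I: "x \<in> T"
    if x: "x \<in> B" "adj x = x" and FG: "finite F" "F \<subseteq> H" "finite G" "G \<subseteq> H" and cd: "c \<ge> 0" "d \<ge> 0"
      and "pos (x + c *\<^sub>R S F + d *\<^sub>R S G)" for x F G c d
  proof -
    have "pos ((x + c *\<^sub>R S F + d *\<^sub>R S G) + c *\<^sub>R (S (F \<union> G) - S F) + d *\<^sub>R (S (F \<union> G) - S G))"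
      by (rule pos_add, rule pos_add) (use that in \<open>auto intro!: pos_scaleR S_mono\<close>)
    also have "(x + c *\<^sub>R S F + d *\<^sub>R S G) + c *\<^sub>R (S (F \<union> G) - S F) + d *\<^sub>R (S (F \<union> G) - S G)
        = x + (c + d) *\<^sub>R S (F \<union> G)"
      by (simp add: algebra_simps)
    finally show ?thesis
      using x FG cd by (auto simp: T_def intro!: exI[of _ "F \<union> G"] exI[of _ "c + d"])
  qed
  have add_mult: "x + y \<in> T \<and> x * y \<in> T" if xy: "x \<in> T" "y \<in> T" for x y
  proof -
    obtain F c where F: "finite F" "F \<subseteq> H" "c \<ge> 0" "pos (x + c *\<^sub>R S F)"
      using xy(1) by (auto simp: T_def)
    obtain G d where G: "finite G" "G \<subseteq> H" "d \<ge> 0" "pos (y + d *\<^sub>R S G)"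
      using xy(2) by (auto simp: T_def)
    have B: "x \<in> B" "y \<in> B" "adj x = x" "adj y = y"
      using xy by (auto simp: T_def)
    have "pos ((x + c *\<^sub>R S F) + (y + d *\<^sub>R S G))"
      by (rule pos_add[OF F(4) G(4)])
    then have "pos ((x + y) + c *\<^sub>R S F + d *\<^sub>R S G)"
      by (simp add: algebra_simps)
    then have 1: "x + y \<in> T"
      using T_I[of "x + y" F G c d] F G B by (simp add: adj_add)
    define p where "p = x + c *\<^sub>R S F"
    define q where "q = y + d *\<^sub>R S G"
    define N where "N = max (norm p) (norm q)"
    have pq: "p \<in> B" "q \<in> B" "pos p" "pos q"
      using F G B S by (auto simp: p_def q_def)
    have N: "pos (of_real N - p)" "pos (of_real N - q)" "N \<ge> 0"
      using pq by (auto simp: N_def pos_herm le_max_iff_disj intro!: pos_norm_minus)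
    have "pos (p * q + (c * d) *\<^sub>R (S F * S G) + d *\<^sub>R ((of_real N - p) * S G)
        + c *\<^sub>R ((of_real N - q) * S F))"
      using pq S[OF F(2)] S[OF G(2)] N F G by (intro pos_add pos_scaleR pos_mult) auto
    also have "p * q + (c * d) *\<^sub>R (S F * S G) + d *\<^sub>R ((of_real N - p) * S G)
        + c *\<^sub>R ((of_real N - q) * S F) = x * y + (c * N) *\<^sub>R S F + (d * N) *\<^sub>R S G"
      using commute[OF S(1)[OF F(2)] B(2)] commute[OF S(1)[OF F(2)] S(1)[OF G(2)]]
      by (simp add: p_def q_def algebra_simps of_real_mult_eq_scaleR)
    finally have "x * y \<in> T"
      using T_I[of "x * y" F G "c * N" "d * N"] F G B N by (simp add: adj_mult_herm)
    then show ?thesis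
      using 1 by blast
  qed
  have not_pre: "\<not> preordering T"
  proof
    assume "preordering T"
    then obtain \<rho> where \<rho>: "\<rho> \<in> characters B" "\<And>x. x \<in> T \<Longrightarrow> 0 \<le> Re (\<rho> x)"
      using preordering_character by metis
    obtain h where h: "h \<in> H" "\<rho> h \<noteq> 0"
      using nonvanishing[OF \<rho>(1)] by blast
    have hB: "h \<in> B" "adj h = h"
      using H h by auto
    have "- (h * h) \<in> T"
      using hB h by (auto simp: T_def adj_mult_herm S_def intro!: exI[of _ "{h}"] exI[of _ "1::real"])
    then have "0 \<le> Re (\<rho> (- (h * h)))"
      by (rule \<rho>(2))
    then have "0 \<le> - Re (\<rho> h * \<rho> h)"
      using hB \<rho> by (simp add: char_minus char_mult)
    moreover obtain r where "\<rho> h = of_real r"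
      using char_herm_real[OF \<rho>(1) hB] by blast
    ultimately have "r * r \<le> 0" "r \<noteq> 0"
      using h by simp_all
    then show False
      using zero_less_mult_iff[of r r] by linarith
  qed
  have "x \<in> T" if "x \<in> B" "pos x" for x
    using that T_I[of x "{}" "{}" 0 0] by (simp add: pos_herm)
  moreover have "x \<in> B \<and> adj x = x" if "x \<in> T" for x
    using that by (simp add: T_def)
  ultimately have "- 1 \<in> T"
    using not_pre add_mult unfolding preordering_def by blast
  then obtain F c where F: "finite F" "F \<subseteq> H" "c \<ge> 0" "pos (- 1 + c *\<^sub>R S F)"
    by (auto simp: T_def)
  have "\<not> pos (- 1 :: 'a)"
  proof
    assume "pos (- 1 :: 'a)"
    then obtain t where t: "t > 0" "norm (of_real t - (- 1 :: 'a)) \<le> t"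
      using posE[of _ 0] by metis
    have "of_real t - (- 1 :: 'a) = of_real (t + 1)"
      by simp
    then show False
      using t by (simp only: norm_of_real)
  qed
  then have c: "c > 0"
    using F by (cases "c = 0") auto
  then have "pos ((1 / c) *\<^sub>R (- 1 + c *\<^sub>R S F))"
    using F by (intro pos_scaleR) auto
  also have "(1 / c) *\<^sub>R (- 1 + c *\<^sub>R S F) = S F - of_real (1 / c)"
    using c by (simp add: of_real_def scaleR_right_diff_distrib)
  finally show thesis
    using that[OF F(1,2), of "1 / c"] c by (simp add: S_def)
qed


section \<open>Positivity in noncommutative algebras\<close>

definition bicommutant :: "'a::cstar_algebra set \<Rightarrow> 'a set" where
  "bicommutant S = {x. \<forall>y. (\<forall>s\<in>S. y * s = s * y) \<longrightarrow> x * y = y * x}"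

lemma bicommutant_superset: "S \<subseteq> bicommutant S"
  by (auto simp: bicommutant_def)

text \<open>
  Every hermitian element lies in its own bicommutant, so the theory of abelian subalgebras applies to it.
\<close>

lemma bicommutant_abelian:
  fixes S :: "'a::cstar_algebra set"
  assumes comm: "\<And>s t. s \<in> S \<Longrightarrow> t \<in> S \<Longrightarrow> s * t = t * s" and star: "\<And>s. s \<in> S \<Longrightarrow> adj s \<in> S"
  shows "abelian_cstar (bicommutant S)"
proof
  let ?C = "{y. \<forall>s\<in>S. y * s = s * y}"
  have eq: "bicommutant S = (\<Inter>y\<in>?C. {x. x * y = y * x})"
    by (auto simp: bicommutant_def)
  have "csubspace (bicommutant S)"
    by (intro cvs.subspaceI)
      (auto simp: bicommutant_def distrib_left distrib_right mult_scaleC_left mult_scaleC_right)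
  moreover have "closed (bicommutant S)"
    unfolding eq by (intro closed_INT ballI closed_Collect_eq continuous_intros)
  moreover have "x * x' \<in> bicommutant S" if "x \<in> bicommutant S" "x' \<in> bicommutant S" for x x'
    using that unfolding bicommutant_def by (auto) (metis mult.assoc)
  moreover have "adj x \<in> bicommutant S" if x: "x \<in> bicommutant S" for x
    unfolding bicommutant_def
  proof (intro CollectI allI impI)
    fix y assume y: "\<forall>s\<in>S. y * s = s * y"
    have "adj y * s = s * adj y" if "s \<in> S" for s
      using arg_cong[OF y[rule_format, OF star[OF that]], of adj] by (simp add: adj_mult adj_adj)
    then have "x * adj y = adj y * x"
      using x unfolding bicommutant_def by blast
    from arg_cong[OF this, of adj] show "adj x * y = y * adj x"
      by (simp add: adj_mult adj_adj)
  qed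
  moreover have "x * x' = x' * x" if "x \<in> bicommutant S" "x' \<in> bicommutant S" for x x'
    using that comm unfolding bicommutant_def by blast
  ultimately show "abelian_cstar_subalgebra (bicommutant S)"
    by (simp add: abelian_cstar_subalgebra_def norm_closed_subalgebra_def)
  show "1 \<in> bicommutant S"
    by (simp add: bicommutant_def)
qed

lemma herm_in_abelian:
  fixes a :: "'a::cstar_algebra"
  assumes "adj a = a"
  obtains B where "abelian_cstar B" "a \<in> B"
  using bicommutant_abelian[of "{a}"] bicommutant_superset[of "{a}"] assms by auto

lemma pos_square_herm: "adj a = a \<Longrightarrow> pos (a * a)"
  by (metis herm_in_abelian abelian_cstar.pos_square)

lemma pos_sqrt_ex:
  assumes "pos a"
  obtains s where "pos s" "s * s = a"
proof -
  obtain B where "abelian_cstar B" "a \<in> B"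
    using herm_in_abelian[OF pos_herm[OF assms]] .
  then show thesis
    using abelian_cstar.pos_sqrt[of B a] assms that by blast
qed

lemma herm_norm_le:
  fixes a :: "'a::cstar_algebra"
  assumes "pos (of_real c - a)" "pos (of_real c + a)" "c \<ge> 0"
  shows "norm a \<le> c"
proof -
  have "adj (of_real c + a) = of_real c + a"
    using assms pos_herm by blast
  then have "adj a = a"
    by (simp add: adj_add)
  then obtain B where "abelian_cstar B" "a \<in> B"
    by (rule herm_in_abelian)
  then show ?thesis
    using abelian_cstar.norm_le_if_pos assms by blast
qed

lemma pos_norm_mono:
  assumes "pos a" "pos (b - a)"
  shows "norm a \<le> norm b"
proof (rule herm_norm_le)
  have "pos (a + (b - a))"
    using assms by (rule pos_add)
  then have "adj b = b"
    by (simp add: pos_herm)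
  then have "pos (of_real (norm b) - b)"
    by (rule pos_norm_minus) simp
  then have "pos ((of_real (norm b) - b) + (b - a))"
    using assms by (intro pos_add)
  then show "pos (of_real (norm b) - a)"
    by simp
  show "pos (of_real (norm b) + a)"
    using assms by (intro pos_add pos_of_real) auto
qed simp

text \<open>
  For \<open>a = y\<^sup>* y\<close> and \<open>b = y y\<^sup>*\<close> the identity \<open>(t + b)\<^sup>n b = y (t + a)\<^sup>n y\<^sup>*\<close> holds. If \<open>-a\<close> is positive, the norm of
  \<open>t + a\<close> is at most \<open>t\<close> for a suitable \<open>t\<close>, so the identity gives \<open>(t + b)\<^sup>n b = O(t\<^sup>n)\<close>. No character can be
  positive at \<open>b\<close>, because its values at the left-hand side would grow faster than \<open>t\<^sup>n\<close>.
\<close>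

lemma pos_minus_swap:
  fixes y :: "'a::cstar_algebra"
  assumes "pos (- (adj y * y))"
  shows "pos (- (y * adj y))"
proof -
  define a where "a = adj y * y"
  define b where "b = y * adj y"
  obtain t where t: "t > 0" "norm (of_real t + a) \<le> t"
    using posE[OF assms, of 0] by (auto simp: a_def)
  have "(of_real t + b) ^ n * b = y * (of_real t + a) ^ n * adj y" for n
  proof (induction n)
    case (Suc n)
    have "(of_real t + b) * y = y * (of_real t + a)"
      by (simp add: a_def b_def algebra_simps mult_of_real_eq_scaleR of_real_mult_eq_scaleR)
    then have "(of_real t + b) * (y * z) = y * ((of_real t + a) * z)" for z
      by (metis mult.assoc)
    then show ?case
      using Suc by (simp add: mult.assoc)
  qed (simp add: b_def)
  note eq = this
  have bound: "norm ((of_real t + b) ^ n * b) \<le> (norm y)\<^sup>2 * t ^ n" for n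
  proof -
    have "norm (y * (of_real t + a) ^ n * adj y) \<le> norm y * norm (of_real t + a) ^ n * norm y"
      using norm_mult_ineq[of "y * (of_real t + a) ^ n" "adj y"] norm_mult_ineq[of y "(of_real t + a) ^ n"]
        norm_power_ineq[of "of_real t + a" n]
      by (smt (verit) mult_left_mono mult_right_mono norm_adj norm_ge_zero)
    also have "\<dots> \<le> norm y * t ^ n * norm y"
      using t by (intro mult_left_mono mult_right_mono power_mono) auto
    finally show ?thesis
      by (simp add: eq power2_eq_square mult_ac)
  qed
  have b: "adj b = b"
    by (simp add: b_def adj_mult adj_adj)
  obtain B where B: "abelian_cstar B" "b \<in> B"
    using herm_in_abelian[OF b] .
  interpret abelian_cstar B
    by fact
  have "pos (- b)"
  proof (rule pos_if_char_nonneg)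
    fix \<rho> assume \<rho>: "\<rho> \<in> characters B"
    define \<beta> where "\<beta> = Re (\<rho> b)"
    have \<beta>: "\<rho> b = of_real \<beta>"
      using char_herm_real[OF \<rho> B(2) b] by (simp add: \<beta>_def)
    have "\<not> \<beta> > 0"
    proof
      assume pos: "\<beta> > 0"
      obtain n :: nat where n: "(norm y)\<^sup>2 < real n * (\<beta> / t * \<beta>)"
        using reals_Archimedean3[of "\<beta> / t * \<beta>"] pos t by auto
      have "cmod (\<rho> ((of_real t + b) ^ n * b)) = (t + \<beta>) ^ n * \<beta>"
        using \<rho> B pos t \<beta>
        by (simp add: char_mult char_power char_add char_of_real norm_mult norm_power flip: of_real_add)
      then have "(t + \<beta>) ^ n * \<beta> \<le> (norm y)\<^sup>2 * t ^ n"
        using char_norm_le[OF \<rho>, of "(of_real t + b) ^ n * b"] bound[of n] B by simp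
      moreover have "(t + \<beta>) ^ n = (1 + \<beta> / t) ^ n * t ^ n"
        using t by (simp add: field_simps flip: power_mult_distrib)
      ultimately have "(1 + \<beta> / t) ^ n * \<beta> \<le> (norm y)\<^sup>2"
        using t by (simp add: mult_ac)
      moreover have "1 + real n * (\<beta> / t) \<le> (1 + \<beta> / t) ^ n"
        using pos t by (intro Bernoulli_inequality) (smt (verit) divide_nonneg_nonneg)
      then have "(1 + real n * (\<beta> / t)) * \<beta> \<le> (1 + \<beta> / t) ^ n * \<beta>"
        using pos by (intro mult_right_mono) auto
      ultimately show False
        using n pos by (simp add: algebra_simps)
    qed
    then show "0 \<le> Re (\<rho> (- b))"
      using \<rho> B \<beta> by (simp add: char_minus)
  qed (use B b in auto)
  then show ?thesis
    by (simp add: b_def)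
qed

text \<open>
  Let \<open>x\<^sup>* x = p - m\<close> with positive \<open>p\<close> and \<open>m\<close> such that \<open>p m = 0\<close>. Then \<open>y = x m\<close> satisfies \<open>y\<^sup>* y = -m\<^sup>3 \<le> 0\<close>,
  hence \<open>y y\<^sup>* \<le> 0\<close>. But \<open>y\<^sup>* y + y y\<^sup>* = 2 (u\<^sup>2 + w\<^sup>2)\<close> for the real and imaginary parts \<open>u\<close> and \<open>w\<close> of \<open>y\<close>, so
  \<open>y\<^sup>* y\<close> is positive as well. Therefore \<open>m\<^sup>3 = 0\<close> and \<open>m = 0\<close>.
\<close>

theorem pos_adj_mult: "pos (adj x * x)" for x :: "'a::cstar_algebra"
proof -
  define b where "b = adj x * x"
  have b: "adj b = b"
    by (simp add: b_def adj_mult adj_adj)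
  obtain B where B: "abelian_cstar B" "b \<in> B"
    using herm_in_abelian[OF b] .
  interpret abelian_cstar B
    by fact
  obtain p m where pm: "p \<in> B" "m \<in> B" "pos p" "pos m" "b = p - m" "p * m = 0"
    using pos_neg_parts[OF B(2) b] by blast
  define y where "y = x * m"
  define u where "u = re_part y"
  define w where "w = im_part y"
  have "adj y * y = m * b * m"
    by (simp only: y_def b_def adj_mult pos_herm[OF pm(4)] mult.assoc)
  also have "\<dots> = m * (p * m) - m * m * m"
    by (simp add: pm(5) algebra_simps)
  finally have yy: "adj y * y = - (m * m * m)"
    using pm by simp
  have mmm: "pos (m * m * m)"
    using pm by (intro pos_mult) auto
  then have "pos (- (y * adj y))"
    by (intro pos_minus_swap) (simp add: yy)
  moreover have "pos (2 *\<^sub>R (u * u + w * w))"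
    by (intro pos_scaleR pos_add pos_square_herm) (auto simp: u_def w_def)
  ultimately have "pos (2 *\<^sub>R (u * u + w * w) + - (y * adj y))"
    by (rule pos_add[rotated])
  moreover have "adj y * y + y * adj y = 2 *\<^sub>R (u * u + w * w)"
  proof -
    have y: "y = u + \<i> *\<^sub>C w"
      unfolding u_def w_def by (rule re_im_decomp)
    have "adj (u + \<i> *\<^sub>C w) = u - \<i> *\<^sub>C w"
      by (simp add: adj_add adj_scaleC u_def w_def)
    then have adj_y: "adj y = u - \<i> *\<^sub>C w"
      by (simp only: y)
    have "(u - \<i> *\<^sub>C w) * (u + \<i> *\<^sub>C w) + (u + \<i> *\<^sub>C w) * (u - \<i> *\<^sub>C w) = 2 *\<^sub>R (u * u + w * w)"
      by (simp add: algebra_simps mult_scaleC_left mult_scaleC_right scaleR_2)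
    then show ?thesis
      by (simp only: adj_y) (simp only: y)
  qed
  ultimately have "pos (adj y * y)"
    by (metis add_diff_cancel_right' diff_conv_add_uminus)
  then have "norm (m * m * m) \<le> 0"
    using mmm pm by (intro norm_le_if_pos) (auto simp: yy)
  then have m3: "m * m * m = 0"
    by simp
  have "m = 0"
  proof (rule eq_if_char_eq)
    fix \<rho> assume \<rho>: "\<rho> \<in> characters B"
    have "\<rho> m * \<rho> m * \<rho> m = \<rho> (m * m * m)"
      using \<rho> pm by (simp add: char_mult)
    then show "\<rho> m = \<rho> 0"
      using \<rho> by (simp add: m3 char_zero)
  qed (use pm in auto)
  then show ?thesis
    using pm by (simp add: b_def)
qed

lemma pos_conj:
  assumes "pos a"
  shows "pos (adj x * a * x)"
proof -
  obtain s where s: "pos s" "s * s = a"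
    using pos_sqrt_ex[OF assms] .
  have "adj x * a * x = adj (s * x) * (s * x)"
    using s by (simp add: adj_mult pos_herm mult.assoc flip: s(2))
  then show ?thesis
    by (simp only: pos_adj_mult)
qed

lemma pos_mult_adj: "pos (x * adj x)"
  using pos_adj_mult[of "adj x"] by (simp add: adj_adj)

lemma pos_conj_herm: "pos a \<Longrightarrow> adj h = h \<Longrightarrow> pos (h * a * h)"
  using pos_conj[of a h] by simp

section \<open>The Hahn--Banach theorem\<close>

definition sublinear :: "('v::real_vector \<Rightarrow> real) \<Rightarrow> bool" where
  "sublinear p \<longleftrightarrow> (\<forall>x y. p (x + y) \<le> p x + p y) \<and> (\<forall>x. \<forall>t>0. p (t *\<^sub>R x) \<le> t * p x)"

lemma sublinear_add: "sublinear p \<Longrightarrow> p (x + y) \<le> p x + p y"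
  by (simp add: sublinear_def)

lemma sublinear_zero:
  assumes "sublinear p"
  shows "p 0 = 0"
proof -
  have "p ((1/2) *\<^sub>R 0) \<le> (1/2) * p 0"
    using assms by (simp only: sublinear_def)
  moreover have "p (0 + 0) \<le> p 0 + p 0"
    using assms by (rule sublinear_add)
  ultimately show ?thesis
    by simp
qed

lemma sublinear_scaleR:
  assumes "sublinear p" "t \<ge> 0"
  shows "p (t *\<^sub>R x) = t * p x"
proof (cases "t = 0")
  case False
  then have "t > 0"
    using assms by simp
  then have "p (t *\<^sub>R x) \<le> t * p x" "p ((1 / t) *\<^sub>R (t *\<^sub>R x)) \<le> (1 / t) * p (t *\<^sub>R x)"
    using assms(1) by (simp_all only: sublinear_def zero_less_divide_1_iff)
  then show ?thesis
    using \<open>t > 0\<close> by (simp add: field_simps)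
qed (use assms sublinear_zero in simp)

lemma sublinear_minus: "sublinear p \<Longrightarrow> - p (- x) \<le> p x"
  using sublinear_add[of p x "- x"] sublinear_zero[of p] by simp

text \<open>
  Lowering a sublinear functional as far as possible in the direction \<open>-y\<close>; a functional that cannot
  be lowered any more is linear.
\<close>

definition lower_along :: "'v::real_vector \<Rightarrow> ('v \<Rightarrow> real) \<Rightarrow> 'v \<Rightarrow> real" where
  "lower_along y p x = (INF t\<in>{0..}. p (x + t *\<^sub>R y) - t * p y)"

lemma lower_along:
  assumes p: "sublinear p"
  shows "sublinear (lower_along y p)" "lower_along y p x \<le> p x" "lower_along y p (- y) \<le> - p y"
proof -
  have low: "- p (- x) \<le> p (x + t *\<^sub>R y) - t * p y" if "t \<ge> 0" for x t
    using sublinear_add[OF p, of "x + t *\<^sub>R y" "- x"] sublinear_scaleR[OF p that, of y] by simp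
  have bdd: "bdd_below ((\<lambda>t. p (x + t *\<^sub>R y) - t * p y) ` {0..})" for x
    using low by (intro bdd_belowI2) auto
  have le: "lower_along y p x \<le> p (x + t *\<^sub>R y) - t * p y" if "t \<ge> 0" for x t
    unfolding lower_along_def using that by (intro cINF_lower[OF bdd]) auto
  have ge: "c \<le> lower_along y p x" if "\<And>t. t \<ge> 0 \<Longrightarrow> c \<le> p (x + t *\<^sub>R y) - t * p y" for c x
    unfolding lower_along_def using that by (intro cINF_greatest) auto
  show "lower_along y p x \<le> p x"
    using le[of 0 x] by simp
  show "lower_along y p (- y) \<le> - p y"
    using le[of 1 "- y"] sublinear_zero[OF p] by simp
  show "sublinear (lower_along y p)"
    unfolding sublinear_def
  proof (intro conjI allI impI)
    fix u v
    have "lower_along y p (u + v) - (p (v + t *\<^sub>R y) - t * p y) \<le> lower_along y p u"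
      if t: "t \<ge> 0" for t
    proof (rule ge)
      fix s :: real assume s: "s \<ge> 0"
      have "lower_along y p (u + v) \<le> p ((u + s *\<^sub>R y) + (v + t *\<^sub>R y)) - (s + t) * p y"
        using le[of "s + t" "u + v"] s t by (simp add: algebra_simps)
      also have "\<dots> \<le> p (u + s *\<^sub>R y) + p (v + t *\<^sub>R y) - (s + t) * p y"
        using sublinear_add[OF p] by simp
      finally show "lower_along y p (u + v) - (p (v + t *\<^sub>R y) - t * p y) \<le> p (u + s *\<^sub>R y) - s * p y"
        by (simp add: algebra_simps)
    qed
    then have "lower_along y p (u + v) - lower_along y p u \<le> lower_along y p v"
      by (intro ge) (simp add: algebra_simps)
    then show "lower_along y p (u + v) \<le> lower_along y p u + lower_along y p v"
      by simp
  next
    fix u and c :: real assume c: "c > 0"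
    have "lower_along y p (c *\<^sub>R u) / c \<le> lower_along y p u"
    proof (rule ge)
      fix t :: real assume t: "t \<ge> 0"
      have "lower_along y p (c *\<^sub>R u) \<le> p (c *\<^sub>R (u + t *\<^sub>R y)) - (c * t) * p y"
        using le[of "c * t" "c *\<^sub>R u"] c t by (simp add: algebra_simps)
      also have "\<dots> = c * (p (u + t *\<^sub>R y) - t * p y)"
        using sublinear_scaleR[OF p, of c "u + t *\<^sub>R y"] c by (simp add: right_diff_distrib mult.assoc)
      finally show "lower_along y p (c *\<^sub>R u) / c \<le> p (u + t *\<^sub>R y) - t * p y"
        using c by (simp add: field_simps)
    qed
    then show "lower_along y p (c *\<^sub>R u) \<le> c * lower_along y p u"
      using c by (simp add: field_simps)
  qed
qed

lemma minimal_sublinear: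
  assumes p: "sublinear (p :: 'v::real_vector \<Rightarrow> real)"
  obtains m where "sublinear m" "\<And>x. m x \<le> p x" "\<And>q. sublinear q \<Longrightarrow> (\<And>x. q x \<le> m x) \<Longrightarrow> q = m"
proof -
  define A where "A = {q. sublinear q \<and> q \<le> p}"
  let ?P = "\<lambda>q r :: 'v \<Rightarrow> real. r \<le> q"
  have "\<exists>m\<in>A. \<forall>a\<in>A. ?P m a \<longrightarrow> a = m"
  proof (rule predicate_Zorn)
    show "partial_order_on A (relation_of ?P A)"
      by (rule partial_order_on_relation_ofI) auto
    fix C assume "C \<in> Chains (relation_of ?P A)"
    then have C: "q \<in> A" "r \<in> A" "q \<le> r \<or> r \<le> q" if "q \<in> C" "r \<in> C" for q r
      using that by (auto simp: Chains_def relation_of_def)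
    show "\<exists>u\<in>A. \<forall>a\<in>C. ?P a u"
    proof (cases "C = {}")
      case True
      then show ?thesis
        using p by (auto simp: A_def)
    next
      case False
      then obtain q0 where q0: "q0 \<in> C"
        by blast
      define u where "u x = (INF q\<in>C. q x)" for x
      have low: "- p (- x) \<le> q x" if "q \<in> C" for q x
      proof -
        have "sublinear q" "q (- x) \<le> p (- x)"
          using C(1)[OF that that] by (auto simp: A_def le_fun_def)
        then show ?thesis
          using sublinear_minus[of q x] by simp
      qed
      have bdd: "bdd_below ((\<lambda>q. q x) ` C)" for x
        using low by (intro bdd_belowI2) auto
      have le: "u x \<le> q x" if "q \<in> C" for q x
        unfolding u_def using that by (intro cINF_lower[OF bdd])
      have ge: "c \<le> u x" if "\<And>q. q \<in> C \<Longrightarrow> c \<le> q x" for c x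
        unfolding u_def using that False by (intro cINF_greatest)
      have "sublinear u"
        unfolding sublinear_def
      proof (intro conjI allI impI)
        fix x y
        have "u (x + y) - q y \<le> u x" if q: "q \<in> C" for q
        proof (rule ge)
          fix r assume r: "r \<in> C"
          obtain s where s: "s \<in> C" "s \<le> q" "s \<le> r"
            using C(3)[OF q r] q r by auto
          have "u (x + y) \<le> s (x + y)"
            by (rule le[OF s(1)])
          also have "\<dots> \<le> s x + s y"
            using C(1)[OF s(1) s(1)] by (auto simp: A_def intro: sublinear_add)
          also have "\<dots> \<le> r x + q y"
            using s by (intro add_mono) (auto simp: le_fun_def)
          finally show "u (x + y) - q y \<le> r x"
            by simp
        qed
        then have "u (x + y) - u x \<le> u y"
          by (intro ge) (simp add: algebra_simps)
        then show "u (x + y) \<le> u x + u y"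
          by simp
      next
        fix x and t :: real assume t: "t > 0"
        have "u (t *\<^sub>R x) / t \<le> u x"
        proof (rule ge)
          fix q assume q: "q \<in> C"
          then have "u (t *\<^sub>R x) \<le> t * q x"
            using le[OF q, of "t *\<^sub>R x"] C(1)[OF q q] sublinear_scaleR[of q t x] t by (simp add: A_def)
          then show "u (t *\<^sub>R x) / t \<le> q x"
            using t by (simp add: field_simps)
        qed
        then show "u (t *\<^sub>R x) \<le> t * u x"
          using t by (simp add: field_simps)
      qed
      moreover have "u \<le> p"
        using le[OF q0] C(1)[OF q0 q0] by (auto simp: A_def le_fun_def intro: order_trans)
      ultimately show ?thesis
        using le by (auto simp: A_def le_fun_def)
    qed
  qed
  then obtain m where m: "m \<in> A" "\<forall>a\<in>A. a \<le> m \<longrightarrow> a = m"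
    by blast
  show thesis
  proof (rule that[of m])
    show "sublinear m" "m x \<le> p x" for x
      using m(1) by (auto simp: A_def le_fun_def)
    show "q = m" if "sublinear q" "\<And>x. q x \<le> m x" for q
      using m that by (auto simp: A_def le_fun_def intro: order_trans)
  qed
qed

text \<open>
  A minimal sublinear functional below \<open>p\<close> is linear. Lowering \<open>p\<close> along \<open>y\<close> first makes the value at \<open>-y\<close> at
  most \<open>-p y\<close>, which forces \<open>g y = p y\<close>.
\<close>

theorem hahn_banach_touching:
  assumes p: "sublinear (p :: 'v::real_vector \<Rightarrow> real)"
  obtains g where "linear g" "\<And>x. g x \<le> p x" "g y = p y"
proof -
  obtain m where m: "sublinear m" and m_le: "\<And>x. m x \<le> lower_along y p x"
    and min: "\<And>q. sublinear q \<Longrightarrow> (\<And>x. q x \<le> m x) \<Longrightarrow> q = m"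
    using minimal_sublinear[OF lower_along(1)[OF p, of y]] by metis
  have "lower_along z m = m" for z
    using min lower_along(1,2)[OF m] by blast
  then have "m (- z) \<le> - m z" for z
    using lower_along(3)[OF m, of z] by simp
  then have minus: "m (- z) = - m z" for z
    using sublinear_minus[OF m, of z] by (smt (verit) minus_minus)
  have add: "m (x + z) = m x + m z" for x z
    using sublinear_add[OF m, of x z] sublinear_add[OF m, of "- x" "- z"] minus[of "x + z"] minus[of x] minus[of z]
    by simp
  have scale: "m (c *\<^sub>R x) = c * m x" for c x
  proof (cases "c \<ge> 0")
    case False
    then have "m (- ((- c) *\<^sub>R x)) = - ((- c) * m x)"
      unfolding minus using sublinear_scaleR[OF m, of "- c" x] by simp
    then show ?thesis
      by simp
  qed (rule sublinear_scaleR[OF m])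
  have "linear m"
    by (rule linearI) (simp_all add: add scale)
  moreover have le: "m x \<le> p x" for x
    using m_le[of x] lower_along(2)[OF p, of y x] by simp
  moreover have "m y = p y"
    using m_le[of "- y"] lower_along(3)[OF p, of y] minus[of y] le[of y] by simp
  ultimately show thesis
    using that by blast
qed

text \<open>
  The modulus of \<open>\<psi>(x)\<close> is the real part of \<open>\<psi>\<close> at a rotation \<open>c x\<close> with \<open>|c| = 1\<close>, so the bound for \<open>g\<close>
  carries over to \<open>\<psi>\<close>.
\<close>

lemma complexification:
  fixes g :: "'a::cstar_algebra \<Rightarrow> real"
  assumes g: "linear g" and g_norm: "\<And>x. g x \<le> K * norm x" and K: "K \<ge> 0"
  obtains \<psi> where "clinear_on UNIV \<psi>" "\<And>x. cmod (\<psi> x) \<le> K * norm x" "\<And>x. Re (\<psi> x) = g x"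
    "\<And>x. Im (\<psi> x) = - g (\<i> *\<^sub>C x)"
proof -
  have g_add: "g (x + y) = g x + g y" and g_scale: "g (t *\<^sub>R x) = t * g x" and g_minus: "g (- x) = - g x"
    for x y t
    using g by (simp_all add: linear_add linear_scale linear_neg)
  define \<psi> where "\<psi> x = Complex (g x) (- g (\<i> *\<^sub>C x))" for x
  have \<psi>_add: "\<psi> (x + y) = \<psi> x + \<psi> y" for x y
    by (simp add: \<psi>_def g_add scaleC_add_right complex_eq_iff)
  have \<psi>_scaleR: "\<psi> (complex_of_real t *\<^sub>C x) = of_real t * \<psi> x" for t x
  proof -
    have "\<i> *\<^sub>C (t *\<^sub>R x) = t *\<^sub>R (\<i> *\<^sub>C x)"
      by (simp add: scaleR_eq_scaleC[where 'a = 'a] scaleC_scaleC mult.commute)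
    then show ?thesis
      by (simp add: \<psi>_def g_scale complex_eq_iff scaleC_of_real)
  qed
  have \<psi>_ii: "\<psi> (\<i> *\<^sub>C x) = \<i> * \<psi> x" for x
    by (simp add: \<psi>_def g_minus complex_eq_iff)
  have \<psi>_scaleC: "\<psi> (c *\<^sub>C x) = c * \<psi> x" for c x
  proof -
    have c: "c = complex_of_real (Re c) + \<i> * complex_of_real (Im c)"
      by (rule complex_eq)
    have "\<psi> ((complex_of_real (Re c) + \<i> * complex_of_real (Im c)) *\<^sub>C x)
        = (complex_of_real (Re c) + \<i> * complex_of_real (Im c)) * \<psi> x"
      by (simp only: scaleC_add_left \<psi>_add \<psi>_scaleR \<psi>_ii scaleC_scaleC[symmetric] distrib_right mult.assoc)
    then show ?thesis
      by (simp only: c[symmetric])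
  qed
  show thesis
  proof (rule that[of \<psi>])
    show "clinear_on UNIV \<psi>"
      by (simp add: clinear_on_def \<psi>_add \<psi>_scaleC scaleC_complex_def)
    show "Re (\<psi> x) = g x" "Im (\<psi> x) = - g (\<i> *\<^sub>C x)" for x
      by (simp_all add: \<psi>_def)
    show "cmod (\<psi> x) \<le> K * norm x" for x
    proof (cases "\<psi> x = 0")
      case False
      define c where "c = cnj (\<psi> x) / of_real (cmod (\<psi> x))"
      have c: "cmod c = 1"
        using False by (simp add: c_def norm_divide)
      have "\<psi> (c *\<^sub>C x) = of_real (cmod (\<psi> x))"
        using False unfolding \<psi>_scaleC c_def
        by (simp add: complex_norm_square[symmetric] power2_eq_square mult.commute field_simps)
      then have "cmod (\<psi> x) = g (c *\<^sub>C x)"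
        by (simp add: \<psi>_def complex_eq_iff)
      also have "\<dots> \<le> K * norm x"
        using g_norm[of "c *\<^sub>C x"] c by (simp add: norm_scaleC)
      finally show ?thesis .
    qed (use K in simp)
  qed
qed

text \<open>
  For a subspace \<open>A\<close> and a functional \<open>\<phi>\<close> on it, the functional \<open>x \<mapsto> inf (K \<parallel>x - a\<parallel> + Re \<phi>(a))\<close> is
  sublinear, and a linear functional below it agrees with \<open>Re \<phi>\<close> on \<open>A\<close>.
\<close>

theorem hahn_banach_complex:
  fixes A :: "'a::cstar_algebra set"
  assumes A: "csubspace A" and \<phi>: "clinear_on A \<phi>" and bound: "\<And>x. x \<in> A \<Longrightarrow> cmod (\<phi> x) \<le> K * norm x"
    and K: "K \<ge> 0"
  obtains \<psi> where "clinear_on UNIV \<psi>" "\<And>x. cmod (\<psi> x) \<le> K * norm x" "\<And>x. x \<in> A \<Longrightarrow> \<psi> x = \<phi> x"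
proof -
  have A0: "0 \<in> A" and A_add: "\<And>x y. x \<in> A \<Longrightarrow> y \<in> A \<Longrightarrow> x + y \<in> A"
    and A_scaleC: "\<And>c x. x \<in> A \<Longrightarrow> c *\<^sub>C x \<in> A"
    using A by (auto simp: cvs.subspace_def)
  have A_scaleR: "t *\<^sub>R x \<in> A" if "x \<in> A" for t x
    using A_scaleC[OF that] by (simp add: scaleR_eq_scaleC)
  have \<phi>_add: "\<phi> (x + y) = \<phi> x + \<phi> y" if "x \<in> A" "y \<in> A" for x y
    using \<phi> that by (simp add: clinear_on_def)
  have \<phi>_scaleC: "\<phi> (c *\<^sub>C x) = c * \<phi> x" if "x \<in> A" for c x
    using \<phi> that by (simp add: clinear_on_def scaleC_complex_def)
  have \<phi>_scaleR: "\<phi> (t *\<^sub>R x) = of_real t * \<phi> x" if "x \<in> A" for t x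
    using \<phi>_scaleC[OF that] by (simp add: scaleR_eq_scaleC)
  have \<phi>0: "\<phi> 0 = 0"
    using \<phi>_scaleR[OF A0, of 0] by simp
  define p where "p x = (INF a\<in>A. K * norm (x - a) + Re (\<phi> a))" for x
  have low: "- (K * norm x) \<le> K * norm (x - a) + Re (\<phi> a)" if "a \<in> A" for x a
  proof -
    have "- Re (\<phi> a) \<le> K * norm a"
      using bound[OF that] abs_Re_le_cmod[of "\<phi> a"] by linarith
    also have "\<dots> \<le> K * (norm x + norm (x - a))"
      using norm_triangle_sub[of a x] K by (intro mult_left_mono) (auto simp: norm_minus_commute)
    finally show ?thesis
      by (simp add: distrib_left)
  qed
  have bdd: "bdd_below ((\<lambda>a. K * norm (x - a) + Re (\<phi> a)) ` A)" for x
    using low by (intro bdd_belowI2) auto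
  have le: "p x \<le> K * norm (x - a) + Re (\<phi> a)" if "a \<in> A" for x a
    unfolding p_def using that by (intro cINF_lower[OF bdd])
  have ge: "c \<le> p x" if "\<And>a. a \<in> A \<Longrightarrow> c \<le> K * norm (x - a) + Re (\<phi> a)" for c x
    unfolding p_def using that A0 by (intro cINF_greatest) auto
  have "sublinear p"
    unfolding sublinear_def
  proof (intro conjI allI impI)
    fix x y
    have "p (x + y) - (K * norm (y - b) + Re (\<phi> b)) \<le> p x" if b: "b \<in> A" for b
    proof (rule ge)
      fix a assume a: "a \<in> A"
      have "p (x + y) \<le> K * norm ((x - a) + (y - b)) + Re (\<phi> (a + b))"
        using le[OF A_add[OF a b], of "x + y"] by (simp add: algebra_simps)
      also have "K * norm ((x - a) + (y - b)) \<le> K * (norm (x - a) + norm (y - b))"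
        using K by (intro mult_left_mono norm_triangle_ineq)
      finally show "p (x + y) - (K * norm (y - b) + Re (\<phi> b)) \<le> K * norm (x - a) + Re (\<phi> a)"
        using a b by (simp add: \<phi>_add distrib_left)
    qed
    then have "p (x + y) - p x \<le> p y"
      by (intro ge) (simp add: algebra_simps)
    then show "p (x + y) \<le> p x + p y"
      by simp
  next
    fix x and t :: real assume t: "t > 0"
    have "p (t *\<^sub>R x) / t \<le> p x"
    proof (rule ge)
      fix a assume a: "a \<in> A"
      have "p (t *\<^sub>R x) \<le> K * norm (t *\<^sub>R (x - a)) + Re (\<phi> (t *\<^sub>R a))"
        using le[OF A_scaleR[OF a, of t], of "t *\<^sub>R x"] by (simp add: scaleR_diff_right)
      also have "\<dots> = t * (K * norm (x - a) + Re (\<phi> a))"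
        using t a by (simp add: \<phi>_scaleR distrib_left)
      finally have "p (t *\<^sub>R x) \<le> t * (K * norm (x - a) + Re (\<phi> a))" .
      then show "p (t *\<^sub>R x) / t \<le> K * norm (x - a) + Re (\<phi> a)"
        using t by (simp add: field_simps)
    qed
    then show "p (t *\<^sub>R x) \<le> t * p x"
      using t by (simp add: field_simps)
  qed
  then obtain g where g: "linear g" "\<And>x. g x \<le> p x"
    using hahn_banach_touching by metis
  have g_minus: "g (- x) = - g x" for x
    using g(1) by (simp add: linear_neg)
  have g_norm: "g x \<le> K * norm x" for x
    using g(2)[of x] le[OF A0, of x] by (simp add: \<phi>0)
  have g_A: "g a = Re (\<phi> a)" if a: "a \<in> A" for a
  proof -
    have "g a \<le> Re (\<phi> a)" if "a \<in> A" for a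
      using g(2)[of a] le[OF that, of a] by simp
    from this[OF a] this[OF A_scaleR[OF a, of "-1"]] show ?thesis
      using \<phi>_scaleR[OF a, of "-1"] by (simp add: g_minus)
  qed
  obtain \<psi> where "clinear_on UNIV \<psi>" "\<And>x. cmod (\<psi> x) \<le> K * norm x"
    and Re_Im: "\<And>x. Re (\<psi> x) = g x" "\<And>x. Im (\<psi> x) = - g (\<i> *\<^sub>C x)"
    using complexification[OF g(1) g_norm K] by metis
  moreover have "\<psi> x = \<phi> x" if "x \<in> A" for x
    using that A_scaleC[OF that] by (simp add: Re_Im g_A \<phi>_scaleC complex_eq_iff)
  ultimately show thesis
    using that by blast
qed

section \<open>Positive functionals and states\<close>

locale star_subalgebra =
  fixes B :: "'a::cstar_algebra set"
  assumes sub_csubspace: "csubspace B" and sub_mult: "x \<in> B \<Longrightarrow> y \<in> B \<Longrightarrow> x * y \<in> B"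
    and sub_adj: "x \<in> B \<Longrightarrow> adj x \<in> B" and sub_one: "1 \<in> B"

lemma star_subalgebra_UNIV: "star_subalgebra UNIV"
  by standard (auto simp: cvs.subspace_def)

sublocale abelian_cstar \<subseteq> star_subalgebra B
  by standard (auto simp: csubspace_B)

locale positive_functional = star_subalgebra B
  for B :: "'a::cstar_algebra set" +
  fixes f :: "'a \<Rightarrow> complex"
  assumes linear: "clinear_on B f" and positive: "x \<in> B \<Longrightarrow> 0 \<le> f (adj x * x)"
begin

lemma mem_add: "x \<in> B \<Longrightarrow> y \<in> B \<Longrightarrow> x + y \<in> B" and mem_scaleC: "x \<in> B \<Longrightarrow> c *\<^sub>C x \<in> B"
  and mem_diff: "x \<in> B \<Longrightarrow> y \<in> B \<Longrightarrow> x - y \<in> B"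
  using sub_csubspace by (auto simp: cvs.subspace_add cvs.subspace_scale cvs.subspace_diff)

lemma f_add: "x \<in> B \<Longrightarrow> y \<in> B \<Longrightarrow> f (x + y) = f x + f y"
  and f_scaleC: "x \<in> B \<Longrightarrow> f (c *\<^sub>C x) = c * f x"
  using linear by (simp_all add: clinear_on_def scaleC_complex_def)

lemma f_diff: "x \<in> B \<Longrightarrow> y \<in> B \<Longrightarrow> f (x - y) = f x - f y"
  using f_add[of x "(-1) *\<^sub>C y"] f_scaleC[of y "-1"] mem_scaleC[of y "-1"] by simp

lemma f_square: "x \<in> B \<Longrightarrow> f (adj x * x) = of_real (Re (f (adj x * x)))"
  "x \<in> B \<Longrightarrow> 0 \<le> Re (f (adj x * x))"
  using positive[of x] by (simp_all add: less_eq_complex_def complex_eq_iff)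

lemma f_swap:
  assumes "x \<in> B" "y \<in> B"
  shows "f (adj y * x) = cnj (f (adj x * y))"
proof -
  have real: "Im (f (adj z * z)) = 0" if "z \<in> B" for z
    using positive[OF that] by (simp add: less_eq_complex_def)
  have m: "adj u * v \<in> B" if "u \<in> B" "v \<in> B" for u v
    using that sub_adj sub_mult by blast
  have "Im (f (adj x * y)) + Im (f (adj y * x)) = 0"
  proof -
    have "adj (x + y) * (x + y) = (adj x * x + adj y * y) + (adj x * y + adj y * x)"
      by (simp add: adj_add algebra_simps)
    then have "f (adj (x + y) * (x + y)) = (f (adj x * x) + f (adj y * y)) + (f (adj x * y) + f (adj y * x))"
      using assms m by (simp add: f_add mem_add)
    then have "Im (f (adj (x + y) * (x + y))) = (Im (f (adj x * x)) + Im (f (adj y * y))) + (Im (f (adj x * y)) + Im (f (adj y * x)))"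
      by simp
    then show ?thesis
      using assms real mem_add by simp
  qed
  moreover have "Re (f (adj x * y)) - Re (f (adj y * x)) = 0"
  proof -
    have "adj (x + \<i> *\<^sub>C y) * (x + \<i> *\<^sub>C y) = (adj x * x + adj y * y) + (\<i> *\<^sub>C (adj x * y) + (- \<i>) *\<^sub>C (adj y * x))"
      by (simp add: adj_add adj_scaleC algebra_simps mult_scaleC_left mult_scaleC_right)
    then have "f (adj (x + \<i> *\<^sub>C y) * (x + \<i> *\<^sub>C y))
        = (f (adj x * x) + f (adj y * y)) + (\<i> * f (adj x * y) + (- \<i>) * f (adj y * x))"
      using assms m by (simp only: f_add mem_add f_scaleC mem_scaleC)
    then have "Im (f (adj (x + \<i> *\<^sub>C y) * (x + \<i> *\<^sub>C y)))
        = (Im (f (adj x * x)) + Im (f (adj y * y))) + (Re (f (adj x * y)) - Re (f (adj y * x)))"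
      by simp
    then show ?thesis
      using assms real mem_add mem_scaleC by simp
  qed
  ultimately show ?thesis
    by (simp add: complex_eq_iff)
qed

lemma cauchy_schwarz:
  assumes x: "x \<in> B" and y: "y \<in> B"
  shows "(cmod (f (adj y * x)))\<^sup>2 \<le> Re (f (adj x * x)) * Re (f (adj y * y))"
proof -
  define z where "z = f (adj y * x)"
  define s where "s = Re (f (adj x * x))"
  define t where "t = Re (f (adj y * y))"
  have m: "adj u * v \<in> B" if "u \<in> B" "v \<in> B" for u v
    using that sub_adj sub_mult by blast
  have quad: "0 \<le> s - 2 * r * (cmod z)\<^sup>2 + r\<^sup>2 * (cmod z)\<^sup>2 * t" for r :: real
  proof -
    define c where "c = of_real r * z"
    define n where "n = (cmod z)\<^sup>2"
    have n: "complex_of_real n = z * cnj z"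
      unfolding n_def by (rule complex_norm_square)
    have "adj (x - c *\<^sub>C y) * (x - c *\<^sub>C y)
        = (adj x * x - c *\<^sub>C (adj x * y)) - (cnj c *\<^sub>C (adj y * x) - (c * cnj c) *\<^sub>C (adj y * y))"
      by (simp add: adj_diff adj_scaleC algebra_simps mult_scaleC_left mult_scaleC_right scaleC_scaleC
          cvs.scale_right_diff_distrib)
    then have "f (adj (x - c *\<^sub>C y) * (x - c *\<^sub>C y))
        = (f (adj x * x) - c * f (adj x * y)) - (cnj c * f (adj y * x) - (c * cnj c) * f (adj y * y))"
      using x y m by (simp only: f_diff mem_diff f_scaleC mem_scaleC)
    also have "\<dots> = of_real s - c * cnj z - cnj c * z + c * cnj c * of_real t"
      using f_square x y f_swap[OF y x] by (simp add: s_def t_def z_def)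
    also have "\<dots> = of_real (s - 2 * r * n + r\<^sup>2 * n * t)"
      by (simp add: c_def n algebra_simps power2_eq_square)
    finally show ?thesis
      using f_square(2)[of "x - c *\<^sub>C y"] x y mem_diff mem_scaleC by (simp add: n_def)
  qed
  have "(cmod z)\<^sup>2 \<le> s * t"
  proof (cases "t = 0")
    case True
    have "s - 2 * ((s + 1) / (cmod z)\<^sup>2) * (cmod z)\<^sup>2 < 0" if "z \<noteq> 0"
      using that f_square(2)[OF x] by (simp add: s_def)
    then show ?thesis
      using quad[of "(s + 1) / (cmod z)\<^sup>2"] True by fastforce
  next
    case False
    then have "t > 0"
      using f_square(2)[OF y] by (simp add: t_def)
    then show ?thesis
      using quad[of "1 / t"] by (simp add: field_simps power2_eq_square)
  qed
  then show ?thesis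
    by (simp add: z_def s_def t_def)
qed

end

lemma functional_norm_le:
  assumes "0 \<in> A" "\<And>x. x \<in> A \<Longrightarrow> norm x \<le> 1 \<Longrightarrow> cmod (\<phi> x) \<le> c"
  shows "functional_norm A \<phi> \<le> c"
  unfolding functional_norm_def using assms by (intro cSup_least) (auto intro!: exI[of _ 0])

lemma functional_norm_bound:
  assumes \<phi>: "\<phi> \<in> bounded_functionals A" and A: "csubspace A" and x: "x \<in> A"
  shows "cmod (\<phi> x) \<le> functional_norm A \<phi> * norm x"
proof -
  obtain K where K: "\<And>x. x \<in> A \<Longrightarrow> cmod (\<phi> x) \<le> K * norm x"
    using \<phi> by (auto simp: bounded_functionals_def bounded_on_def)
  have scale: "\<phi> (c *\<^sub>C x) = c * \<phi> x" if "x \<in> A" for c x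
    using \<phi> that by (simp add: bounded_functionals_def clinear_on_def scaleC_complex_def)
  have bdd: "bdd_above {cmod (\<phi> x) | x. x \<in> A \<and> norm x \<le> 1}"
  proof (rule bdd_aboveI)
    fix r assume "r \<in> {cmod (\<phi> x) | x. x \<in> A \<and> norm x \<le> 1}"
    then obtain y where y: "r = cmod (\<phi> y)" "y \<in> A" "norm y \<le> 1"
      by blast
    have "r \<le> \<bar>K\<bar> * norm y"
      using K[OF y(2)] y(1) by (metis abs_ge_self mult_right_mono norm_ge_zero order_trans)
    also have "\<dots> \<le> \<bar>K\<bar>"
      using y(3) by (simp add: mult_left_le)
    finally show "r \<le> \<bar>K\<bar>" .
  qed
  show ?thesis
  proof (cases "x = 0")
    case True
    then show ?thesis
      using K[OF x] by simp
  next
    case False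
    define u where "u = complex_of_real (1 / norm x) *\<^sub>C x"
    have u: "u \<in> A" "norm u = 1"
      using x False A by (auto simp: u_def norm_scaleC norm_divide cvs.subspace_scale)
    have "cmod (\<phi> u) \<le> functional_norm A \<phi>"
      unfolding functional_norm_def using u by (intro cSup_upper[OF _ bdd]) auto
    moreover have "cmod (\<phi> u) = cmod (\<phi> x) / norm x"
      unfolding u_def scale[OF x] by (simp add: norm_mult norm_divide)
    ultimately show ?thesis
      using False by (simp add: field_simps)
  qed
qed

lemma functional_norm_ge:
  assumes "\<phi> \<in> bounded_functionals A" "csubspace A" "x \<in> A" "norm x \<le> 1"
  shows "cmod (\<phi> x) \<le> functional_norm A \<phi>"
proof -
  have "0 \<le> functional_norm A \<phi>"
  proof (rule ccontr)
    assume neg: "\<not> 0 \<le> functional_norm A \<phi>"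
    have "cmod (\<phi> y) \<le> 0" if "y \<in> A" for y
    proof -
      have "functional_norm A \<phi> * norm y \<le> 0"
        using neg by (simp add: mult_nonpos_nonneg)
      then show ?thesis
        using functional_norm_bound[OF assms(1,2) that] by linarith
    qed
    then have "{cmod (\<phi> y) | y. y \<in> A \<and> norm y \<le> 1} = {0}"
      using assms(3,4) by (auto intro!: exI[of _ x])
    then show False
      using neg by (simp add: functional_norm_def)
  qed
  then show ?thesis
    using functional_norm_bound[OF assms(1-3)] assms(4)
    by (meson mult_left_le order_trans)
qed

lemma bounded_functionalsI:
  assumes "\<phi> \<in> extensional A" "clinear_on A \<phi>" "\<And>x. x \<in> A \<Longrightarrow> cmod (\<phi> x) \<le> K * norm x"
  shows "\<phi> \<in> bounded_functionals A"
  using assms by (auto simp: bounded_functionals_def bounded_on_def)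

context star_subalgebra
begin

lemma states_positive_functional:
  assumes "f \<in> states B"
  shows "positive_functional B f"
  using assms by unfold_locales (auto simp: states_def bounded_functionals_def)

lemma state_norm_le:
  assumes "f \<in> states B" "x \<in> B"
  shows "cmod (f x) \<le> norm x"
  using functional_norm_bound[of f B x] assms sub_csubspace by (simp add: states_def)

text \<open>
  By the Cauchy--Schwarz inequality \<open>|f(x)|\<^sup>2 \<le> f(1)\<close> on the unit ball, so a functional of norm one has
  \<open>f(1) \<ge> 1\<close>.
\<close>

lemma state_one:
  assumes f: "f \<in> states B"
  shows "f 1 = 1"
proof -
  interpret positive_functional B f
    by (rule states_positive_functional[OF f])
  define s where "s = Re (f 1)"
  have f1: "f 1 = of_real s" "s \<ge> 0"
    using f_square[OF sub_one] by (simp_all add: s_def)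
  have "s \<le> 1"
    using state_norm_le[OF f sub_one] abs_Re_le_cmod[of "f 1"] by (simp add: s_def)
  have "functional_norm B f \<le> sqrt s"
  proof (rule functional_norm_le)
    show "0 \<in> B"
      using sub_csubspace by (rule cvs.subspace_0)
    fix x assume x: "x \<in> B" "norm x \<le> 1"
    have "(cmod (f (adj 1 * x)))\<^sup>2 \<le> Re (f (adj x * x)) * Re (f (adj 1 * 1))"
      by (rule cauchy_schwarz[OF x(1) sub_one])
    also have "Re (f (adj x * x)) \<le> norm (adj x * x)"
      using state_norm_le[OF f, of "adj x * x"] abs_Re_le_cmod[of "f (adj x * x)"] x sub_adj sub_mult
      by (smt (verit))
    then have "Re (f (adj x * x)) * Re (f (adj 1 * 1)) \<le> 1 * s"
      using x(2) f1(2) by (intro mult_mono) (auto simp: s_def cstar_identity power_le_one intro: order_trans)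
    finally show "cmod (f x) \<le> sqrt s"
      by (intro real_le_rsqrt) simp
  qed
  then have "1 \<le> sqrt s"
    using f by (simp add: states_def)
  then have "s = 1"
    using \<open>s \<le> 1\<close> by simp
  then show ?thesis
    using f1 by simp
qed

lemma statesI:
  assumes "f \<in> extensional B" "clinear_on B f" "\<And>x. x \<in> B \<Longrightarrow> cmod (f x) \<le> norm x" "f 1 = 1"
    "\<And>x. x \<in> B \<Longrightarrow> 0 \<le> f (adj x * x)"
  shows "f \<in> states B"
proof -
  have bf: "f \<in> bounded_functionals B"
    using assms by (intro bounded_functionalsI[where K = 1]) auto
  moreover have "functional_norm B f = 1"
  proof (rule antisym)
    show "functional_norm B f \<le> 1"
      using assms(3) cvs.subspace_0[OF sub_csubspace] by (intro functional_norm_le) (auto intro: order_trans)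
    show "1 \<le> functional_norm B f"
      using functional_norm_ge[OF bf sub_csubspace sub_one] assms(4) by simp
  qed
  ultimately show ?thesis
    using assms(5) by (simp add: states_def)
qed

end

context abelian_cstar
begin

lemma char_square: "\<rho> \<in> characters B \<Longrightarrow> x \<in> B \<Longrightarrow> \<rho> (adj x * x) = of_real ((cmod (\<rho> x))\<^sup>2)"
  by (simp add: char_mult char_adj complex_norm_square mult.commute del: of_real_power)

lemma character_state:
  assumes \<rho>: "\<rho> \<in> characters B"
  shows "\<rho> \<in> states B"
proof (rule statesI)
  show "\<rho> \<in> extensional B" "clinear_on B \<rho>"
    using \<rho> by (simp_all add: characters_def)
  show "0 \<le> \<rho> (adj x * x)" if "x \<in> B" for x
    using that \<rho> by (simp add: char_square less_eq_complex_def)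
qed (use \<rho> char_norm_le char_one in auto)

text \<open>
  If \<open>\<rho> = t \<psi>\<^sub>1 + (1-t) \<psi>\<^sub>2\<close> and \<open>\<rho>(x) = 0\<close>, then both states vanish at \<open>x\<^sup>* x\<close>, hence at \<open>x\<close>; so both have
  the kernel of \<open>\<rho>\<close>.
\<close>

lemma character_pure:
  assumes \<rho>: "\<rho> \<in> characters B"
  shows "\<rho> \<in> pure_states B"
proof -
  have same: "\<psi> = \<rho>"
    if \<psi>: "\<psi> \<in> states B" and null: "\<And>x. x \<in> B \<Longrightarrow> \<rho> x = 0 \<Longrightarrow> Re (\<psi> (adj x * x)) = 0" for \<psi>
  proof (rule extensionalityI[of _ B])
    interpret positive_functional B \<psi>
      by (rule states_positive_functional[OF \<psi>])
    fix x assume x: "x \<in> B"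
    define y where "y = x - \<rho> x *\<^sub>C 1"
    have y: "y \<in> B" "\<rho> y = 0"
      using x \<rho> by (auto simp: y_def char_diff char_scaleC char_one)
    have "(cmod (\<psi> (adj 1 * y)))\<^sup>2 \<le> 0"
      using cauchy_schwarz[OF y(1) one_mem] null[OF y] by simp
    then have "\<psi> y = 0"
      by simp
    then show "\<psi> x = \<rho> x"
      using x state_one[OF \<psi>] by (simp add: y_def f_diff f_scaleC)
  qed (use \<psi> \<rho> in \<open>auto simp: states_def bounded_functionals_def characters_def\<close>)
  have "\<psi>1 = \<rho> \<and> \<psi>2 = \<rho>"
    if \<psi>: "\<psi>1 \<in> states B" "\<psi>2 \<in> states B" and t: "0 < t" "t < 1"
      and eq: "\<forall>x\<in>B. \<rho> x = of_real t * \<psi>1 x + of_real (1 - t) * \<psi>2 x" for \<psi>1 \<psi>2 and t :: real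
  proof -
    have null: "Re (\<psi>1 (adj x * x)) = 0 \<and> Re (\<psi>2 (adj x * x)) = 0" if x: "x \<in> B" "\<rho> x = 0" for x
    proof -
      have pos: "0 \<le> Re (\<psi>1 (adj x * x))" "0 \<le> Re (\<psi>2 (adj x * x))"
        using \<psi> x by (auto simp: states_def less_eq_complex_def)
      have "\<rho> (adj x * x) = 0"
        using char_square[OF \<rho> x(1)] x(2) by simp
      then have "Re (of_real t * \<psi>1 (adj x * x) + of_real (1 - t) * \<psi>2 (adj x * x)) = 0"
        using eq x by (metis adj_mem mult_mem zero_complex.sel(1))
      then have "t * Re (\<psi>1 (adj x * x)) + (1 - t) * Re (\<psi>2 (adj x * x)) = 0"
        by simp
      moreover have "0 \<le> t * Re (\<psi>1 (adj x * x))" "0 \<le> (1 - t) * Re (\<psi>2 (adj x * x))"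
        using t pos by simp_all
      ultimately have "t * Re (\<psi>1 (adj x * x)) = 0" "(1 - t) * Re (\<psi>2 (adj x * x)) = 0"
        by linarith+
      then show ?thesis
        using t by simp
    qed
    then show ?thesis
      using same \<psi> by blast
  qed
  then show ?thesis
    using character_state[OF \<rho>] by (simp add: pure_states_def)
qed

end

section \<open>The conditional expectation of a regular inclusion\<close>

lemma (in abelian_cstar) sandwich:
  assumes "h \<in> B" "k \<in> B"
  shows "k * (h * z * h) * k = (h * k) * z * (h * k)" "h * (k * z * k) * h = (h * k) * z * (h * k)"
proof -
  have "(k * h) * z * (h * k) = (h * k) * z * (h * k)" "(h * k) * z * (k * h) = (h * k) * z * (h * k)"
    using commute[OF assms] by simp_all
  then show "k * (h * z * h) * k = (h * k) * z * (h * k)" "h * (k * z * k) * h = (h * k) * z * (h * k)"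
    by (simp_all add: mult.assoc)
qed

locale regular =
  fixes D :: "'a::cstar_algebra set"
  assumes regular: "regular_inclusion D"

sublocale regular \<subseteq> abelian_cstar D
  using regular by unfold_locales
    (simp_all add: regular_inclusion_def maximal_abelian_cstar_subalgebra_def)

context regular
begin

text \<open>
  This is the state \<open>\<rho> \<circ> E\<close>; as the conditional expectation \<open>E\<close> is constructed from these states, they are
  obtained directly from the extension property.
\<close>

definition ext_state :: "('a \<Rightarrow> complex) \<Rightarrow> 'a \<Rightarrow> complex" where
  "ext_state \<rho> = (THE f. f \<in> states UNIV \<and> restrict f D = \<rho>)"

lemma ext_state_unique_ex:
  assumes "\<rho> \<in> characters D"
  shows "\<exists>!f. f \<in> states UNIV \<and> restrict f D = \<rho>"
  using regular character_pure[OF assms] by (simp add: regular_inclusion_def extension_property_def)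

lemma ext_state:
  assumes "\<rho> \<in> characters D"
  shows "ext_state \<rho> \<in> states UNIV" and "x \<in> D \<Longrightarrow> ext_state \<rho> x = \<rho> x"
proof -
  have *: "ext_state \<rho> \<in> states UNIV \<and> restrict (ext_state \<rho>) D = \<rho>"
    unfolding ext_state_def by (rule theI'[OF ext_state_unique_ex[OF assms]])
  then show "ext_state \<rho> \<in> states UNIV"
    by simp
  show "ext_state \<rho> x = \<rho> x" if "x \<in> D"
    using * that by (metis restrict_apply')
qed

lemma ext_state_eqI:
  assumes \<rho>: "\<rho> \<in> characters D" and f: "f \<in> states UNIV" "\<And>x. x \<in> D \<Longrightarrow> f x = \<rho> x"
  shows "f = ext_state \<rho>"
proof -
  have "restrict f D = \<rho>"
    using f(2) \<rho> by (intro extensionalityI[of _ D]) (auto simp: characters_def)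
  moreover have "restrict (ext_state \<rho>) D = \<rho>"
    using ext_state[OF \<rho>] \<rho> by (intro extensionalityI[of _ D]) (auto simp: characters_def)
  ultimately show ?thesis
    using ext_state_unique_ex[OF \<rho>] f(1) ext_state(1)[OF \<rho>] by blast
qed

context
  fixes \<rho> :: "'a \<Rightarrow> complex"
  assumes \<rho>: "\<rho> \<in> characters D"
begin

interpretation ext: positive_functional UNIV "ext_state \<rho>"
  by (rule star_subalgebra.states_positive_functional[OF star_subalgebra_UNIV ext_state(1)[OF \<rho>]])

lemma ext_add: "ext_state \<rho> (x + y) = ext_state \<rho> x + ext_state \<rho> y"
  and ext_diff: "ext_state \<rho> (x - y) = ext_state \<rho> x - ext_state \<rho> y"
  and ext_scaleC: "ext_state \<rho> (c *\<^sub>C x) = c * ext_state \<rho> x"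
  by (simp_all add: ext.f_add ext.f_diff ext.f_scaleC)

lemma ext_scaleR: "ext_state \<rho> (t *\<^sub>R x) = of_real t * ext_state \<rho> x"
  by (simp add: scaleR_eq_scaleC[where 'a = 'a] ext_scaleC)

lemma ext_zero: "ext_state \<rho> 0 = 0"
  using ext_scaleR[of 0 0] by simp

lemma ext_minus: "ext_state \<rho> (- x) = - ext_state \<rho> x"
  using ext_scaleR[of "-1" x] by simp

lemma ext_sum: "ext_state \<rho> (\<Sum>i\<in>I. f i) = (\<Sum>i\<in>I. ext_state \<rho> (f i))"
  by (induction I rule: infinite_finite_induct) (simp_all add: ext_zero ext_add)

lemma ext_norm_le: "cmod (ext_state \<rho> x) \<le> norm x"
  by (rule star_subalgebra.state_norm_le[OF star_subalgebra_UNIV ext_state(1)[OF \<rho>]]) simp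

lemma ext_positive: "0 \<le> ext_state \<rho> (adj x * x)"
  by (rule ext.positive) simp

lemma ext_cauchy_schwarz:
  "(cmod (ext_state \<rho> (adj y * x)))\<^sup>2 \<le> Re (ext_state \<rho> (adj x * x)) * Re (ext_state \<rho> (adj y * y))"
  by (rule ext.cauchy_schwarz) simp_all

lemma ext_adj: "ext_state \<rho> (adj x) = cnj (ext_state \<rho> x)"
  using ext.f_swap[of 1 x] by simp

text \<open>
  The Cauchy--Schwarz inequality makes \<open>D\<close> part of the multiplicative domain: the state vanishes at
  \<open>(d - \<rho>(d))\<^sup>* (d - \<rho>(d))\<close>.
\<close>

lemma ext_mult_right:
  assumes d: "d \<in> D"
  shows "ext_state \<rho> (x * d) = ext_state \<rho> x * \<rho> d"
proof -
  define e where "e = d - \<rho> d *\<^sub>C 1"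
  have e: "e \<in> D" "\<rho> e = 0"
    using d \<rho> by (auto simp: e_def char_diff char_scaleC char_one)
  then have "ext_state \<rho> (adj e * e) = 0"
    using ext_state(2)[OF \<rho>, of "adj e * e"] char_square[OF \<rho> e(1)] by simp
  then have "ext_state \<rho> (x * e) = 0"
    using ext_cauchy_schwarz[of "adj x" e] by (simp add: adj_adj)
  then show ?thesis
    by (simp add: e_def right_diff_distrib mult_scaleC_right ext_diff ext_scaleC)
qed

lemma ext_mult_left:
  assumes d: "d \<in> D"
  shows "ext_state \<rho> (d * x) = \<rho> d * ext_state \<rho> x"
proof -
  have "ext_state \<rho> (adj (d * x)) = ext_state \<rho> (adj x) * \<rho> (adj d)"
    unfolding adj_mult using d by (intro ext_mult_right) simp
  then show ?thesis
    using d \<rho> by (simp add: ext_adj char_adj) (metis complex_cnj_cnj complex_cnj_mult mult.commute)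
qed

end

subsection \<open>Local compression\<close>

text \<open>
  The infimum \<open>p(x)\<close> of the numbers \<open>t\<close> with \<open>h (t - Re x) h \<ge> 0\<close> for some \<open>h \<in> D\<close> that does not vanish
  at \<open>\<rho>\<close> is sublinear, and its restriction to hermitian elements of \<open>D\<close> is at most \<open>\<rho>\<close>. A linear functional
  below \<open>p\<close> is therefore the real part of a state that extends \<open>\<rho>\<close>; touching \<open>p\<close> at \<open>a\<close>, it shows that the unique
  extension takes the value \<open>p(a)\<close>.
\<close>

definition compression_bounds :: "('a \<Rightarrow> complex) \<Rightarrow> 'a \<Rightarrow> real set" where
  "compression_bounds \<rho> x =
     {t. \<exists>h\<in>D. adj h = h \<and> \<rho> h \<noteq> 0 \<and> pos (h * (of_real t - re_part x) * h)}"

definition compression_inf :: "('a \<Rightarrow> complex) \<Rightarrow> 'a \<Rightarrow> real" where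
  "compression_inf \<rho> x = Inf (compression_bounds \<rho> x)"

context
  fixes \<rho> :: "'a \<Rightarrow> complex"
  assumes \<rho>: "\<rho> \<in> characters D"
begin

lemma compression_boundsI:
  assumes "pos (of_real t - re_part x)"
  shows "t \<in> compression_bounds \<rho> x"
  using assms one_mem char_one[OF \<rho>] by (auto simp: compression_bounds_def intro!: bexI[of _ 1])

lemma compression_bounds_norm: "norm x \<in> compression_bounds \<rho> x"
  by (rule compression_boundsI) (simp add: pos_norm_minus norm_re_part)

lemma compression_bounds_below:
  assumes "t \<in> compression_bounds \<rho> x"
  shows "- norm x \<le> t"
proof -
  obtain h where h: "h \<in> D" "adj h = h" "\<rho> h \<noteq> 0" "pos (h * (of_real t - re_part x) * h)"
    using assms by (auto simp: compression_bounds_def)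
  have "pos (h * (of_real (norm x) + re_part x) * h)"
    using h by (intro pos_conj_herm) (simp_all add: pos_norm_minus norm_re_part)
  then have "pos (h * (of_real t - re_part x) * h + h * (of_real (norm x) + re_part x) * h)"
    using h by (intro pos_add)
  also have "h * (of_real t - re_part x) * h + h * (of_real (norm x) + re_part x) * h
      = (t + norm x) *\<^sub>R (h * h)"
    by (simp add: algebra_simps of_real_mult_eq_scaleR)
  finally have "0 \<le> Re (\<rho> ((t + norm x) *\<^sub>R (h * h)))"
    using h \<rho> by (intro char_pos) auto
  moreover obtain r where r: "\<rho> h = of_real r"
    using char_herm_real[OF \<rho> h(1,2)] by blast
  ultimately have "0 \<le> (t + norm x) * (r * r)"
    using h \<rho> by (simp add: char_scaleR char_mult)
  moreover have "r * r > 0"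
    using h(3) r by (cases "r = 0") (auto simp: zero_less_mult_iff)
  ultimately show ?thesis
    by (simp add: zero_le_mult_iff)
qed

lemma compression_inf_le: "t \<in> compression_bounds \<rho> x \<Longrightarrow> compression_inf \<rho> x \<le> t"
  unfolding compression_inf_def using compression_bounds_below
  by (intro cInf_lower bdd_belowI) auto

lemma compression_inf_ge:
  "(\<And>t. t \<in> compression_bounds \<rho> x \<Longrightarrow> c \<le> t) \<Longrightarrow> c \<le> compression_inf \<rho> x"
  unfolding compression_inf_def using compression_bounds_norm by (intro cInf_greatest) auto

lemma compression_bounds_add:
  assumes "s \<in> compression_bounds \<rho> x" "t \<in> compression_bounds \<rho> y"
  shows "s + t \<in> compression_bounds \<rho> (x + y)"
proof -
  obtain h where h: "h \<in> D" "adj h = h" "\<rho> h \<noteq> 0" "pos (h * (of_real s - re_part x) * h)"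
    using assms by (auto simp: compression_bounds_def)
  obtain k where k: "k \<in> D" "adj k = k" "\<rho> k \<noteq> 0" "pos (k * (of_real t - re_part y) * k)"
    using assms by (auto simp: compression_bounds_def)
  have "pos (k * (h * (of_real s - re_part x) * h) * k + h * (k * (of_real t - re_part y) * k) * h)"
    by (rule pos_add[OF pos_conj_herm[OF h(4) k(2)] pos_conj_herm[OF k(4) h(2)]])
  also have "k * (h * (of_real s - re_part x) * h) * k + h * (k * (of_real t - re_part y) * k) * h
      = (h * k) * (of_real s - re_part x) * (h * k) + (h * k) * (of_real t - re_part y) * (h * k)"
    by (simp only: sandwich[OF h(1) k(1)])
  also have "\<dots> = (h * k) * (of_real (s + t) - re_part (x + y)) * (h * k)"
    by (simp add: re_part_add algebra_simps)
  finally show ?thesis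
    using h k \<rho> unfolding compression_bounds_def
    by (intro CollectI bexI[of _ "h * k"]) (auto simp: adj_mult_herm char_mult)
qed

lemma compression_bounds_scaleR:
  assumes "t \<in> compression_bounds \<rho> x" "c > 0"
  shows "c * t \<in> compression_bounds \<rho> (c *\<^sub>R x)"
proof -
  obtain h where h: "h \<in> D" "adj h = h" "\<rho> h \<noteq> 0" "pos (h * (of_real t - re_part x) * h)"
    using assms by (auto simp: compression_bounds_def)
  have "pos (c *\<^sub>R (h * (of_real t - re_part x) * h))"
    using h assms by (intro pos_scaleR) auto
  also have "c *\<^sub>R (h * (of_real t - re_part x) * h) = h * (of_real (c * t) - re_part (c *\<^sub>R x)) * h"
    by (simp add: re_part_scaleR of_real_def algebra_simps)
  finally show ?thesis
    using h by (auto simp: compression_bounds_def)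
qed

lemma compression_inf_sublinear: "sublinear (compression_inf \<rho>)"
  unfolding sublinear_def
proof (intro conjI allI impI)
  fix x y
  have "compression_inf \<rho> (x + y) - t \<le> compression_inf \<rho> x" if t: "t \<in> compression_bounds \<rho> y" for t
    using compression_inf_le[OF compression_bounds_add[OF _ t]] by (intro compression_inf_ge) (simp add: algebra_simps)
  then have "compression_inf \<rho> (x + y) - compression_inf \<rho> x \<le> compression_inf \<rho> y"
    by (intro compression_inf_ge) (simp add: algebra_simps)
  then show "compression_inf \<rho> (x + y) \<le> compression_inf \<rho> x + compression_inf \<rho> y"
    by simp
next
  fix x and c :: real assume c: "c > 0"
  have "compression_inf \<rho> (c *\<^sub>R x) / c \<le> compression_inf \<rho> x"
    using compression_inf_le[OF compression_bounds_scaleR[OF _ c]] c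
    by (intro compression_inf_ge) (simp add: field_simps)
  then show "compression_inf \<rho> (c *\<^sub>R x) \<le> c * compression_inf \<rho> x"
    using c by (simp add: field_simps)
qed

lemma compression_inf_D:
  assumes d: "d \<in> D" "adj d = d"
  shows "compression_inf \<rho> d \<le> Re (\<rho> d)"
proof (rule field_le_epsilon)
  fix \<epsilon> :: real assume "\<epsilon> > 0"
  define a where "a = of_real (Re (\<rho> d) + \<epsilon>) - d"
  have a: "a \<in> D" "adj a = a"
    using d by (simp_all add: a_def adj_diff del: of_real_add)
  obtain p m where pm: "p \<in> D" "m \<in> D" "pos p" "pos m" "a = p - m" "p * m = 0"
    using pos_neg_parts[OF a] by blast
  have "\<rho> a = of_real (Re (\<rho> d) + \<epsilon>) - \<rho> d"
    unfolding a_def using d \<rho> by (simp only: char_diff of_real_mem char_of_real)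
  also have "\<rho> d = of_real (Re (\<rho> d))"
    by (rule char_herm_real[OF \<rho> d])
  finally have "Re (\<rho> p) - Re (\<rho> m) = \<epsilon>"
    using pm \<rho> by (simp add: char_diff) (metis Re_complex_of_real minus_complex.sel(1) add_diff_cancel_left')
  then have "Re (\<rho> p) > 0"
    using char_pos[OF \<rho> pm(2,4)] \<open>\<epsilon> > 0\<close> by simp
  then have nz: "\<rho> p \<noteq> 0"
    by auto
  have "p * a * p = p * p * p"
    by (simp add: pm(5,6) right_diff_distrib)
  moreover have "pos (p * p * p)"
    using pm by (intro pos_mult) auto
  ultimately have "Re (\<rho> d) + \<epsilon> \<in> compression_bounds \<rho> d"
    using pm nz d unfolding compression_bounds_def a_def
    by (intro CollectI bexI[of _ p]) (auto simp: pos_herm)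
  then show "compression_inf \<rho> d \<le> Re (\<rho> d) + \<epsilon>"
    by (rule compression_inf_le)
qed

lemma compression_inf_ext_state: "adj a = a \<Longrightarrow> compression_inf \<rho> a = Re (ext_state \<rho> a)"
proof -
  assume "adj a = a"
  obtain g where g: "linear g" "\<And>x. g x \<le> compression_inf \<rho> x" "g a = compression_inf \<rho> a"
    using hahn_banach_touching[OF compression_inf_sublinear] by metis
  have g_norm: "g x \<le> 1 * norm x" for x
    using g(2)[of x] compression_inf_le[OF compression_bounds_norm[of x]] by simp
  obtain f where f: "clinear_on UNIV f" "\<And>x. cmod (f x) \<le> 1 * norm x" "\<And>x. Re (f x) = g x"
    and Im_f: "\<And>x. Im (f x) = - g (\<i> *\<^sub>C x)"
    using complexification[OF g(1) g_norm] by auto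
  have g_minus: "g (- x) = - g x" for x
    using g(1) by (simp add: linear_neg)
  have g_nonneg: "0 \<le> g x" if "pos (re_part x)" for x
  proof -
    have "0 \<in> compression_bounds \<rho> (- x)"
      using that by (intro compression_boundsI) (simp add: re_part_minus)
    then have "g (- x) \<le> 0"
      using g(2)[of "- x"] compression_inf_le[of 0 "- x"] by simp
    then show ?thesis
      by (simp add: g_minus)
  qed
  have Im_herm: "Im (f x) = 0" if "adj x = x" for x
  proof -
    have "re_part (\<i> *\<^sub>C x) = 0"
      using that by (simp add: re_part_def adj_scaleC)
    then have "0 \<le> g (\<i> *\<^sub>C x)" "0 \<le> g (- (\<i> *\<^sub>C x))"
      using g_nonneg[of "\<i> *\<^sub>C x"] g_nonneg[of "- (\<i> *\<^sub>C x)"] by (simp_all add: re_part_minus)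
    then show ?thesis
      by (simp add: Im_f g_minus)
  qed
  have f_herm: "f d = \<rho> d" if d: "d \<in> D" "adj d = d" for d
  proof -
    have "g d \<le> Re (\<rho> d)" "g (- d) \<le> Re (\<rho> (- d))"
      using g(2)[of d] g(2)[of "- d"] compression_inf_D[of d] compression_inf_D[of "- d"] d
      by fastforce+
    then have "Re (f d) = Re (\<rho> d)"
      using d \<rho> by (simp add: g_minus char_minus f(3))
    then show ?thesis
      using Im_herm[OF d(2)] char_herm_real[OF \<rho> d] by (simp add: complex_eq_iff)
  qed
  have f_D: "f d = \<rho> d" if d: "d \<in> D" for d
  proof -
    have "f (re_part d + \<i> *\<^sub>C im_part d) = f (re_part d) + \<i> * f (im_part d)"
      using f(1) by (simp add: clinear_on_def scaleC_complex_def)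
    also have "\<dots> = \<rho> (re_part d) + \<i> * \<rho> (im_part d)"
      using d by (simp add: f_herm)
    also have "\<dots> = \<rho> (re_part d + \<i> *\<^sub>C im_part d)"
      using d \<rho> by (simp add: char_add char_scaleC)
    finally show ?thesis
      by (simp flip: re_im_decomp)
  qed
  have "f \<in> states UNIV"
  proof (rule star_subalgebra.statesI[OF star_subalgebra_UNIV])
    show "f 1 = 1"
      using f_D[of 1] \<rho> by (simp add: char_one)
    show "0 \<le> f (adj x * x)" for x
    proof -
      have herm: "adj (adj x * x) = adj x * x"
        by (simp add: adj_mult adj_adj)
      then have "0 \<le> Re (f (adj x * x))"
        using g_nonneg[of "adj x * x"] pos_adj_mult[of x] by (simp add: f(3))
      then show ?thesis
        using Im_herm[OF herm] by (simp add: less_eq_complex_def)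
    qed
  qed (use f in auto)
  then have "f = ext_state \<rho>"
    using f_D by (intro ext_state_eqI[OF \<rho>])
  then show ?thesis
    using g(3) f(3)[of a] by simp
qed

lemma local_upper_bound:
  assumes "adj a = a" "\<epsilon> > 0"
  obtains h where "h \<in> D" "adj h = h" "\<rho> h \<noteq> 0"
    "pos (h * (of_real (Re (ext_state \<rho> a) + \<epsilon>) - a) * h)"
proof -
  have "compression_inf \<rho> a < Re (ext_state \<rho> a) + \<epsilon>"
    using assms compression_inf_ext_state by simp
  then obtain t where t: "t \<in> compression_bounds \<rho> a" "t < Re (ext_state \<rho> a) + \<epsilon>"
    using cInf_lessD[of "compression_bounds \<rho> a"] compression_bounds_norm unfolding compression_inf_def
    by blast
  then have "t + (Re (ext_state \<rho> a) + \<epsilon> - t) \<in> compression_bounds \<rho> (a + 0)"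
    by (intro compression_bounds_add[OF t(1) compression_boundsI])
      (use t in \<open>simp add: re_part_def del: of_real_add of_real_diff\<close>)
  then show thesis
    using that assms by (auto simp: compression_bounds_def)
qed

text \<open>
  Four one-sided bounds, for the real and imaginary parts of \<open>y\<close> and their negatives, hold after compressing
  with the product of the four elements that witness them one by one.
\<close>

lemma local_compression:
  assumes "\<epsilon> > 0"
  obtains h where "h \<in> D" "adj h = h" "\<rho> h \<noteq> 0"
    "pos (h * (of_real \<epsilon> - (re_part y - of_real (Re (ext_state \<rho> (re_part y))))) * h)"
    "pos (h * (of_real \<epsilon> + (re_part y - of_real (Re (ext_state \<rho> (re_part y))))) * h)"
    "pos (h * (of_real \<epsilon> - (im_part y - of_real (Re (ext_state \<rho> (im_part y))))) * h)"
    "pos (h * (of_real \<epsilon> + (im_part y - of_real (Re (ext_state \<rho> (im_part y))))) * h)"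
proof -
  have pair: "\<exists>h\<in>D. adj h = h \<and> \<rho> h \<noteq> 0
      \<and> pos (h * (of_real \<epsilon> - (a - of_real (Re (ext_state \<rho> a)))) * h)
      \<and> pos (h * (of_real \<epsilon> + (a - of_real (Re (ext_state \<rho> a)))) * h)" if a: "adj a = a" for a
  proof -
    obtain h where h: "h \<in> D" "adj h = h" "\<rho> h \<noteq> 0"
      "pos (h * (of_real (Re (ext_state \<rho> a) + \<epsilon>) - a) * h)"
      using local_upper_bound[OF a assms] .
    obtain k where k: "k \<in> D" "adj k = k" "\<rho> k \<noteq> 0"
      "pos (k * (of_real (Re (ext_state \<rho> (- a)) + \<epsilon>) - (- a)) * k)"
      using local_upper_bound[of "- a", OF _ assms] a by auto
    note hk = sandwich[OF h(1) k(1)]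
    have eq: "of_real (Re (ext_state \<rho> a) + \<epsilon>) - a = of_real \<epsilon> - (a - of_real (Re (ext_state \<rho> a)))"
      "of_real (Re (ext_state \<rho> (- a)) + \<epsilon>) - (- a) = of_real \<epsilon> + (a - of_real (Re (ext_state \<rho> a)))"
      by (simp_all add: ext_minus[OF \<rho>])
    have "pos (k * (h * (of_real (Re (ext_state \<rho> a) + \<epsilon>) - a) * h) * k)"
      "pos (h * (k * (of_real (Re (ext_state \<rho> (- a)) + \<epsilon>) - (- a)) * k) * h)"
      using h k by (auto intro: pos_conj_herm)
    then show ?thesis
      unfolding hk eq using h k \<rho> by (intro bexI[of _ "h * k"]) (auto simp: adj_mult_herm char_mult)
  qed
  obtain h where h: "h \<in> D" "adj h = h" "\<rho> h \<noteq> 0"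
    "pos (h * (of_real \<epsilon> - (re_part y - of_real (Re (ext_state \<rho> (re_part y))))) * h)"
    "pos (h * (of_real \<epsilon> + (re_part y - of_real (Re (ext_state \<rho> (re_part y))))) * h)"
    using pair[OF adj_re_part] by blast
  obtain k where k: "k \<in> D" "adj k = k" "\<rho> k \<noteq> 0"
    "pos (k * (of_real \<epsilon> - (im_part y - of_real (Re (ext_state \<rho> (im_part y))))) * k)"
    "pos (k * (of_real \<epsilon> + (im_part y - of_real (Re (ext_state \<rho> (im_part y))))) * k)"
    using pair[OF adj_im_part] by blast
  note hk = sandwich[OF h(1) k(1), symmetric]
  show thesis
  proof (rule that[of "h * k"])
    show "pos ((h * k) * (of_real \<epsilon> - (re_part y - of_real (Re (ext_state \<rho> (re_part y))))) * (h * k))"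
      "pos ((h * k) * (of_real \<epsilon> + (re_part y - of_real (Re (ext_state \<rho> (re_part y))))) * (h * k))"
      unfolding hk(1) by (rule pos_conj_herm[OF h(4) k(2)] pos_conj_herm[OF h(5) k(2)])+
    show "pos ((h * k) * (of_real \<epsilon> - (im_part y - of_real (Re (ext_state \<rho> (im_part y))))) * (h * k))"
      "pos ((h * k) * (of_real \<epsilon> + (im_part y - of_real (Re (ext_state \<rho> (im_part y))))) * (h * k))"
      unfolding hk(2) by (rule pos_conj_herm[OF k(4) h(2)] pos_conj_herm[OF k(5) h(2)])+
  qed (use h k \<rho> in \<open>auto simp: adj_mult_herm char_mult\<close>)
qed

end

subsection \<open>Averaging\<close>

text \<open>
  The elements \<open>h\<close> that compress \<open>y\<close> near some character to within \<open>\<epsilon>\<close> of a scalar have no common zero,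
  so finitely many of them have an invertible sum of squares; normalizing this sum to 1 gives a
  partition of unity that compresses \<open>y\<close> globally.
\<close>

lemma averaging_approx:
  assumes \<epsilon>: "\<epsilon> > 0"
  obtains I :: "'a set" and g :: "'a \<Rightarrow> 'a" and e
  where "finite I" "\<And>i. i \<in> I \<Longrightarrow> g i \<in> D" "\<And>i. i \<in> I \<Longrightarrow> adj (g i) = g i" "(\<Sum>i\<in>I. g i * g i) = 1"
    "e \<in> D" "norm ((\<Sum>i\<in>I. g i * y * g i) - e) \<le> \<epsilon>"
proof -
  define Q where "Q h c z \<longleftrightarrow> pos (h * (of_real (\<epsilon>/2) - (z - of_real c)) * h)
    \<and> pos (h * (of_real (\<epsilon>/2) + (z - of_real c)) * h)" for h z :: 'a and c
  define H where "H = {h \<in> D. adj h = h \<and> (\<exists>c. Q h c (re_part y)) \<and> (\<exists>c. Q h c (im_part y))}"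
  have "\<exists>h\<in>H. \<rho> h \<noteq> 0" if "\<rho> \<in> characters D" for \<rho>
    using local_compression[OF that, of "\<epsilon>/2" y] \<epsilon> unfolding H_def Q_def by (smt (verit) half_gt_zero mem_Collect_eq)
  then obtain F \<delta> where F: "finite F" "F \<subseteq> H" "\<delta> > 0" "pos ((\<Sum>h\<in>F. h * h) - of_real \<delta>)"
    using finite_square_sum_bounded_below[of H] unfolding H_def by blast
  have FD: "h \<in> D" "adj h = h" if "h \<in> F" for h
    using F that by (auto simp: H_def)
  define S where "S = (\<Sum>h\<in>F. h * h)"
  have "S \<in> D"
    unfolding S_def using FD by (intro sum_mem) auto
  then have "S - of_real \<delta> \<in> D"
    by simp
  then obtain x where x: "x \<in> D" "pos x" "x * S = 1"
    using strictly_pos_inverse[of "S - of_real \<delta>" \<delta>] F(3,4) by (auto simp: S_def)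
  obtain s where s: "s \<in> D" "pos s" "s * s = x"
    using pos_sqrt[OF x(1,2)] .
  have s_herm: "adj s = s"
    by (rule pos_herm[OF s(2)])
  define g where "g h = h * s" for h
  have g: "g h \<in> D" "adj (g h) = g h" if "h \<in> F" for h
    using FD[OF that] s s_herm by (auto simp: g_def adj_mult_herm)
  have g_sum: "(\<Sum>h\<in>F. g h * g h) = 1"
  proof -
    have "g h * g h = x * (h * h)" if "h \<in> F" for h
    proof -
      have "g h * g h = (s * h) * (h * s)"
        using commute[OF FD(1)[OF that] s(1)] by (simp add: g_def)
      also have "\<dots> = s * ((h * h) * s)"
        by (simp add: mult.assoc)
      also have "(h * h) * s = s * (h * h)"
        using FD[OF that] s by (intro commute) auto
      finally show ?thesis
        by (simp add: s(3)[symmetric] mult.assoc)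
    qed
    then have "(\<Sum>h\<in>F. g h * g h) = x * S"
      by (simp add: S_def sum_distrib_left)
    then show ?thesis
      using x by simp
  qed
  have conj: "pos (g h * z * g h)" if "h \<in> F" "pos (h * z * h)" for h z
  proof -
    have "g h * z * g h = s * (h * z * h) * s"
      using commute[OF FD(1)[OF that(1)] s(1)] by (simp add: g_def mult.assoc)
    then show ?thesis
      using pos_conj_herm[OF that(2) s_herm] by simp
  qed
  have approx: "norm ((\<Sum>h\<in>F. g h * z * g h) - (\<Sum>h\<in>F. c h *\<^sub>R (g h * g h))) \<le> \<epsilon>/2"
    if Q: "\<And>h. h \<in> F \<Longrightarrow> Q h (c h) z" for z and c :: "'a \<Rightarrow> real"
  proof (rule herm_norm_le)
    have one: "of_real (\<epsilon>/2) = (\<Sum>h\<in>F. (\<epsilon>/2) *\<^sub>R (g h * g h))"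
      using g_sum by (simp add: of_real_def flip: scaleR_sum_right)
    have "(\<Sum>h\<in>F. g h * (of_real (\<epsilon>/2) - (z - of_real (c h))) * g h)
        = (\<Sum>h\<in>F. (\<epsilon>/2) *\<^sub>R (g h * g h) - (g h * z * g h - c h *\<^sub>R (g h * g h)))"
      by (intro sum.cong refl) (simp add: of_real_def algebra_simps)
    also have "\<dots> = of_real (\<epsilon>/2) - ((\<Sum>h\<in>F. g h * z * g h) - (\<Sum>h\<in>F. c h *\<^sub>R (g h * g h)))"
      by (simp only: one sum_subtractf)
    finally have "of_real (\<epsilon>/2) - ((\<Sum>h\<in>F. g h * z * g h) - (\<Sum>h\<in>F. c h *\<^sub>R (g h * g h)))
        = (\<Sum>h\<in>F. g h * (of_real (\<epsilon>/2) - (z - of_real (c h))) * g h)"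
      by (rule sym)
    then show "pos (of_real (\<epsilon>/2) - ((\<Sum>h\<in>F. g h * z * g h) - (\<Sum>h\<in>F. c h *\<^sub>R (g h * g h))))"
      using Q conj by (simp only: Q_def) (intro pos_sum; simp)
    have "(\<Sum>h\<in>F. g h * (of_real (\<epsilon>/2) + (z - of_real (c h))) * g h)
        = (\<Sum>h\<in>F. (\<epsilon>/2) *\<^sub>R (g h * g h) + (g h * z * g h - c h *\<^sub>R (g h * g h)))"
      by (intro sum.cong refl) (simp add: of_real_def algebra_simps)
    also have "\<dots> = of_real (\<epsilon>/2) + ((\<Sum>h\<in>F. g h * z * g h) - (\<Sum>h\<in>F. c h *\<^sub>R (g h * g h)))"
      by (simp only: one sum_subtractf sum.distrib)
    finally have "of_real (\<epsilon>/2) + ((\<Sum>h\<in>F. g h * z * g h) - (\<Sum>h\<in>F. c h *\<^sub>R (g h * g h)))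
        = (\<Sum>h\<in>F. g h * (of_real (\<epsilon>/2) + (z - of_real (c h))) * g h)"
      by (rule sym)
    then show "pos (of_real (\<epsilon>/2) + ((\<Sum>h\<in>F. g h * z * g h) - (\<Sum>h\<in>F. c h *\<^sub>R (g h * g h))))"
      using Q conj by (simp only: Q_def) (intro pos_sum; simp)
  qed (use \<epsilon> in simp)
  have "\<forall>h\<in>F. \<exists>c. Q h c (re_part y)"
    using F(2) by (auto simp: H_def)
  from bchoice[OF this] obtain c1 where c1: "\<And>h. h \<in> F \<Longrightarrow> Q h (c1 h) (re_part y)"
    by auto
  have "\<forall>h\<in>F. \<exists>c. Q h c (im_part y)"
    using F(2) by (auto simp: H_def)
  from bchoice[OF this] obtain c2 where c2: "\<And>h. h \<in> F \<Longrightarrow> Q h (c2 h) (im_part y)"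
    by auto
  define e1 where "e1 = (\<Sum>h\<in>F. c1 h *\<^sub>R (g h * g h))"
  define e2 where "e2 = (\<Sum>h\<in>F. c2 h *\<^sub>R (g h * g h))"
  have e: "e1 \<in> D" "e2 \<in> D"
    using g by (auto simp: e1_def e2_def intro!: sum_mem)
  have decomp: "(\<Sum>h\<in>F. g h * y * g h) - (e1 + \<i> *\<^sub>C e2)
      = ((\<Sum>h\<in>F. g h * re_part y * g h) - e1) + \<i> *\<^sub>C ((\<Sum>h\<in>F. g h * im_part y * g h) - e2)"
  proof -
    have "g h * y * g h = g h * re_part y * g h + \<i> *\<^sub>C (g h * im_part y * g h)" for h
    proof -
      have "g h * (re_part y + \<i> *\<^sub>C im_part y) * g h = g h * re_part y * g h + \<i> *\<^sub>C (g h * im_part y * g h)"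
        by (simp add: distrib_left distrib_right mult_scaleC_left mult_scaleC_right)
      then show ?thesis
        by (simp flip: re_im_decomp)
    qed
    then show ?thesis
      by (simp add: sum.distrib cvs.scale_sum_right cvs.scale_right_diff_distrib)
  qed
  have "norm ((\<Sum>h\<in>F. g h * y * g h) - (e1 + \<i> *\<^sub>C e2)) \<le> \<epsilon>/2 + \<epsilon>/2"
    unfolding decomp using approx[of c1, OF c1] approx[of c2, OF c2]
    by (intro order_trans[OF norm_triangle_ineq] add_mono) (simp_all add: e1_def e2_def norm_scaleC)
  then show thesis
    using that[OF F(1) g g_sum, of "e1 + \<i> *\<^sub>C e2"] e by simp
qed

lemma ext_state_average:
  assumes \<rho>: "\<rho> \<in> characters D" and g: "\<And>i. i \<in> I \<Longrightarrow> g i \<in> D" "(\<Sum>i\<in>I. g i * g i) = 1"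
  shows "ext_state \<rho> (\<Sum>i\<in>I. g i * y * g i) = ext_state \<rho> y"
proof -
  have "ext_state \<rho> (\<Sum>i\<in>I. g i * y * g i) = (\<Sum>i\<in>I. \<rho> (g i * g i) * ext_state \<rho> y)"
    using g(1) \<rho> by (simp add: ext_sum ext_mult_left ext_mult_right char_mult mult_ac)
  also have "\<dots> = \<rho> (\<Sum>i\<in>I. g i * g i) * ext_state \<rho> y"
    using g(1) \<rho> by (subst char_sum) (auto simp: sum_distrib_right)
  finally show ?thesis
    using g(2) \<rho> by (simp add: char_one)
qed

text \<open>
  The elements \<open>e\<close> that approximate an average of \<open>y\<close> within \<open>1/n\<close> satisfy \<open>|\<rho>(e) - ext_state \<rho> y| \<le> 1/n\<close> for all
  characters at once, hence they converge in norm.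
\<close>

lemma expectation_exists:
  obtains e where "e \<in> D" "\<And>\<rho>. \<rho> \<in> characters D \<Longrightarrow> \<rho> e = ext_state \<rho> y"
proof -
  have "\<exists>e\<in>D. \<forall>\<rho>\<in>characters D. cmod (ext_state \<rho> y - \<rho> e) \<le> inverse (real (Suc n))" for n
  proof -
    have "inverse (real (Suc n)) > 0"
      by simp
    then obtain I :: "'a set" and g e where "finite I"
      and g: "\<And>i. i \<in> I \<Longrightarrow> g i \<in> D" "\<And>i. i \<in> I \<Longrightarrow> adj (g i) = g i" "(\<Sum>i\<in>I. g i * g i) = 1"
      and e: "e \<in> D" "norm ((\<Sum>i\<in>I. g i * y * g i) - e) \<le> inverse (real (Suc n))"
      by (rule averaging_approx[where y = y]) blast
    have "cmod (ext_state \<rho> y - \<rho> e) \<le> inverse (real (Suc n))" if \<rho>: "\<rho> \<in> characters D" for \<rho>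
    proof -
      have "ext_state \<rho> y - \<rho> e = ext_state \<rho> ((\<Sum>i\<in>I. g i * y * g i) - e)"
        using ext_state_average[OF \<rho> g(1,3), of y] ext_state(2)[OF \<rho> e(1)] ext_diff[OF \<rho>] by simp
      then show ?thesis
        using ext_norm_le[OF \<rho>] e(2) by (metis order_trans)
    qed
    then show ?thesis
      using e(1) by blast
  qed
  then obtain e where e: "\<And>n. e n \<in> D"
    and dist: "\<And>n \<rho>. \<rho> \<in> characters D \<Longrightarrow> cmod (ext_state \<rho> y - \<rho> (e n)) \<le> inverse (real (Suc n))"
    by metis
  have diff: "norm (e m - e n) \<le> inverse (real (Suc m)) + inverse (real (Suc n))" for m n
  proof (rule norm_le_if_char_le)
    fix \<rho> assume \<rho>: "\<rho> \<in> characters D"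
    have "\<rho> (e m - e n) = (ext_state \<rho> y - \<rho> (e n)) - (ext_state \<rho> y - \<rho> (e m))"
      using e \<rho> by (simp add: char_diff)
    then show "cmod (\<rho> (e m - e n)) \<le> inverse (real (Suc m)) + inverse (real (Suc n))"
      using dist[OF \<rho>, of m] dist[OF \<rho>, of n] norm_triangle_ineq4
      by (smt (verit))
  qed (use e in auto)
  have "Cauchy e"
  proof (rule metric_CauchyI)
    fix r :: real assume "r > 0"
    then obtain N where N: "inverse (real (Suc N)) < r / 2"
      using reals_Archimedean[of "r / 2"] by auto
    have "dist (e m) (e n) < r" if "m \<ge> N" "n \<ge> N" for m n
    proof -
      have "inverse (real (Suc m)) \<le> inverse (real (Suc N))" "inverse (real (Suc n)) \<le> inverse (real (Suc N))"
        using that by (simp_all add: divide_simps)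
      then show ?thesis
        using diff[of m n] N unfolding dist_norm by linarith
    qed
    then show "\<exists>M. \<forall>m\<ge>M. \<forall>n\<ge>M. dist (e m) (e n) < r"
      by blast
  qed
  then obtain l where l: "e \<longlonglongrightarrow> l"
    using Cauchy_convergent convergent_def by blast
  have lD: "l \<in> D"
    using closed_sequentially[OF closed_B] e l by blast
  have "\<rho> l = ext_state \<rho> y" if \<rho>: "\<rho> \<in> characters D" for \<rho>
  proof -
    have "(\<lambda>n. \<rho> (e n) - \<rho> l) \<longlonglongrightarrow> 0"
    proof (rule Lim_null_comparison)
      show "(\<lambda>n. norm (e n - l)) \<longlonglongrightarrow> 0"
        using l by (simp add: LIM_zero tendsto_norm_zero)
      show "\<forall>\<^sub>F n in sequentially. norm (\<rho> (e n) - \<rho> l) \<le> norm (e n - l)"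
        using \<rho> e lD char_norm_le[OF \<rho>, of "e _ - l"] by (simp add: char_diff)
    qed
    moreover have "(\<lambda>n. ext_state \<rho> y - \<rho> (e n)) \<longlonglongrightarrow> 0"
      by (rule Lim_null_comparison[OF _ LIMSEQ_inverse_real_of_nat]) (use dist[OF \<rho>] in simp)
    ultimately have "(\<lambda>n. (ext_state \<rho> y - \<rho> (e n)) + (\<rho> (e n) - \<rho> l)) \<longlonglongrightarrow> 0 + 0"
      by (rule tendsto_add[rotated])
    then show ?thesis
      by (simp add: LIMSEQ_const_iff)
  qed
  then show thesis
    using that lD by blast
qed

definition expectation :: "'a \<Rightarrow> 'a" where
  "expectation y = (SOME e. e \<in> D \<and> (\<forall>\<rho>\<in>characters D. \<rho> e = ext_state \<rho> y))"

lemma expectation_mem [simp]: "expectation y \<in> D"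
  and char_expectation: "\<rho> \<in> characters D \<Longrightarrow> \<rho> (expectation y) = ext_state \<rho> y"
proof -
  have "\<exists>e. e \<in> D \<and> (\<forall>\<rho>\<in>characters D. \<rho> e = ext_state \<rho> y)"
    by (rule expectation_exists[of y]) blast
  note * = someI_ex[OF this, folded expectation_def]
  show "expectation y \<in> D" "\<rho> \<in> characters D \<Longrightarrow> \<rho> (expectation y) = ext_state \<rho> y"
    using * by simp_all
qed

lemma expectation_eqI:
  assumes "e \<in> D" "\<And>\<rho>. \<rho> \<in> characters D \<Longrightarrow> \<rho> e = ext_state \<rho> y"
  shows "expectation y = e"
  using assms by (intro eq_if_char_eq) (simp_all add: char_expectation)

lemma expectation_averaging:
  assumes "\<epsilon> > 0"
  obtains I :: "'a set" and g :: "'a \<Rightarrow> 'a"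
  where "finite I" "\<And>i. i \<in> I \<Longrightarrow> g i \<in> D" "\<And>i. i \<in> I \<Longrightarrow> adj (g i) = g i" "(\<Sum>i\<in>I. g i * g i) = 1"
    "norm ((\<Sum>i\<in>I. g i * y * g i) - expectation y) \<le> \<epsilon>"
proof -
  have "\<epsilon>/2 > 0"
    using assms by simp
  then obtain I :: "'a set" and g e where I: "finite I"
    and g: "\<And>i. i \<in> I \<Longrightarrow> g i \<in> D" "\<And>i. i \<in> I \<Longrightarrow> adj (g i) = g i" "(\<Sum>i\<in>I. g i * g i) = 1"
    and e: "e \<in> D" "norm ((\<Sum>i\<in>I. g i * y * g i) - e) \<le> \<epsilon>/2"
    by (rule averaging_approx[where y = y]) blast
  have "norm (e - expectation y) \<le> \<epsilon>/2"
  proof (rule norm_le_if_char_le)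
    fix \<rho> assume \<rho>: "\<rho> \<in> characters D"
    have "\<rho> (e - expectation y) = - ext_state \<rho> ((\<Sum>i\<in>I. g i * y * g i) - e)"
      using ext_state_average[OF \<rho> g(1,3), of y] ext_state(2)[OF \<rho> e(1)] ext_diff[OF \<rho>] e \<rho>
      by (simp add: char_diff char_expectation)
    then have "cmod (\<rho> (e - expectation y)) \<le> norm ((\<Sum>i\<in>I. g i * y * g i) - e)"
      using ext_norm_le[OF \<rho>] by simp
    then show "cmod (\<rho> (e - expectation y)) \<le> \<epsilon>/2"
      using e(2) by linarith
  qed (use e assms in auto)
  then have "norm ((\<Sum>i\<in>I. g i * y * g i) - expectation y) \<le> \<epsilon>"
    using e(2) norm_triangle_ineq[of "(\<Sum>i\<in>I. g i * y * g i) - e" "e - expectation y"] by simp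
  then show thesis
    using that I g by blast
qed

text \<open>
  A bounded functional that takes the same value, up to the factor \<open>\<tau>(g\<^sup>2)\<close>, at all compressions \<open>g y g\<close>
  takes this value at the averages of \<open>y\<close>, hence at \<open>E(y)\<close>.
\<close>

lemma functional_expectation:
  fixes G :: "'a \<Rightarrow> complex"
  assumes \<tau>: "\<tau> \<in> characters D" and linear: "clinear_on UNIV G" and bound: "\<And>z. cmod (G z) \<le> K * norm z"
    and compress: "\<And>g. g \<in> D \<Longrightarrow> G (g * y * g) = \<tau> (g * g) * c"
  shows "G (expectation y) = c"
proof -
  have add: "G (a + b) = G a + G b" and scale: "G (t *\<^sub>C a) = t * G a" for a b t
    using linear by (simp_all add: clinear_on_def scaleC_complex_def)
  have G_sum: "G (\<Sum>i\<in>I. f i) = (\<Sum>i\<in>I. G (f i))" for I :: "'a set" and f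
    using scale[of 0 0] by (induction I rule: infinite_finite_induct) (simp_all add: add)
  have diff: "G (a - b) = G a - G b" for a b
    using add[of a "- b"] scale[of "-1" b] by simp
  have "cmod (c - G (expectation y)) \<le> 0 + \<delta>" if \<delta>: "\<delta> > 0" for \<delta>
  proof -
    define \<epsilon> where "\<epsilon> = \<delta> / (\<bar>K\<bar> + 1)"
    have "\<epsilon> > 0"
      using \<delta> by (simp add: \<epsilon>_def add_nonneg_pos)
    then obtain I :: "'a set" and g where "finite I"
      and g: "\<And>i. i \<in> I \<Longrightarrow> g i \<in> D" "\<And>i. i \<in> I \<Longrightarrow> adj (g i) = g i" "(\<Sum>i\<in>I. g i * g i) = 1"
      and approx: "norm ((\<Sum>i\<in>I. g i * y * g i) - expectation y) \<le> \<epsilon>"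
      by (rule expectation_averaging[where y = y]) blast
    have "G (\<Sum>i\<in>I. g i * y * g i) = (\<Sum>i\<in>I. \<tau> (g i * g i)) * c"
      using compress g(1) by (simp add: G_sum sum_distrib_right)
    also have "(\<Sum>i\<in>I. \<tau> (g i * g i)) = \<tau> (\<Sum>i\<in>I. g i * g i)"
      using g(1) by (intro char_sum[OF \<tau>, symmetric]) simp
    finally have "c - G (expectation y) = G ((\<Sum>i\<in>I. g i * y * g i) - expectation y)"
      using g(3) by (simp add: char_one[OF \<tau>] diff)
    also have "cmod \<dots> \<le> \<bar>K\<bar> * \<epsilon>"
      using approx by (intro order_trans[OF bound] mult_mono) auto
    also have "\<dots> \<le> \<delta>"
      using \<delta> by (simp add: \<epsilon>_def divide_le_eq distrib_left mult.commute)
    finally show ?thesis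
      by simp
  qed
  then have "cmod (c - G (expectation y)) \<le> 0"
    by (rule field_le_epsilon)
  then show ?thesis
    by simp
qed

lemma expectation_conditional: "is_conditional_expectation D expectation"
  unfolding is_conditional_expectation_def
proof (intro conjI allI ballI)
  show "clinear_on UNIV expectation"
    unfolding clinear_on_def
    by (auto intro!: expectation_eqI simp: char_add char_scaleC char_expectation ext_add ext_scaleC)
  show "expectation x \<in> D" for x
    by simp
  show "expectation d = d" if "d \<in> D" for d
    using that by (intro expectation_eqI) (auto simp: ext_state(2))
  show "norm (expectation x) \<le> norm x" for x
    by (rule norm_le_if_char_le) (auto simp: char_expectation ext_norm_le)
  show "\<exists>d\<in>D. expectation (adj x * x) = adj d * d" for x
  proof -
    have "expectation (adj x * x) = adj (expectation (adj x * x))"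
      by (rule expectation_eqI) (auto simp: char_adj char_expectation adj_mult adj_adj simp flip: ext_adj)
    moreover have "0 \<le> Re (\<rho> (expectation (adj x * x)))" if "\<rho> \<in> characters D" for \<rho>
      using ext_positive[OF that, of x] that by (simp add: char_expectation less_eq_complex_def)
    ultimately have "pos (expectation (adj x * x))"
      by (intro pos_if_char_nonneg) simp_all
    then obtain s where "s \<in> D" "pos s" "s * s = expectation (adj x * x)"
      using pos_sqrt[OF expectation_mem] by blast
    then show ?thesis
      by (metis pos_herm)
  qed
  show "expectation (d * x) = d * expectation x" "expectation (x * d) = expectation x * d"
    if "d \<in> D" for x d
    using that
    by (auto intro!: expectation_eqI simp: char_mult char_expectation ext_mult_left ext_mult_right)
qed

text \<open>
  For any conditional expectation \<open>E\<close> the functional \<open>\<rho> \<circ> E\<close> is a state that extends \<open>\<rho>\<close>, and there is only one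
  such state.
\<close>

lemma conditional_expectation_unique:
  assumes E: "is_conditional_expectation D E"
  shows "E = expectation"
proof
  fix y
  have ED: "E x \<in> D" for x
    using E by (simp add: is_conditional_expectation_def)
  have "\<rho> (E y) = ext_state \<rho> y" if \<rho>: "\<rho> \<in> characters D" for \<rho>
  proof -
    have "(\<lambda>x. \<rho> (E x)) \<in> states UNIV"
    proof (rule star_subalgebra.statesI[OF star_subalgebra_UNIV])
      show "clinear_on UNIV (\<lambda>x. \<rho> (E x))"
        using E \<rho> ED
        by (simp add: is_conditional_expectation_def clinear_on_def char_add char_scaleC scaleC_complex_def)
      show "cmod (\<rho> (E x)) \<le> norm x" for x
        using E char_norm_le[OF \<rho> ED[of x]] by (metis is_conditional_expectation_def order_trans)
      show "\<rho> (E 1) = 1"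
        using E char_one[OF \<rho>] one_mem by (simp add: is_conditional_expectation_def)
      show "0 \<le> \<rho> (E (adj x * x))" for x
      proof -
        obtain d where "d \<in> D" "E (adj x * x) = adj d * d"
          using E unfolding is_conditional_expectation_def by blast
        then show ?thesis
          using char_square[OF \<rho>] by (simp add: less_eq_complex_def)
      qed
    qed simp
    moreover have "\<rho> (E d) = \<rho> d" if "d \<in> D" for d
      using E that by (simp add: is_conditional_expectation_def)
    ultimately have "(\<lambda>x. \<rho> (E x)) = ext_state \<rho>"
      by (intro ext_state_eqI[OF \<rho>])
    then show ?thesis
      by (rule fun_cong)
  qed
  then show "E y = expectation y"
    using ED expectation_eqI by metis
qed

lemma cond_exp_eq: "cond_exp D = expectation"
  unfolding cond_exp_def
  using expectation_conditional conditional_expectation_unique by (rule the_equality)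

lemma char_state_eq: "\<rho> \<in> characters D \<Longrightarrow> char_state D \<rho> = ext_state \<rho>"
  by (simp add: char_state_def cond_exp_eq char_expectation fun_eq_iff)

text \<open>
  A hermitian \<open>x\<close> that commutes with \<open>D\<close> generates together with \<open>D\<close> an abelian algebra, the bicommutant
  of \<open>D \<union> {x}\<close>, which cannot be larger than \<open>D\<close>.
\<close>

lemma commutant_subset:
  assumes comm: "\<And>d. d \<in> D \<Longrightarrow> x * d = d * x"
  shows "x \<in> D"
proof -
  have herm: "x \<in> D" if x: "adj x = x" "\<And>d. d \<in> D \<Longrightarrow> x * d = d * x" for x
  proof -
    have ab: "abelian_cstar (bicommutant (insert x D))"
      using x commute by (intro bicommutant_abelian) auto
    have "maximal_abelian_cstar_subalgebra D"
      using regular by (simp add: regular_inclusion_def)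
    moreover have "insert x D \<subseteq> bicommutant (insert x D)"
      by (rule bicommutant_superset)
    ultimately have "bicommutant (insert x D) = D"
      using abelian_cstar.abelian[OF ab] unfolding maximal_abelian_cstar_subalgebra_def by auto
    then show ?thesis
      using bicommutant_superset[of "insert x D"] by auto
  qed
  have comm_adj: "adj x * d = d * adj x" if "d \<in> D" for d
    using arg_cong[OF comm[of "adj d"], of adj] that by (simp add: adj_mult adj_adj)
  have "re_part x \<in> D"
    using comm comm_adj by (intro herm[OF adj_re_part]) (simp add: re_part_def distrib_left distrib_right)
  moreover have "im_part x \<in> D"
    using comm comm_adj
    by (intro herm[OF adj_im_part])
      (simp add: im_part_def re_part_def adj_scaleC algebra_simps mult_scaleC_left mult_scaleC_right)
  ultimately have "re_part x + \<i> *\<^sub>C im_part x \<in> D"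
    by simp
  then show ?thesis
    by (simp flip: re_im_decomp)
qed

end

section \<open>Eigenfunctionals\<close>

text \<open>
  The elements \<open>z = x h + y k\<close> and \<open>w = x k - y h\<close> are the entries of the row \<open>(x, y)\<close> multiplied by a unitary
  2-by-2 matrix, so \<open>z z\<^sup>* + w w\<^sup>* = x x\<^sup>* + y y\<^sup>*\<close>.
\<close>

lemma norm_row_column:
  fixes x y h k :: "'a::cstar_algebra"
  assumes h: "adj h = h" and k: "adj k = k" and comm: "h * k = k * h" and one: "h * h + k * k = 1"
  shows "(norm (x * h + y * k))\<^sup>2 \<le> (norm x)\<^sup>2 + (norm y)\<^sup>2"
proof -
  define z where "z = x * h + y * k"
  define w where "w = x * k - y * h"
  have one': "h * (h * u) + k * (k * u) = u" for u
    using arg_cong[OF one, of "\<lambda>t. t * u"] by (simp add: distrib_right mult.assoc)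
  have comm': "h * (k * u) = k * (h * u)" for u
    using comm by (metis mult.assoc)
  have "z * adj z + w * adj w
      = x * (h * (h * adj x) + k * (k * adj x)) + y * (h * (h * adj y) + k * (k * adj y))"
    by (simp add: z_def w_def adj_add adj_diff adj_mult h k algebra_simps comm')
  then have sum: "z * adj z + w * adj w = x * adj x + y * adj y"
    by (simp only: one')
  have "norm (z * adj z) \<le> norm (x * adj x + y * adj y)"
    by (rule pos_norm_mono[OF pos_mult_adj]) (simp add: pos_mult_adj flip: sum)
  also have "\<dots> \<le> (norm x)\<^sup>2 + (norm y)\<^sup>2"
    using norm_triangle_ineq[of "x * adj x" "y * adj y"] by (simp add: cstar_identity')
  finally show ?thesis
    by (simp add: cstar_identity' z_def)
qed

text \<open>
  A functional of norm one comes close to the value 1 on \<open>X\<close>. A perturbation by \<open>c\<close> that changes norms only to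
  second order in \<open>c\<close> cannot change the value of such a functional to first order.
\<close>

lemma peak_perturbation:
  fixes \<phi> :: "'x \<Rightarrow> complex"
  assumes bound: "\<And>x c. x \<in> X \<Longrightarrow> (cmod (\<phi> x + c * w))\<^sup>2 \<le> 1 + (cmod c)\<^sup>2 * M"
    and peak: "\<And>\<eta>. \<eta> > 0 \<Longrightarrow> \<exists>x\<in>X. 1 - \<eta> < cmod (\<phi> x)" and M: "M \<ge> 0"
  shows "w = 0"
proof (rule ccontr)
  assume w: "w \<noteq> 0"
  define \<beta> where "\<beta> = cmod w"
  have \<beta>: "\<beta> > 0"
    using w by (simp add: \<beta>_def)
  \<comment> \<open>Every \<open>t\<close> with \<open>t M < 2 \<beta>\<close> contradicts \<open>1 + t \<beta> \<le> sqrt (1 + t\<^sup>2 M)\<close>.\<close>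
  define t where "t = \<beta> / (M + 1)"
  have t: "t > 0"
    using \<beta> M by (simp add: t_def)
  have "1 + t * \<beta> \<le> sqrt (1 + t\<^sup>2 * M)"
  proof (rule field_le_epsilon)
    fix \<eta> :: real assume "\<eta> > 0"
    then obtain x where x: "x \<in> X" "1 - min \<eta> (1/2) < cmod (\<phi> x)"
      using peak[of "min \<eta> (1/2)"] by auto
    then have nz: "\<phi> x \<noteq> 0"
      by auto
    \<comment> \<open>The phase of \<open>c\<close> aligns \<open>c w\<close> with \<open>\<phi>(x)\<close>.\<close>
    define c where "c = of_real t * (\<phi> x / of_real (cmod (\<phi> x))) * (cnj w / of_real \<beta>)"
    have c: "cmod c = t"
      using nz \<beta> t w by (simp add: c_def norm_mult norm_divide \<beta>_def)
    have "c * w = (\<phi> x / of_real (cmod (\<phi> x))) * of_real (t * \<beta>)"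
    proof -
      have "cnj w * w = of_real \<beta> * of_real \<beta>"
        by (simp add: \<beta>_def complex_norm_square[symmetric] mult.commute[of "cnj w"] flip: power2_eq_square)
      then have "cnj w * w / of_real \<beta> = of_real \<beta>"
        using \<beta> by simp
      moreover have "c * w = of_real t * (\<phi> x / of_real (cmod (\<phi> x))) * (cnj w * w / of_real \<beta>)"
        by (simp add: c_def)
      ultimately show ?thesis
        by (simp add: mult_ac)
    qed
    then have "\<phi> x + c * w = (\<phi> x / of_real (cmod (\<phi> x))) * of_real (cmod (\<phi> x) + t * \<beta>)"
      using nz by (simp add: field_simps)
    then have "cmod (\<phi> x + c * w) = cmod (\<phi> x) + t * \<beta>"
      using nz t \<beta> by (simp add: norm_mult norm_divide flip: of_real_add of_real_mult)
    then have "(cmod (\<phi> x) + t * \<beta>)\<^sup>2 \<le> 1 + t\<^sup>2 * M"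
      using bound[OF x(1), of c] c by simp
    then have "cmod (\<phi> x) + t * \<beta> \<le> sqrt (1 + t\<^sup>2 * M)"
      by (rule real_le_rsqrt)
    then show "1 + t * \<beta> \<le> sqrt (1 + t\<^sup>2 * M) + \<eta>"
      using x(2) by linarith
  qed
  then have "(1 + t * \<beta>)\<^sup>2 \<le> 1 + t\<^sup>2 * M"
    using t \<beta> M power_mono[of "1 + t * \<beta>" "sqrt (1 + t\<^sup>2 * M)" 2] by simp
  then have "2 * (t * \<beta>) \<le> t * (t * M)"
    using zero_le_power2[of "t * \<beta>"] unfolding power2_sum by (simp add: power2_eq_square mult.assoc)
  then have "2 * \<beta> \<le> t * M"
    using t by (simp add: mult.left_commute[of 2])
  also have "\<dots> \<le> \<beta>"
    using \<beta> M by (simp add: t_def field_simps)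
  finally show False
    using \<beta> by simp
qed

locale regular_sub = regular D for D :: "'a::cstar_algebra set" +
  fixes A :: "'a set"
  assumes A: "norm_closed_subalgebra A" and DA: "D \<subseteq> A"
begin

lemma A_csubspace: "csubspace A" and A_closed: "closed A"
  and A_mult: "x \<in> A \<Longrightarrow> y \<in> A \<Longrightarrow> x * y \<in> A"
  using A by (auto simp: norm_closed_subalgebra_def)

lemma A_zero: "0 \<in> A" and A_add: "x \<in> A \<Longrightarrow> y \<in> A \<Longrightarrow> x + y \<in> A"
  and A_scaleC: "x \<in> A \<Longrightarrow> c *\<^sub>C x \<in> A"
  using A_csubspace by (auto simp: cvs.subspace_def)

lemma A_sum: "(\<And>i. i \<in> I \<Longrightarrow> f i \<in> A) \<Longrightarrow> (\<Sum>i\<in>I. f i) \<in> A"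
  using A_csubspace by (rule cvs.subspace_sum)

lemma A_D: "d \<in> D \<Longrightarrow> d \<in> A"
  using DA by blast

text \<open>
  Eigenfunctionals of arbitrary norm, with range and source as parameters; so the notion survives composition
  with a bounded isomorphism, which changes norms.
\<close>

definition eigen :: "('a \<Rightarrow> complex) \<Rightarrow> ('a \<Rightarrow> complex) \<Rightarrow> ('a \<Rightarrow> complex) \<Rightarrow> bool" where
  "eigen \<phi> \<sigma> \<rho> \<longleftrightarrow> \<phi> \<in> bounded_functionals A \<and> \<sigma> \<in> characters D \<and> \<rho> \<in> characters D \<and>
     (\<forall>d\<in>D. \<forall>x\<in>A. \<phi> (d * x) = \<sigma> d * \<phi> x \<and> \<phi> (x * d) = \<phi> x * \<rho> d)"

lemma bf_add: "\<phi> \<in> bounded_functionals A \<Longrightarrow> x \<in> A \<Longrightarrow> y \<in> A \<Longrightarrow> \<phi> (x + y) = \<phi> x + \<phi> y"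
  and bf_scaleC: "\<phi> \<in> bounded_functionals A \<Longrightarrow> x \<in> A \<Longrightarrow> \<phi> (c *\<^sub>C x) = c * \<phi> x"
  by (simp_all add: bounded_functionals_def clinear_on_def scaleC_complex_def)

lemma bf_zero: "\<phi> \<in> bounded_functionals A \<Longrightarrow> \<phi> 0 = 0"
  using bf_scaleC[of \<phi> 0 0] A_zero by simp

lemma bf_minus: "\<phi> \<in> bounded_functionals A \<Longrightarrow> x \<in> A \<Longrightarrow> \<phi> (- x) = - \<phi> x"
  using bf_scaleC[of \<phi> x "-1"] by simp

lemma bf_diff: "\<phi> \<in> bounded_functionals A \<Longrightarrow> x \<in> A \<Longrightarrow> y \<in> A \<Longrightarrow> \<phi> (x - y) = \<phi> x - \<phi> y"
  using bf_add[of \<phi> x "- y"] bf_minus[of \<phi> y] A_scaleC[of y "-1"] by simp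

lemma bf_sum:
  assumes "\<phi> \<in> bounded_functionals A" "\<And>i. i \<in> I \<Longrightarrow> f i \<in> A"
  shows "\<phi> (\<Sum>i\<in>I. f i) = (\<Sum>i\<in>I. \<phi> (f i))"
  using assms(2)
  by (induction I rule: infinite_finite_induct) (simp_all add: bf_zero bf_add A_sum assms(1))

lemma bf_extensional: "\<phi> \<in> bounded_functionals A \<Longrightarrow> \<phi> \<in> extensional A"
  by (simp add: bounded_functionals_def)

lemma norm_one_nonzero:
  assumes "functional_norm A \<phi> = 1"
  obtains x where "x \<in> A" "\<phi> x \<noteq> 0"
proof -
  have "\<exists>x\<in>A. \<phi> x \<noteq> 0"
  proof (rule ccontr)
    assume "\<not> ?thesis"
    then have "functional_norm A \<phi> \<le> 0"
      using A_zero by (intro functional_norm_le) auto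
    then show False
      using assms by simp
  qed
  then show thesis
    using that by blast
qed

lemma eigenfunctional_eigen:
  assumes \<phi>: "\<phi> \<in> eigenfunctionals1 D A"
  obtains \<sigma> \<rho> where "eigen \<phi> \<sigma> \<rho>"
proof -
  have bf: "\<phi> \<in> bounded_functionals A" and fn: "functional_norm A \<phi> = 1"
    using \<phi> by (auto simp: eigenfunctionals1_def)
  obtain x0 where x0: "x0 \<in> A" "\<phi> x0 \<noteq> 0"
    using norm_one_nonzero[OF fn] .
  obtain l where l: "\<And>d x. d \<in> D \<Longrightarrow> x \<in> A \<Longrightarrow> \<phi> (d * x) = l d * \<phi> x"
    using \<phi> unfolding eigenfunctionals1_def by (simp add: Ball_def) metis
  obtain r where r: "\<And>d x. d \<in> D \<Longrightarrow> x \<in> A \<Longrightarrow> \<phi> (x * d) = r d * \<phi> x"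
    using \<phi> unfolding eigenfunctionals1_def by (simp add: Ball_def) metis
  have "restrict l D \<in> characters D"
  proof -
    have "l (d + e) = l d + l e" if "d \<in> D" "e \<in> D" for d e
    proof -
      have "l (d + e) * \<phi> x0 = (l d + l e) * \<phi> x0"
        using l[of "d + e" x0] l[of d x0] l[of e x0] that x0 bf A_mult A_D
        by (simp add: distrib_right bf_add)
      then show ?thesis
        using x0 by simp
    qed
    moreover have "l (c *\<^sub>C d) = c * l d" if "d \<in> D" for c d
    proof -
      have "l (c *\<^sub>C d) * \<phi> x0 = (c * l d) * \<phi> x0"
        using l[of "c *\<^sub>C d" x0] l[of d x0] that x0 bf A_mult A_D
        by (simp add: mult_scaleC_left bf_scaleC)
      then show ?thesis
        using x0 by simp
    qed
    moreover have "l (d * e) = l d * l e" if "d \<in> D" "e \<in> D" for d e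
    proof -
      have "l (d * e) * \<phi> x0 = (l d * l e) * \<phi> x0"
        using l[of "d * e" x0] l[of d "e * x0"] l[of e x0] that x0 A_mult A_D
        by (simp add: mult.assoc)
      then show ?thesis
        using x0 by simp
    qed
    moreover have "l 1 \<noteq> 0"
      using l[of 1 x0] x0 by auto
    ultimately show ?thesis
      using one_mem by (auto simp: characters_def clinear_on_def scaleC_complex_def)
  qed
  moreover have "restrict r D \<in> characters D"
  proof -
    have "r (d + e) = r d + r e" if "d \<in> D" "e \<in> D" for d e
    proof -
      have "r (d + e) * \<phi> x0 = (r d + r e) * \<phi> x0"
        using r[of "d + e" x0] r[of d x0] r[of e x0] that x0 bf A_mult A_D
        by (simp add: distrib_left distrib_right bf_add)
      then show ?thesis
        using x0 by simp
    qed
    moreover have "r (c *\<^sub>C d) = c * r d" if "d \<in> D" for c d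
    proof -
      have "r (c *\<^sub>C d) * \<phi> x0 = (c * r d) * \<phi> x0"
        using r[of "c *\<^sub>C d" x0] r[of d x0] that x0 bf A_mult A_D
        by (simp add: mult_scaleC_right bf_scaleC)
      then show ?thesis
        using x0 by simp
    qed
    moreover have "r (d * e) = r d * r e" if "d \<in> D" "e \<in> D" for d e
    proof -
      have "r (d * e) * \<phi> x0 = (r d * r e) * \<phi> x0"
        using r[of "d * e" x0] r[of e "x0 * d"] r[of d x0] that x0 A_mult A_D
        by (simp add: mult.assoc[symmetric] mult.commute[of "r e"])
      then show ?thesis
        using x0 by simp
    qed
    moreover have "r 1 \<noteq> 0"
      using r[of 1 x0] x0 by auto
    ultimately show ?thesis
      using one_mem by (auto simp: characters_def clinear_on_def scaleC_complex_def)
  qed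
  ultimately have "eigen \<phi> (restrict l D) (restrict r D)"
    using bf l r by (simp add: eigen_def)
  then show thesis
    by (rule that)
qed

lemma eigen_range_source:
  assumes e: "eigen \<phi> \<sigma> \<rho>" and x: "x \<in> A" "\<phi> x \<noteq> 0"
  shows "eig_range D A \<phi> = \<sigma>" "eig_source D A \<phi> = \<rho>"
proof -
  have ext: "\<sigma> \<in> extensional D" "\<rho> \<in> extensional D"
    using e by (auto simp: eigen_def characters_def)
  show "eig_range D A \<phi> = \<sigma>"
    unfolding eig_range_def
  proof (rule the_equality)
    show "\<sigma> \<in> characters D \<and> (\<forall>d\<in>D. \<forall>x\<in>A. \<phi> (d * x) = \<sigma> d * \<phi> x)"
      using e by (simp add: eigen_def)
    fix \<tau> assume \<tau>: "\<tau> \<in> characters D \<and> (\<forall>d\<in>D. \<forall>x\<in>A. \<phi> (d * x) = \<tau> d * \<phi> x)"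
    show "\<tau> = \<sigma>"
    proof (rule extensionalityI[of _ D])
      fix d assume "d \<in> D"
      then have "\<tau> d * \<phi> x = \<sigma> d * \<phi> x"
        using \<tau> e x by (metis eigen_def)
      then show "\<tau> d = \<sigma> d"
        using x by simp
    qed (use \<tau> ext in \<open>auto simp: characters_def\<close>)
  qed
  show "eig_source D A \<phi> = \<rho>"
    unfolding eig_source_def
  proof (rule the_equality)
    show "\<rho> \<in> characters D \<and> (\<forall>d\<in>D. \<forall>x\<in>A. \<phi> (x * d) = \<phi> x * \<rho> d)"
      using e by (simp add: eigen_def)
    fix \<tau> assume \<tau>: "\<tau> \<in> characters D \<and> (\<forall>d\<in>D. \<forall>x\<in>A. \<phi> (x * d) = \<phi> x * \<tau> d)"
    show "\<tau> = \<rho>"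
    proof (rule extensionalityI[of _ D])
      fix d assume "d \<in> D"
      then have "\<phi> x * \<tau> d = \<phi> x * \<rho> d"
        using \<tau> e x by (metis eigen_def)
      then show "\<tau> d = \<rho> d"
        using x by simp
    qed (use \<tau> ext in \<open>auto simp: characters_def\<close>)
  qed
qed

lemma eigenfunctionals1_iff:
  "\<phi> \<in> eigenfunctionals1 D A \<longleftrightarrow>
     functional_norm A \<phi> = 1 \<and> eigen \<phi> (eig_range D A \<phi>) (eig_source D A \<phi>)"
proof
  assume \<phi>: "\<phi> \<in> eigenfunctionals1 D A"
  then have fn: "functional_norm A \<phi> = 1"
    by (simp add: eigenfunctionals1_def)
  obtain \<sigma> \<rho> where e: "eigen \<phi> \<sigma> \<rho>"
    using eigenfunctional_eigen[OF \<phi>] .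
  obtain x where "x \<in> A" "\<phi> x \<noteq> 0"
    using norm_one_nonzero[OF fn] .
  then show "functional_norm A \<phi> = 1 \<and> eigen \<phi> (eig_range D A \<phi>) (eig_source D A \<phi>)"
    using eigen_range_source[OF e] e fn by simp
next
  assume "functional_norm A \<phi> = 1 \<and> eigen \<phi> (eig_range D A \<phi>) (eig_source D A \<phi>)"
  then show "\<phi> \<in> eigenfunctionals1 D A"
    unfolding eigenfunctionals1_def eigen_def by (auto intro: exI[of _ "eig_source D A \<phi> _"] simp: mult.commute)
qed

lemma eigenfunctionals1I:
  assumes "eigen \<phi> \<sigma> \<rho>" "functional_norm A \<phi> = 1"
  shows "\<phi> \<in> eigenfunctionals1 D A" "eig_range D A \<phi> = \<sigma>" "eig_source D A \<phi> = \<rho>"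
  using norm_one_nonzero[OF assms(2)] eigen_range_source[OF assms(1)] eigenfunctionals1_iff assms by metis+

end

lemma regular_sub_UNIV: "regular_inclusion D \<Longrightarrow> regular_sub D UNIV"
  by unfold_locales (auto simp: norm_closed_subalgebra_def cvs.subspace_def)

context abelian_cstar
begin

subsection \<open>Elements of an abelian algebra adapted to a character\<close>

lemma unit_complement:
  assumes \<rho>: "\<rho> \<in> characters B" and k: "k \<in> B" "adj k = k" "norm k \<le> 1" "\<rho> k = 0"
  obtains h where "h \<in> B" "adj h = h" "h * h + k * k = 1" "\<rho> h = 1"
proof -
  have "norm (k * k) \<le> 1"
    using k(3) norm_mult_ineq[of k k] mult_le_one[OF k(3) norm_ge_zero k(3)] by linarith
  then have "pos (1 - k * k)"
    using pos_norm_minus(1)[of "k * k" 1] k by (simp add: adj_mult)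
  then obtain h where h: "h \<in> B" "pos h" "h * h = 1 - k * k"
    using pos_sqrt[of "1 - k * k"] k by auto
  have "\<rho> (1 - k * k) = 1"
    using k \<rho> by (simp add: char_diff char_one char_mult)
  then have "\<rho> h * \<rho> h = 1"
    using h \<rho> by (simp flip: char_mult)
  moreover have "\<rho> h \<noteq> - 1"
    using char_pos[OF \<rho> h(1,2)] by auto
  ultimately have "\<rho> h = 1"
    by (metis square_eq_1_iff)
  then show thesis
    using that[of h] h by (simp add: pos_herm)
qed

lemma resolvent:
  assumes a: "a \<in> B" "pos a" and c: "c > 0"
  obtains x where "x \<in> B" "adj x = x" "\<And>\<rho>. \<rho> \<in> characters B \<Longrightarrow> \<rho> x = of_real (1 / (Re (\<rho> a) + c))"
proof -
  obtain x where x: "x \<in> B" "pos x" "x * (a + of_real c) = 1"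
    using strictly_pos_inverse[OF a c] .
  have "\<rho> x = of_real (1 / (Re (\<rho> a) + c))" if \<rho>: "\<rho> \<in> characters B" for \<rho>
  proof -
    have "\<rho> a = of_real (Re (\<rho> a))"
      using \<rho> a by (intro char_herm_real) (auto simp: pos_herm)
    moreover have "\<rho> x * (\<rho> a + of_real c) = 1"
      using x a \<rho> char_mult[OF \<rho>, of x "a + of_real c"] by (simp add: char_add char_of_real char_one)
    ultimately have "\<rho> x * of_real (Re (\<rho> a) + c) = 1"
      by simp
    moreover have "Re (\<rho> a) + c \<noteq> 0"
      using char_pos[OF \<rho> a] c by simp
    ultimately show ?thesis
      by (simp add: field_simps flip: of_real_add)
  qed
  then show thesis
    using that x pos_herm by blast
qed

text \<open>
  For \<open>x = (a + \<delta>)\<^sup>-\<^sup>1\<close> the element \<open>(1 - x a) a (1 - x a)\<close> is \<open>\<delta>\<^sup>2 a / (a + \<delta>)\<^sup>2\<close>, which is at most \<open>\<delta>\<close>.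
\<close>

lemma approximate_unit:
  assumes a: "a \<in> B" "pos a" and \<delta>: "\<delta> > 0"
  obtains x where "x \<in> B" "adj x = x" "norm ((1 - x * a) * a * (1 - x * a)) \<le> \<delta>"
proof -
  obtain x where x: "x \<in> B" "adj x = x" "\<And>\<rho>. \<rho> \<in> characters B \<Longrightarrow> \<rho> x = of_real (1 / (Re (\<rho> a) + \<delta>))"
    using resolvent[OF a \<delta>] by blast
  have "norm ((1 - x * a) * a * (1 - x * a)) \<le> \<delta>"
  proof (rule norm_le_if_char_le)
    fix \<tau> assume \<tau>: "\<tau> \<in> characters B"
    define r where "r = Re (\<tau> a)"
    have r: "\<tau> a = of_real r" "r \<ge> 0"
      using \<tau> a char_herm_real[OF \<tau> a(1)] char_pos[OF \<tau> a(1)] by (auto simp: r_def pos_herm)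
    have "\<tau> (1 - x * a) = of_real (1 - 1 / (r + \<delta>) * r)"
      using x(1) x(3)[OF \<tau>] a(1) \<tau> r by (simp add: char_diff char_one char_mult)
    also have "1 - 1 / (r + \<delta>) * r = \<delta> / (r + \<delta>)"
      using r \<delta> by (simp add: field_simps)
    finally have "\<tau> ((1 - x * a) * a * (1 - x * a)) = of_real (\<delta> / (r + \<delta>) * r * (\<delta> / (r + \<delta>)))"
      using x(1) a(1) \<tau> r by (simp add: char_mult)
    moreover have "0 \<le> \<delta> / (r + \<delta>) * r * (\<delta> / (r + \<delta>))"
      using r \<delta> by simp
    moreover have "\<delta> / (r + \<delta>) * r * (\<delta> / (r + \<delta>)) \<le> \<delta>"
    proof -
      have "r / (r + \<delta>) \<le> 1" "\<delta> / (r + \<delta>) \<le> 1"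
        using r \<delta> by simp_all
      then have "(r / (r + \<delta>)) * (\<delta> / (r + \<delta>)) \<le> 1"
        using r \<delta> by (intro mult_le_one) auto
      then have "\<delta> * ((r / (r + \<delta>)) * (\<delta> / (r + \<delta>))) \<le> \<delta> * 1"
        using \<delta> by (intro mult_left_mono) auto
      then show ?thesis
        by (simp add: mult_ac)
    qed
    ultimately show "cmod (\<tau> ((1 - x * a) * a * (1 - x * a))) \<le> \<delta>"
      by (simp only: norm_of_real abs_of_nonneg)
  qed (use x a \<delta> in auto)
  then show thesis
    using that x by blast
qed

lemma approx_annihilate:
  assumes \<rho>: "\<rho> \<in> characters B" and a: "a \<in> B" "pos a" "\<rho> a = 0" and \<delta>: "\<delta> > 0"
  obtains d where "d \<in> B" "adj d = d" "\<rho> d = 1" "norm (d * a * d) \<le> \<delta>"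
proof -
  obtain x where x: "x \<in> B" "adj x = x" "norm ((1 - x * a) * a * (1 - x * a)) \<le> \<delta>"
    using approximate_unit[OF a(1,2) \<delta>] .
  have "\<rho> (1 - x * a) = 1"
    using x a \<rho> by (simp add: char_diff char_one char_mult)
  moreover have "adj (1 - x * a) = 1 - x * a"
    using x a by (simp add: adj_diff adj_mult_herm pos_herm)
  ultimately show thesis
    using that[of "1 - x * a"] x a by simp
qed

text \<open>
  The function \<open>2 \<alpha> / (r + \<alpha>)\<close> takes the value 1 at \<open>r = \<alpha>\<close>, and \<open>(2 \<alpha> / (r + \<alpha>))\<^sup>2 r \<le> \<alpha>\<close> by the inequality
  of the means.
\<close>

lemma peak_element:
  assumes \<rho>: "\<rho> \<in> characters B" and a: "a \<in> B" "pos a" "\<rho> a = of_real \<alpha>" and \<alpha>: "\<alpha> > 0"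
  obtains h where "h \<in> B" "adj h = h" "\<rho> h = 1" "norm (h * a * h) \<le> \<alpha>"
proof -
  obtain x where x: "x \<in> B" "adj x = x" "\<And>\<rho>. \<rho> \<in> characters B \<Longrightarrow> \<rho> x = of_real (1 / (Re (\<rho> a) + \<alpha>))"
    using resolvent[OF a(1,2) \<alpha>] by blast
  define h where "h = (2 * \<alpha>) *\<^sub>R x"
  have h: "h \<in> B" "adj h = h" "\<rho> h = 1"
    using x(1,2) x(3)[OF \<rho>] a(3) \<alpha> \<rho> by (simp_all add: h_def char_scaleR)
  have "norm (h * a * h) \<le> \<alpha>"
  proof (rule norm_le_if_char_le)
    fix \<tau> assume \<tau>: "\<tau> \<in> characters B"
    define r where "r = Re (\<tau> a)"
    have r: "\<tau> a = of_real r" "r \<ge> 0"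
      using \<tau> a char_herm_real[OF \<tau> a(1)] char_pos[OF \<tau> a(1)] by (auto simp: r_def pos_herm)
    have "\<tau> (h * a * h) = of_real (2 * \<alpha> / (r + \<alpha>) * r * (2 * \<alpha> / (r + \<alpha>)))"
      using x(1,2) x(3)[OF \<tau>] a(1) \<tau> r by (simp add: h_def char_mult char_scaleR)
    moreover have "0 \<le> 2 * \<alpha> / (r + \<alpha>) * r * (2 * \<alpha> / (r + \<alpha>))"
      using r \<alpha> by simp
    moreover have "2 * \<alpha> / (r + \<alpha>) * r * (2 * \<alpha> / (r + \<alpha>)) \<le> \<alpha>"
    proof -
      have "4 * \<alpha> * r \<le> (r + \<alpha>) * (r + \<alpha>)"
        using zero_le_power2[of "r - \<alpha>"] by (simp add: power2_eq_square algebra_simps)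
      then have "\<alpha> * (4 * \<alpha> * r) \<le> \<alpha> * ((r + \<alpha>) * (r + \<alpha>))"
        using \<alpha> by (intro mult_left_mono) auto
      then have "\<alpha> * (4 * \<alpha> * r) / ((r + \<alpha>) * (r + \<alpha>)) \<le> \<alpha>"
        using r \<alpha> by (subst pos_divide_le_eq) (auto intro: mult_pos_pos)
      then show ?thesis
        by (simp add: mult_ac)
    qed
    ultimately show "cmod (\<tau> (h * a * h)) \<le> \<alpha>"
      by (simp only: norm_of_real abs_of_nonneg)
  qed (use h a \<alpha> in auto)
  then show thesis
    using that h by blast
qed

end

context regular_sub
begin

lemma normalizerD:
  assumes "v \<in> normalizers D A"
  shows "v \<in> A" "d \<in> D \<Longrightarrow> v * d * adj v \<in> D" "d \<in> D \<Longrightarrow> adj v * d * v \<in> D"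
    "adj v * v \<in> D" "v * adj v \<in> D"
  using assms unfolding normalizers_def by (auto dest: bspec[OF _ one_mem])

lemma normalizer_mult_right:
  assumes v: "\<And>d. d \<in> D \<Longrightarrow> v * d * adj v \<in> D \<and> adj v * d * v \<in> D" and e: "e \<in> D" "v * e \<in> A"
  shows "v * e \<in> normalizers D A"
proof -
  have "(v * e) * d * adj (v * e) \<in> D" "adj (v * e) * d * (v * e) \<in> D" if d: "d \<in> D" for d
  proof -
    have "(v * e) * d * adj (v * e) = v * (e * d * adj e) * adj v"
      "adj (v * e) * d * (v * e) = adj e * (adj v * d * v) * e"
      by (simp_all add: adj_mult mult.assoc)
    then show "(v * e) * d * adj (v * e) \<in> D" "adj (v * e) * d * (v * e) \<in> D"
      using v d e by simp_all
  qed
  then show ?thesis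
    using e by (simp add: normalizers_def)
qed

lemma normalizer_scaleC:
  assumes "v \<in> normalizers D A"
  shows "c *\<^sub>C v \<in> normalizers D A"
proof -
  have "v * (c *\<^sub>C 1) \<in> normalizers D A"
    using assms by (intro normalizer_mult_right) (auto simp: normalizers_def mult_scaleC_right intro: A_scaleC)
  then show ?thesis
    by (simp add: mult_scaleC_right)
qed

lemma normalizer_mult:
  assumes "v \<in> normalizers D A" "w \<in> normalizers D A"
  shows "v * w \<in> normalizers D A"
proof -
  have "(v * w) * d * adj (v * w) \<in> D" "adj (v * w) * d * (v * w) \<in> D" if d: "d \<in> D" for d
  proof -
    have "(v * w) * d * adj (v * w) = v * (w * d * adj w) * adj v"
      "adj (v * w) * d * (v * w) = adj w * (adj v * d * v) * w"
      by (simp_all add: adj_mult mult.assoc)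
    then show "(v * w) * d * adj (v * w) \<in> D" "adj (v * w) * d * (v * w) \<in> D"
      using normalizerD[OF assms(1)] normalizerD[OF assms(2)] d by simp_all
  qed
  then show ?thesis
    using A_mult[OF normalizerD(1)[OF assms(1)] normalizerD(1)[OF assms(2)]]
    by (simp add: normalizers_def)
qed

subsection \<open>Extension to the whole algebra\<close>

text \<open>
  A norm-preserving extension \<open>\<psi>\<close> of \<open>\<phi>\<close> is again an eigenfunctional: for hermitian \<open>h, k \<in> D\<close> with
  \<open>h\<^sup>2 + k\<^sup>2 = 1\<close>, \<open>\<rho>(k) = 0\<close> and \<open>\<rho>(h) = 1\<close>, the element \<open>x h + c y k\<close> has norm at most
  \<open>(1 + |c|\<^sup>2 \<parallel>y\<parallel>\<^sup>2)\<^bsup>1/2\<^esup>\<close> for \<open>x\<close> in the unit ball of \<open>A\<close>, while \<open>\<psi>\<close> takes the value \<open>\<phi>(x) + c \<psi>(y k)\<close> there.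
\<close>

lemma eigenfunctional_extension:
  assumes e: "eigen \<phi> \<sigma> \<rho>" and fn: "functional_norm A \<phi> = 1"
  obtains \<psi> where "regular_sub.eigen D UNIV \<psi> \<sigma> \<rho>" "\<And>x. x \<in> A \<Longrightarrow> \<psi> x = \<phi> x"
proof -
  interpret U: regular_sub D UNIV
    by (rule regular_sub_UNIV[OF regular])
  have bf: "\<phi> \<in> bounded_functionals A" and \<sigma>: "\<sigma> \<in> characters D" and \<rho>: "\<rho> \<in> characters D"
    and left: "\<And>d x. d \<in> D \<Longrightarrow> x \<in> A \<Longrightarrow> \<phi> (d * x) = \<sigma> d * \<phi> x"
    and right: "\<And>d x. d \<in> D \<Longrightarrow> x \<in> A \<Longrightarrow> \<phi> (x * d) = \<phi> x * \<rho> d"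
    using e by (auto simp: eigen_def)
  have "cmod (\<phi> x) \<le> 1 * norm x" if "x \<in> A" for x
    using functional_norm_bound[OF bf A_csubspace that] fn by simp
  moreover have "clinear_on A \<phi>"
    using bf by (simp add: bounded_functionals_def)
  ultimately obtain \<psi> where \<psi>: "clinear_on UNIV \<psi>" "\<And>x. cmod (\<psi> x) \<le> 1 * norm x"
    and \<psi>_A: "\<And>x. x \<in> A \<Longrightarrow> \<psi> x = \<phi> x"
    using hahn_banach_complex[OF A_csubspace, of \<phi> 1] by auto
  have \<psi>_bf: "\<psi> \<in> bounded_functionals UNIV"
    using \<psi> by (intro bounded_functionalsI[where K = 1]) auto
  note add = U.bf_add[OF \<psi>_bf, simplified] and scaleC = U.bf_scaleC[OF \<psi>_bf, simplified]
    and diff = U.bf_diff[OF \<psi>_bf, simplified]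
  have scaleR: "\<psi> (t *\<^sub>R x) = of_real t * \<psi> x" for t x
    using scaleC[of "of_real t" x] by (simp add: scaleC_of_real)
  define X where "X = {x \<in> A. norm x \<le> 1}"
  have peak: "\<exists>x\<in>X. 1 - \<eta> < cmod (\<phi> x)" if "\<eta> > 0" for \<eta>
  proof (rule ccontr)
    assume "\<not> ?thesis"
    then have "functional_norm A \<phi> \<le> 1 - \<eta>"
      using A_zero by (intro functional_norm_le) (auto simp: X_def not_less)
    then show False
      using fn that by simp
  qed
  have norm_sq: "(cmod (\<psi> z))\<^sup>2 \<le> 1 + (cmod c)\<^sup>2 * (norm y)\<^sup>2"
    if "norm x \<le> 1" "(norm z)\<^sup>2 \<le> (norm x)\<^sup>2 + (norm (c *\<^sub>C y))\<^sup>2" for x y z c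
  proof -
    have "(cmod (\<psi> z))\<^sup>2 \<le> (norm z)\<^sup>2"
      using \<psi>(2)[of z] by (simp add: power_mono)
    also have "\<dots> \<le> 1 + (cmod c)\<^sup>2 * (norm y)\<^sup>2"
      using that power_le_one[of "norm x" 2] by (simp add: norm_scaleC power_mult_distrib)
    finally show ?thesis .
  qed
  have null_right: "\<psi> (y * k) = 0" if k: "k \<in> D" "adj k = k" "norm k \<le> 1" "\<rho> k = 0" for y k
  proof (rule peak_perturbation[OF _ peak zero_le_power2])
    obtain h where h: "h \<in> D" "adj h = h" "h * h + k * k = 1" "\<rho> h = 1"
      using unit_complement[OF \<rho> k] .
    fix x c assume x: "x \<in> X"
    have "(norm (x * h + (c *\<^sub>C y) * k))\<^sup>2 \<le> (norm x)\<^sup>2 + (norm (c *\<^sub>C y))\<^sup>2"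
      using h k by (intro norm_row_column commute) auto
    then have "(cmod (\<psi> (x * h + (c *\<^sub>C y) * k)))\<^sup>2 \<le> 1 + (cmod c)\<^sup>2 * (norm y)\<^sup>2"
      using x norm_sq[of x] by (simp add: X_def)
    moreover have "\<psi> (x * h + (c *\<^sub>C y) * k) = \<phi> x + c * \<psi> (y * k)"
      using x h \<psi>_A[of "x * h"] A_mult A_D right by (simp add: X_def add scaleC mult_scaleC_left)
    ultimately show "(cmod (\<phi> x + c * \<psi> (y * k)))\<^sup>2 \<le> 1 + (cmod c)\<^sup>2 * (norm y)\<^sup>2"
      by simp
  qed
  have null_left: "\<psi> (k * y) = 0" if k: "k \<in> D" "adj k = k" "norm k \<le> 1" "\<sigma> k = 0" for y k
  proof (rule peak_perturbation[OF _ peak zero_le_power2])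
    obtain h where h: "h \<in> D" "adj h = h" "h * h + k * k = 1" "\<sigma> h = 1"
      using unit_complement[OF \<sigma> k] .
    fix x c assume x: "x \<in> X"
    have "(norm (adj x * h + adj (c *\<^sub>C y) * k))\<^sup>2 \<le> (norm (adj x))\<^sup>2 + (norm (adj (c *\<^sub>C y)))\<^sup>2"
      using h k by (intro norm_row_column commute) auto
    moreover have "adj x * h + adj (c *\<^sub>C y) * k = adj (h * x + k * (c *\<^sub>C y))"
      using h k by (simp add: adj_add adj_mult)
    ultimately have "(norm (h * x + k * (c *\<^sub>C y)))\<^sup>2 \<le> (norm x)\<^sup>2 + (norm (c *\<^sub>C y))\<^sup>2"
      by simp
    then have "(cmod (\<psi> (h * x + k * (c *\<^sub>C y))))\<^sup>2 \<le> 1 + (cmod c)\<^sup>2 * (norm y)\<^sup>2"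
      using x norm_sq[of x] by (simp add: X_def)
    moreover have "\<psi> (h * x + k * (c *\<^sub>C y)) = \<phi> x + c * \<psi> (k * y)"
      using x h \<psi>_A[of "h * x"] A_mult A_D left by (simp add: X_def add scaleC mult_scaleC_right)
    ultimately show "(cmod (\<phi> x + c * \<psi> (k * y)))\<^sup>2 \<le> 1 + (cmod c)\<^sup>2 * (norm y)\<^sup>2"
      by simp
  qed
  have kernel: "\<exists>a b s t. d = \<tau> d *\<^sub>C 1 + (s *\<^sub>R a + \<i> *\<^sub>C (t *\<^sub>R b)) \<and> a \<in> D \<and> adj a = a \<and> norm a \<le> 1 \<and> \<tau> a = 0
      \<and> b \<in> D \<and> adj b = b \<and> norm b \<le> 1 \<and> \<tau> b = 0"
    if \<tau>: "\<tau> \<in> characters D" and d: "d \<in> D" for \<tau> d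
  proof -
    define f where "f = d - \<tau> d *\<^sub>C 1"
    have f: "f \<in> D" "\<tau> f = 0"
      using d \<tau> by (auto simp: f_def char_diff char_scaleC char_one)
    obtain s t where st: "\<tau> (re_part f) = of_real s" "\<tau> (im_part f) = of_real t"
      using char_herm_real[OF \<tau>, of "re_part f"] char_herm_real[OF \<tau>, of "im_part f"] f
      by (metis adj_re_part adj_im_part re_part_mem im_part_mem)
    have "\<tau> (re_part f + \<i> *\<^sub>C im_part f) = 0"
      using f(2) by (simp flip: re_im_decomp)
    then have "of_real s + \<i> * of_real t = (0 :: complex)"
      using f \<tau> by (simp add: char_add char_scaleC st)
    then have zero: "\<tau> (re_part f) = 0" "\<tau> (im_part f) = 0"
      by (simp_all add: st complex_eq_iff)
    define n where "n = norm f + 1"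
    have n: "n > 0"
      by (simp add: n_def add_nonneg_pos)
    define a where "a = (1/n) *\<^sub>R re_part f"
    define b where "b = (1/n) *\<^sub>R im_part f"
    have "norm (re_part f) \<le> n" "norm (im_part f) \<le> n"
      using norm_re_part[of f] norm_im_part[of f] by (simp_all add: n_def)
    then have "a \<in> D" "adj a = a" "norm a \<le> 1" "\<tau> a = 0" "b \<in> D" "adj b = b" "norm b \<le> 1" "\<tau> b = 0"
      using f zero n \<tau> by (auto simp: a_def b_def char_scaleR divide_simps)
    moreover have "d = \<tau> d *\<^sub>C 1 + (n *\<^sub>R a + \<i> *\<^sub>C (n *\<^sub>R b))"
      using n re_im_decomp[of f] by (simp add: a_def b_def f_def algebra_simps)
    ultimately show ?thesis
      by blast
  qed
  have "\<psi> (y * d) = \<psi> y * \<rho> d" if d: "d \<in> D" for y d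
  proof -
    obtain a b s t where eq: "d = \<rho> d *\<^sub>C 1 + (s *\<^sub>R a + \<i> *\<^sub>C (t *\<^sub>R b))"
      and ab: "a \<in> D" "adj a = a" "norm a \<le> 1" "\<rho> a = 0" "b \<in> D" "adj b = b" "norm b \<le> 1" "\<rho> b = 0"
      using kernel[OF \<rho> d] by blast
    have "\<psi> (y * (\<rho> d *\<^sub>C 1 + (s *\<^sub>R a + \<i> *\<^sub>C (t *\<^sub>R b)))) = \<rho> d * \<psi> y"
      using null_right ab by (simp add: distrib_left mult_scaleC_right add scaleC scaleR)
    then show ?thesis
      using eq by (simp add: mult.commute)
  qed
  moreover have "\<psi> (d * y) = \<sigma> d * \<psi> y" if d: "d \<in> D" for y d
  proof -
    obtain a b s t where eq: "d = \<sigma> d *\<^sub>C 1 + (s *\<^sub>R a + \<i> *\<^sub>C (t *\<^sub>R b))"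
      and ab: "a \<in> D" "adj a = a" "norm a \<le> 1" "\<sigma> a = 0" "b \<in> D" "adj b = b" "norm b \<le> 1" "\<sigma> b = 0"
      using kernel[OF \<sigma> d] by blast
    have "\<psi> ((\<sigma> d *\<^sub>C 1 + (s *\<^sub>R a + \<i> *\<^sub>C (t *\<^sub>R b))) * y) = \<sigma> d * \<psi> y"
      using null_left ab by (simp add: distrib_right mult_scaleC_left add scaleC scaleR)
    then show ?thesis
      using eq by simp
  qed
  ultimately have "U.eigen \<psi> \<sigma> \<rho>"
    using \<psi>_bf \<sigma> \<rho> by (simp add: U.eigen_def)
  then show thesis
    using that \<psi>_A by blast
qed

end

section \<open>Normalizers as coordinates\<close>

context regular_sub
begin

lemma eigenD:
  assumes "eigen \<phi> \<sigma> \<rho>"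
  shows "\<phi> \<in> bounded_functionals A" "\<sigma> \<in> characters D" "\<rho> \<in> characters D"
    "d \<in> D \<Longrightarrow> x \<in> A \<Longrightarrow> \<phi> (d * x) = \<sigma> d * \<phi> x" "d \<in> D \<Longrightarrow> x \<in> A \<Longrightarrow> \<phi> (x * d) = \<phi> x * \<rho> d"
  using assms by (auto simp: eigen_def)

lemma norm_mult_herm_square:
  assumes "adj h = h"
  shows "(norm (v * h))\<^sup>2 = norm (h * (adj v * v) * h)"
proof -
  have "adj (v * h) * (v * h) = h * (adj v * v) * h"
    using assms by (simp add: adj_mult mult.assoc)
  then show ?thesis
    by (metis cstar_identity)
qed

text \<open>
  If \<open>\<rho>(v\<^sup>* v) = 0\<close>, there are \<open>d \<in> D\<close> with \<open>\<rho>(d) = 1\<close> for which \<open>v d\<close> is arbitrarily small, although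
  \<open>\<phi>(v d) = \<phi>(v)\<close>.
\<close>

lemma eigen_normalizer_pos:
  assumes e: "eigen \<phi> \<sigma> \<rho>" and v: "v \<in> normalizers D A" and nz: "\<phi> v \<noteq> 0"
  shows "0 < Re (\<rho> (adj v * v))" "\<rho> (adj v * v) = of_real (Re (\<rho> (adj v * v)))"
proof -
  note \<rho> = eigenD(3)[OF e] and bf = eigenD(1)[OF e]
  define a where "a = adj v * v"
  have a: "a \<in> D" "pos a" "adj a = a"
    using normalizerD(4)[OF v] by (auto simp: a_def pos_adj_mult adj_mult adj_adj)
  show real: "\<rho> (adj v * v) = of_real (Re (\<rho> (adj v * v)))"
    using char_herm_real[OF \<rho> a(1,3)] by (simp add: a_def)
  have "\<rho> a \<noteq> 0"
  proof
    assume zero: "\<rho> a = 0"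
    define K where "K = functional_norm A \<phi>"
    have "(cmod (\<phi> v))\<^sup>2 \<le> K\<^sup>2 * \<delta>" if \<delta>: "\<delta> > 0" for \<delta>
    proof -
      obtain d where d: "d \<in> D" "adj d = d" "\<rho> d = 1" "norm (d * a * d) \<le> \<delta>"
        using approx_annihilate[OF \<rho> a(1,2) zero \<delta>] .
      have vd: "v * d \<in> A"
        using normalizerD(1)[OF v] d A_mult A_D by auto
      have "\<phi> v = \<phi> (v * d)"
        using eigenD(5)[OF e d(1) normalizerD(1)[OF v]] d by simp
      also have "cmod \<dots> \<le> K * norm (v * d)"
        unfolding K_def by (rule functional_norm_bound[OF bf A_csubspace vd])
      finally have "(cmod (\<phi> v))\<^sup>2 \<le> (K * norm (v * d))\<^sup>2"
        by (simp add: power_mono)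
      also have "\<dots> = K\<^sup>2 * norm (d * a * d)"
        using norm_mult_herm_square[OF d(2), of v] by (simp add: power_mult_distrib a_def)
      also have "\<dots> \<le> K\<^sup>2 * \<delta>"
        using d by (intro mult_left_mono) auto
      finally show ?thesis .
    qed
    from this[of "(cmod (\<phi> v))\<^sup>2 / (2 * (K\<^sup>2 + 1))"]
    have le: "(cmod (\<phi> v))\<^sup>2 \<le> K\<^sup>2 * ((cmod (\<phi> v))\<^sup>2 / (2 * (K\<^sup>2 + 1)))"
      using nz by (simp add: add_nonneg_pos)
    have "K\<^sup>2 / (2 * (K\<^sup>2 + 1)) < 1"
      by (simp add: divide_less_eq add_nonneg_pos)
    then have "(cmod (\<phi> v))\<^sup>2 * (K\<^sup>2 / (2 * (K\<^sup>2 + 1))) < (cmod (\<phi> v))\<^sup>2 * 1"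
      using nz by (intro mult_strict_left_mono) auto
    then show False
      using le by (simp add: mult_ac)
  qed
  moreover have "0 \<le> Re (\<rho> a)"
    by (rule char_pos[OF \<rho> a(1,2)])
  ultimately show "0 < Re (\<rho> (adj v * v))"
    using real unfolding a_def by (metis less_eq_real_def of_real_0)
qed

lemma eigen_conjugation:
  assumes e: "eigen \<phi> \<sigma> \<rho>" and v: "v \<in> normalizers D A" "\<phi> v \<noteq> 0" and d: "d \<in> D"
  shows "\<sigma> (v * d * adj v) = \<rho> d * \<rho> (adj v * v)"
proof -
  have "\<sigma> (v * d * adj v) * \<phi> v = \<phi> (v * (d * (adj v * v)))"
    using eigenD(4)[OF e normalizerD(2)[OF v(1) d] normalizerD(1)[OF v(1)]] by (simp add: mult.assoc)
  also have "\<dots> = \<phi> v * \<rho> (d * (adj v * v))"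
    using eigenD(5)[OF e _ normalizerD(1)[OF v(1)]] normalizerD(4)[OF v(1)] d by simp
  finally show ?thesis
    using v(2) char_mult[OF eigenD(3)[OF e] d normalizerD(4)[OF v(1)]] by simp
qed

end

text \<open>
  The functional \<open>z \<mapsto> \<psi>(v z)\<close> acts on the compressions \<open>g v\<^sup>* x g\<close> of \<open>v\<^sup>* x\<close> by scalars, because
  \<open>v g v\<^sup>* x g\<close> is \<open>x\<close> multiplied from both sides with elements of \<open>D\<close>.
\<close>

lemma (in regular) eigen_expectation:
  assumes e: "regular_sub.eigen D UNIV \<psi> \<sigma> \<rho>" and v: "v \<in> normalizers D UNIV" "\<psi> v \<noteq> 0"
  shows "\<psi> v * ext_state \<rho> (adj v * x) = \<rho> (adj v * v) * \<psi> x"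
proof -
  interpret U: regular_sub D UNIV
    by (rule regular_sub_UNIV[OF regular])
  note \<rho> = U.eigenD(3)[OF e] and bf = U.eigenD(1)[OF e]
  define K where "K = functional_norm UNIV \<psi>"
  have "0 \<le> K"
    using functional_norm_ge[OF bf U.A_csubspace U.A_zero] by (simp add: K_def U.bf_zero[OF bf])
  have "\<psi> (v * expectation (adj v * x)) = \<rho> (adj v * v) * \<psi> x"
  proof (rule functional_expectation[OF \<rho>])
    show "clinear_on UNIV (\<lambda>z. \<psi> (v * z))"
      by (simp add: clinear_on_def scaleC_complex_def distrib_left mult_scaleC_right U.bf_add[OF bf] U.bf_scaleC[OF bf])
    show "cmod (\<psi> (v * z)) \<le> (K * norm v) * norm z" for z
    proof -
      have "cmod (\<psi> (v * z)) \<le> K * norm (v * z)"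
        unfolding K_def by (rule functional_norm_bound[OF bf U.A_csubspace]) simp
      also have "\<dots> \<le> K * (norm v * norm z)"
        using \<open>0 \<le> K\<close> by (intro mult_left_mono norm_mult_ineq)
      finally show ?thesis
        by (simp add: mult.assoc)
    qed
    fix g assume g: "g \<in> D"
    have "v * (g * (adj v * x) * g) = (v * g * adj v) * (x * g)"
      by (simp add: mult.assoc)
    also have "\<psi> \<dots> = \<sigma> (v * g * adj v) * (\<psi> x * \<rho> g)"
      using U.eigenD(4,5)[OF e] U.normalizerD(2)[OF v(1) g] g by simp
    finally show "\<psi> (v * (g * (adj v * x) * g)) = \<rho> (g * g) * (\<rho> (adj v * v) * \<psi> x)"
      using U.eigen_conjugation[OF e v g] char_mult[OF \<rho> g g] by (simp add: mult_ac)
  qed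
  then show ?thesis
    using U.eigenD(5)[OF e expectation_mem UNIV_I] char_expectation[OF \<rho>] by simp
qed

context regular_sub
begin

subsection \<open>Every eigenfunctional sees a normalizer of \<open>A\<close>\<close>

text \<open>
  By averaging, the element is a limit of sums of \<open>v (g v\<^sup>* x g) = (v g v\<^sup>*)(x g)\<close>, and the right-hand side belongs
  to \<open>A\<close> although \<open>v\<close> need not.
\<close>

lemma normalizer_expectation_mem:
  assumes v: "v \<in> normalizers D UNIV" and x: "x \<in> A"
  shows "v * expectation (adj v * x) \<in> normalizers D A"
proof (rule normalizer_mult_right)
  show "v * d * adj v \<in> D \<and> adj v * d * v \<in> D" if "d \<in> D" for d
    using v that by (simp add: normalizers_def)
  define y where "y = adj v * x"
  have "v * expectation y \<in> closure A"
    unfolding closure_approachable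
  proof (intro allI impI)
    fix \<delta> :: real assume \<delta>: "\<delta> > 0"
    define \<epsilon> where "\<epsilon> = \<delta> / (norm v + 1)"
    have pos: "norm v + 1 > 0"
      by (simp add: add_nonneg_pos)
    then have "\<epsilon> > 0"
      using \<delta> by (simp add: \<epsilon>_def)
    then obtain I :: "'a set" and g where I: "finite I"
      and g: "\<And>i. i \<in> I \<Longrightarrow> g i \<in> D" "\<And>i. i \<in> I \<Longrightarrow> adj (g i) = g i" "(\<Sum>i\<in>I. g i * g i) = 1"
      and approx: "norm ((\<Sum>i\<in>I. g i * y * g i) - expectation y) \<le> \<epsilon>"
      by (rule expectation_averaging[where y = y]) blast
    have "v * (\<Sum>i\<in>I. g i * y * g i) = (\<Sum>i\<in>I. (v * g i * adj v) * (x * g i))"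
      by (simp add: y_def sum_distrib_left mult.assoc)
    also have "\<dots> \<in> A"
    proof (rule A_sum)
      fix i assume "i \<in> I"
      then have "v * g i * adj v \<in> D" "g i \<in> D"
        using v g(1) by (auto simp: normalizers_def)
      then show "(v * g i * adj v) * (x * g i) \<in> A"
        using A_mult[OF A_D A_mult[OF x A_D]] by blast
    qed
    finally have mem: "v * (\<Sum>i\<in>I. g i * y * g i) \<in> A" .
    have "dist (v * (\<Sum>i\<in>I. g i * y * g i)) (v * expectation y) \<le> norm v * \<epsilon>"
      unfolding dist_norm right_diff_distrib[symmetric]
      using approx by (intro order_trans[OF norm_mult_ineq] mult_left_mono) auto
    also have "\<dots> < \<delta>"
      using \<delta> pos by (simp add: \<epsilon>_def field_simps)
    finally show "\<exists>z\<in>A. dist z (v * expectation y) < \<delta>"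
      using mem by blast
  qed
  then show "v * expectation (adj v * x) \<in> A"
    using A_closed by (simp add: y_def)
qed simp

text \<open>
  An extension \<open>\<psi>\<close> of \<open>\<phi>\<close> to the whole algebra is nonzero at some normalizer \<open>v\<close>, as normalizers span a dense
  subspace. If \<open>\<phi>(x) \<noteq> 0\<close>, then \<open>v E(v\<^sup>* x)\<close> is a normalizer in \<open>A\<close>, and its value \<open>\<rho>(v\<^sup>* v) \<phi>(x)\<close> is nonzero.
\<close>

lemma normalizer_seen:
  assumes \<phi>: "\<phi> \<in> eigenfunctionals1 D A"
  obtains v where "v \<in> normalizers D A" "\<phi> v \<noteq> 0"
proof -
  interpret U: regular_sub D UNIV
    by (rule regular_sub_UNIV[OF regular])
  have fn: "functional_norm A \<phi> = 1" and e: "eigen \<phi> (eig_range D A \<phi>) (eig_source D A \<phi>)"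
    using \<phi> eigenfunctionals1_iff by auto
  define \<rho> where "\<rho> = eig_source D A \<phi>"
  obtain \<psi> where \<psi>: "U.eigen \<psi> (eig_range D A \<phi>) \<rho>" "\<And>x. x \<in> A \<Longrightarrow> \<psi> x = \<phi> x"
    using eigenfunctional_extension[OF e fn] unfolding \<rho>_def by blast
  note bf = U.eigenD(1)[OF \<psi>(1)] and \<rho> = U.eigenD(3)[OF \<psi>(1)]
  obtain x where x: "x \<in> A" "\<phi> x \<noteq> 0"
    using norm_one_nonzero[OF fn] .
  have "\<exists>v\<in>normalizers D UNIV. \<psi> v \<noteq> 0"
  proof (rule ccontr)
    assume none: "\<not> ?thesis"
    define N where "N = {z. \<psi> z = 0}"
    have "csubspace N"
      by (intro cvs.subspaceI) (auto simp: N_def U.bf_zero[OF bf] U.bf_add[OF bf] U.bf_scaleC[OF bf])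
    then have sub: "cspan (normalizers D UNIV) \<subseteq> N"
      using none by (intro cvs.span_minimal) (auto simp: N_def)
    define K where "K = functional_norm UNIV \<psi>"
    have lip: "cmod (\<psi> z) \<le> K * norm z" for z
      unfolding K_def by (rule functional_norm_bound[OF bf U.A_csubspace]) simp
    have "x \<in> closure (cspan (normalizers D UNIV))"
      using regular by (simp add: regular_inclusion_def)
    then obtain s where s: "\<And>n. s n \<in> cspan (normalizers D UNIV)" "s \<longlonglongrightarrow> x"
      unfolding closure_sequential by blast
    have "(\<lambda>n. K * norm (x - s n)) \<longlonglongrightarrow> K * norm (x - x)"
      by (intro tendsto_intros s(2))
    moreover have "cmod (\<psi> x) \<le> K * norm (x - s n)" for n
      using lip[of "x - s n"] U.bf_diff[OF bf, of x "s n"] sub s(1)[of n] by (auto simp: N_def)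
    ultimately have "cmod (\<psi> x) \<le> 0"
      by (intro LIMSEQ_le_const[of "\<lambda>n. K * norm (x - s n)"]) auto
    then show False
      using \<psi>(2)[OF x(1)] x(2) by simp
  qed
  then obtain v where v: "v \<in> normalizers D UNIV" "\<psi> v \<noteq> 0"
    by blast
  define w where "w = v * expectation (adj v * x)"
  have w: "w \<in> normalizers D A"
    unfolding w_def by (rule normalizer_expectation_mem[OF v(1) x(1)])
  have "\<psi> w = \<psi> v * ext_state \<rho> (adj v * x)"
    using U.eigenD(5)[OF \<psi>(1), of "expectation (adj v * x)" v] char_expectation[OF \<rho>] by (simp add: w_def)
  also have "\<dots> = \<rho> (adj v * v) * \<psi> x"
    by (rule eigen_expectation[OF \<psi>(1) v])
  also have "\<dots> \<noteq> 0"
    using U.eigen_normalizer_pos[OF \<psi>(1) v] x \<psi>(2)[OF x(1)] by auto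
  finally have "\<phi> w \<noteq> 0"
    using \<psi>(2) normalizerD(1)[OF w] by simp
  then show thesis
    using that w by blast
qed

subsection \<open>The functionals \<open>[v, \<rho>]\<close>\<close>

lemma char_state_normalizer:
  assumes v: "v \<in> normalizers D A" and \<rho>: "\<rho> \<in> characters D"
  shows "char_state D \<rho> (adj v * v) = of_real (Re (\<rho> (adj v * v)))"
    and "0 < char_state D \<rho> (adj v * v) \<longleftrightarrow> 0 < Re (\<rho> (adj v * v))"
proof -
  have "\<rho> (adj v * v) = of_real (Re (\<rho> (adj v * v)))"
    using normalizerD(4)[OF v] by (intro char_herm_real[OF \<rho>]) (auto simp: adj_mult adj_adj)
  then show "char_state D \<rho> (adj v * v) = of_real (Re (\<rho> (adj v * v)))"
    using ext_state(2)[OF \<rho> normalizerD(4)[OF v]] by (simp add: char_state_eq[OF \<rho>])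
  then show "0 < char_state D \<rho> (adj v * v) \<longleftrightarrow> 0 < Re (\<rho> (adj v * v))"
    by (simp add: less_complex_def)
qed

context
  fixes v \<rho> and \<alpha> :: real
  assumes v: "v \<in> normalizers D A" and \<rho>: "\<rho> \<in> characters D"
    and \<alpha>: "0 < \<alpha>" "\<rho> (adj v * v) = of_real \<alpha>"
begin

lemma ext_vv: "ext_state \<rho> (adj v * v) = of_real \<alpha>"
  using ext_state(2)[OF \<rho> normalizerD(4)[OF v]] \<alpha> by simp

lemma coord_apply: "x \<in> A \<Longrightarrow> coord D A v \<rho> x = ext_state \<rho> (adj v * x) / of_real (sqrt \<alpha>)"
  using \<alpha> by (simp add: coord_def char_state_eq[OF \<rho>] ext_vv)

lemma coord_self: "coord D A v \<rho> v = of_real (sqrt \<alpha>)"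
  using \<alpha> normalizerD(1)[OF v]
  by (simp add: coord_apply ext_vv real_div_sqrt flip: of_real_divide)

lemma coord_norm_le:
  assumes x: "x \<in> A"
  shows "cmod (coord D A v \<rho> x) \<le> norm x"
proof -
  have "(cmod (ext_state \<rho> (adj v * x)))\<^sup>2 \<le> Re (ext_state \<rho> (adj x * x)) * \<alpha>"
    using ext_cauchy_schwarz[OF \<rho>, of v x] by (simp add: ext_vv)
  also have "Re (ext_state \<rho> (adj x * x)) \<le> (norm x)\<^sup>2"
    using ext_norm_le[OF \<rho>, of "adj x * x"] abs_Re_le_cmod[of "ext_state \<rho> (adj x * x)"]
    by (simp add: cstar_identity)
  then have "Re (ext_state \<rho> (adj x * x)) * \<alpha> \<le> (norm x * sqrt \<alpha>)\<^sup>2"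
    using \<alpha> by (simp add: power_mult_distrib mult_right_mono)
  finally have "cmod (ext_state \<rho> (adj v * x)) \<le> norm x * sqrt \<alpha>"
    by (rule power2_le_imp_le) (use \<alpha> in simp)
  then show ?thesis
    using \<alpha> x by (simp add: coord_apply norm_divide divide_le_eq)
qed

lemma coord_bounded: "coord D A v \<rho> \<in> bounded_functionals A"
proof (rule bounded_functionalsI)
  show "coord D A v \<rho> \<in> extensional A"
    by (simp add: coord_def)
  show "clinear_on A (coord D A v \<rho>)"
    unfolding clinear_on_def
    by (auto simp: coord_apply A_add A_scaleC distrib_left mult_scaleC_right ext_add[OF \<rho>] ext_scaleC[OF \<rho>]
        scaleC_complex_def add_divide_distrib)
  show "cmod (coord D A v \<rho> x) \<le> 1 * norm x" if "x \<in> A" for x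
    using coord_norm_le[OF that] by simp
qed

text \<open>
  The norm is attained at a multiple of \<open>v h\<close>, where \<open>h \<in> D\<close> cuts \<open>v\<close> down to the norm \<open>\<rho>(v\<^sup>* v)\<^bsup>1/2\<^esup>\<close> while
  \<open>\<rho>(h) = 1\<close>.
\<close>

lemma coord_norm: "functional_norm A (coord D A v \<rho>) = 1"
proof (rule antisym)
  show "functional_norm A (coord D A v \<rho>) \<le> 1"
    by (rule functional_norm_le) (use A_zero coord_norm_le in \<open>auto intro: order_trans\<close>)
  have a: "adj v * v \<in> D" "pos (adj v * v)"
    using normalizerD(4)[OF v] pos_adj_mult by auto
  obtain h where h: "h \<in> D" "adj h = h" "\<rho> h = 1" "norm (h * (adj v * v) * h) \<le> \<alpha>"
    using peak_element[OF \<rho> a \<alpha>(2,1)] .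
  define x where "x = (1 / sqrt \<alpha>) *\<^sub>R (v * h)"
  have x: "x \<in> A"
    using A_scaleC[OF A_mult[OF normalizerD(1)[OF v] A_D[OF h(1)]], of "of_real (1 / sqrt \<alpha>)"]
    by (simp only: x_def scaleC_of_real)
  have "(norm (v * h))\<^sup>2 \<le> \<alpha>"
    using norm_mult_herm_square[OF h(2), of v] h(4) by simp
  then have "norm (v * h) \<le> sqrt \<alpha>"
    by (rule real_le_rsqrt)
  then have "norm x \<le> 1"
    using \<alpha> by (simp add: x_def)
  moreover have "ext_state \<rho> (adj v * (v * h)) = of_real \<alpha>"
    using ext_mult_right[OF \<rho> h(1), of "adj v * v"] h by (simp add: ext_vv mult.assoc)
  then have "coord D A v \<rho> x = of_real (1 / sqrt \<alpha>) * of_real \<alpha> / of_real (sqrt \<alpha>)"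
    using x by (simp add: coord_apply) (simp add: x_def ext_scaleR[OF \<rho>])
  then have "coord D A v \<rho> x = 1"
    using \<alpha> by (simp flip: of_real_mult of_real_divide)
  ultimately show "1 \<le> functional_norm A (coord D A v \<rho>)"
    using functional_norm_ge[OF coord_bounded A_csubspace x] by simp
qed

text \<open>
  As \<open>v v\<^sup>*\<close> commutes with \<open>d\<close>, the products \<open>(v\<^sup>* v)(v\<^sup>* d x)\<close> and \<open>(v\<^sup>* d v)(v\<^sup>* x)\<close> agree.
\<close>

lemma ext_conj_left:
  assumes d: "d \<in> D"
  shows "ext_state \<rho> (adj v * d * x) * of_real \<alpha> = \<rho> (adj v * d * v) * ext_state \<rho> (adj v * x)"
proof -
  note vD = normalizerD[OF v]
  have "(adj v * v) * (adj v * d * x) = adj v * ((v * adj v) * d) * x"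
    by (simp add: mult.assoc)
  also have "(v * adj v) * d = d * (v * adj v)"
    using vD(5) d by (rule commute)
  finally have eq: "(adj v * v) * (adj v * d * x) = (adj v * d * v) * (adj v * x)"
    by (simp add: mult.assoc)
  have "ext_state \<rho> (adj v * d * x) * of_real \<alpha> = ext_state \<rho> ((adj v * v) * (adj v * d * x))"
    using ext_mult_left[OF \<rho> vD(4)] \<alpha> by (simp add: mult.commute)
  then show ?thesis
    unfolding eq using ext_mult_left[OF \<rho> vD(3)[OF d]] by simp
qed

text \<open>
  The left transformation rule is recorded for all \<open>x\<close> of the surrounding algebra and not only for \<open>x \<in> A\<close>,
  because products of coordinates lead to elements such as \<open>v\<^sup>* y w\<close> with arbitrary \<open>y\<close>.
\<close>

lemma coord_eigen:
  obtains \<sigma> where "eigen (coord D A v \<rho>) \<sigma> \<rho>"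
    "\<And>d x. d \<in> D \<Longrightarrow> ext_state \<rho> (adj v * d * x) = \<sigma> d * ext_state \<rho> (adj v * x)"
proof -
  have left: "coord D A v \<rho> (d * x) = (\<rho> (adj v * d * v) / of_real \<alpha>) * coord D A v \<rho> x"
    if "d \<in> D" "x \<in> A" for d x
    using ext_conj_left[OF that(1), of x] that A_mult A_D \<alpha> by (simp add: coord_apply mult.assoc field_simps)
  have right: "coord D A v \<rho> (x * d) = \<rho> d * coord D A v \<rho> x" if "d \<in> D" "x \<in> A" for d x
    using ext_mult_right[OF \<rho> that(1), of "adj v * x"] that A_mult A_D
    by (simp add: coord_apply mult.assoc)
  have E1: "coord D A v \<rho> \<in> eigenfunctionals1 D A"
    using coord_bounded coord_norm left right unfolding eigenfunctionals1_def by blast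
  then obtain \<sigma> \<tau> where e: "eigen (coord D A v \<rho>) \<sigma> \<tau>"
    by (rule eigenfunctional_eigen)
  have vA: "v \<in> A"
    by (rule normalizerD(1)[OF v])
  have nz: "coord D A v \<rho> v \<noteq> 0"
    using \<alpha> by (simp add: coord_self)
  have "\<tau> = \<rho>"
  proof (rule extensionalityI[of _ D])
    show "\<tau> \<in> extensional D" "\<rho> \<in> extensional D"
      using \<rho> eigenD(3)[OF e] by (auto simp: characters_def)
    fix d assume d: "d \<in> D"
    show "\<tau> d = \<rho> d"
      using eigenD(5)[OF e d vA] right[OF d vA] nz by simp
  qed
  moreover have "ext_state \<rho> (adj v * d * x) = \<sigma> d * ext_state \<rho> (adj v * x)" if d: "d \<in> D" for d x
  proof -
    have "\<sigma> d * coord D A v \<rho> v = (\<rho> (adj v * d * v) / of_real \<alpha>) * coord D A v \<rho> v"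
      by (rule trans[OF eigenD(4)[OF e d vA, symmetric] left[OF d vA]])
    then have "\<sigma> d = \<rho> (adj v * d * v) / of_real \<alpha>"
      using nz mult_right_cancel by blast
    moreover have "ext_state \<rho> (adj v * d * x) = \<rho> (adj v * d * v) / of_real \<alpha> * ext_state \<rho> (adj v * x)"
      using ext_conj_left[OF d, of x] \<alpha> by (simp add: eq_divide_eq)
    ultimately show ?thesis
      by (simp only:)
  qed
  ultimately show thesis
    using that e by blast
qed

lemma coord_mem: "coord D A v \<rho> \<in> eigenfunctionals1 D A" and coord_source: "eig_source D A (coord D A v \<rho>) = \<rho>"
proof -
  obtain \<sigma> where e: "eigen (coord D A v \<rho>) \<sigma> \<rho>"
    using coord_eigen by metis
  show "coord D A v \<rho> \<in> eigenfunctionals1 D A" "eig_source D A (coord D A v \<rho>) = \<rho>"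
    by (rule eigenfunctionals1I[OF e coord_norm])+
qed

lemma coord_range_left:
  assumes "d \<in> D"
  shows "ext_state \<rho> (adj v * d * x) = eig_range D A (coord D A v \<rho>) d * ext_state \<rho> (adj v * x)"
proof -
  obtain \<sigma> where "eigen (coord D A v \<rho>) \<sigma> \<rho>"
    and \<sigma>: "\<And>d x. d \<in> D \<Longrightarrow> ext_state \<rho> (adj v * d * x) = \<sigma> d * ext_state \<rho> (adj v * x)"
    by (rule coord_eigen) blast
  then have "eig_range D A (coord D A v \<rho>) = \<sigma>"
    using eigenfunctionals1I(2)[OF _ coord_norm] by blast
  then show ?thesis
    using \<sigma> assms by simp
qed

end

text \<open>
  By the averaging identity \<open>\<phi>(v) \<rho>(v\<^sup>* x) = \<rho>(v\<^sup>* v) \<phi>(x)\<close> the functional \<open>\<phi>\<close> is a multiple of \<open>[v, \<rho>]\<close>. Both have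
  norm one and both are positive at \<open>v\<close>, so they coincide.
\<close>

lemma eigenfunctional_is_coord:
  assumes \<phi>: "\<phi> \<in> eigenfunctionals1 D A" and v: "v \<in> normalizers D A" and pos: "0 < \<phi> v"
  shows "\<phi> = coord D A v (eig_source D A \<phi>)"
    and "eig_source D A \<phi> (adj v * v) = of_real ((cmod (\<phi> v))\<^sup>2)"
proof -
  define \<rho> where "\<rho> = eig_source D A \<phi>"
  have fn: "functional_norm A \<phi> = 1" and e: "eigen \<phi> (eig_range D A \<phi>) \<rho>"
    using \<phi> eigenfunctionals1_iff by (auto simp: \<rho>_def)
  note \<rho> = eigenD(3)[OF e] and bf = eigenD(1)[OF e]
  define s where "s = Re (\<phi> v)"
  have s: "\<phi> v = of_real s" "s > 0"
    using pos by (auto simp: s_def less_complex_def complex_eq_iff)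
  then have nz: "\<phi> v \<noteq> 0"
    by simp
  define \<alpha> where "\<alpha> = Re (\<rho> (adj v * v))"
  have \<alpha>: "0 < \<alpha>" "\<rho> (adj v * v) = of_real \<alpha>"
    using eigen_normalizer_pos[OF e v nz] by (simp_all add: \<alpha>_def)
  obtain \<psi> where \<psi>: "regular_sub.eigen D UNIV \<psi> (eig_range D A \<phi>) \<rho>" "\<And>x. x \<in> A \<Longrightarrow> \<psi> x = \<phi> x"
    using eigenfunctional_extension[OF e fn] by blast
  have eq: "\<phi> x = of_real (s / sqrt \<alpha>) * coord D A v \<rho> x" if x: "x \<in> A" for x
  proof -
    have "of_real s * ext_state \<rho> (adj v * x) = of_real \<alpha> * \<phi> x"
      using eigen_expectation[OF \<psi>(1), of v x] \<psi>(2)[OF x] \<psi>(2)[OF normalizerD(1)[OF v]] v nz \<alpha> s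
      by (simp add: normalizers_def)
    then have "\<phi> x = of_real s * ext_state \<rho> (adj v * x) / of_real \<alpha>"
      using \<alpha> by (simp add: field_simps)
    also have "complex_of_real \<alpha> = of_real (sqrt \<alpha>) * of_real (sqrt \<alpha>)"
      using \<alpha> by (simp flip: of_real_mult)
    finally show ?thesis
      using x by (simp add: coord_apply[OF v \<rho> \<alpha>])
  qed
  have "s / sqrt \<alpha> = 1"
  proof -
    have c: "s / sqrt \<alpha> > 0"
      using s \<alpha> by simp
    have "functional_norm A \<phi> \<le> s / sqrt \<alpha>"
    proof (rule functional_norm_le[OF A_zero])
      fix x assume x: "x \<in> A" "norm x \<le> 1"
      have "cmod (\<phi> x) = s / sqrt \<alpha> * cmod (coord D A v \<rho> x)"
        using c unfolding eq[OF x(1)] by (simp only: norm_mult norm_of_real abs_of_pos)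
      also have "\<dots> \<le> s / sqrt \<alpha> * 1"
        using c coord_norm_le[OF v \<rho> \<alpha> x(1)] x(2) by (intro mult_left_mono) auto
      finally show "cmod (\<phi> x) \<le> s / sqrt \<alpha>"
        by simp
    qed
    moreover have "functional_norm A (coord D A v \<rho>) \<le> sqrt \<alpha> / s"
    proof (rule functional_norm_le[OF A_zero])
      fix x assume x: "x \<in> A" "norm x \<le> 1"
      have "cmod (\<phi> x) = s / sqrt \<alpha> * cmod (coord D A v \<rho> x)"
        using c unfolding eq[OF x(1)] by (simp only: norm_mult norm_of_real abs_of_pos)
      moreover have "cmod (\<phi> x) \<le> 1"
        using functional_norm_ge[OF bf A_csubspace x] fn by simp
      ultimately have "s / sqrt \<alpha> * cmod (coord D A v \<rho> x) \<le> 1"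
        by (simp only:)
      then show "cmod (coord D A v \<rho> x) \<le> sqrt \<alpha> / s"
        using s(2) \<alpha>(1) by (simp add: field_simps)
    qed
    ultimately have "1 \<le> s / sqrt \<alpha>" "1 \<le> sqrt \<alpha> / s"
      using fn coord_norm[OF v \<rho> \<alpha>] by simp_all
    then show ?thesis
      using s \<alpha> by (simp add: field_simps)
  qed
  then show "\<phi> = coord D A v (eig_source D A \<phi>)"
    using eq bf_extensional[OF bf] unfolding \<rho>_def[symmetric]
    by (intro extensionalityI[of _ A]) (auto simp: coord_def)
  have "s = sqrt \<alpha>"
    using \<open>s / sqrt \<alpha> = 1\<close> \<alpha> by (simp add: divide_eq_1_iff)
  then show "eig_source D A \<phi> (adj v * v) = of_real ((cmod (\<phi> v))\<^sup>2)"
    using \<alpha> s by (simp add: \<rho>_def[symmetric])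
qed

lemma eigenfunctional_coord_ex:
  assumes \<phi>: "\<phi> \<in> eigenfunctionals1 D A"
  obtains v where "v \<in> normalizers D A" "0 < \<phi> v"
proof -
  have bf: "\<phi> \<in> bounded_functionals A"
    using \<phi> by (simp add: eigenfunctionals1_def)
  obtain v where v: "v \<in> normalizers D A" "\<phi> v \<noteq> 0"
    using normalizer_seen[OF \<phi>] .
  have "\<phi> (cnj (\<phi> v) *\<^sub>C v) = of_real ((cmod (\<phi> v))\<^sup>2)"
    using bf_scaleC[OF bf normalizerD(1)[OF v(1)]] by (simp only: complex_norm_square mult.commute)
  then have "0 < \<phi> (cnj (\<phi> v) *\<^sub>C v)"
    using v by (simp add: less_complex_def)
  then show thesis
    using that normalizer_scaleC[OF v(1)] by blast
qed

subsection \<open>The partial product\<close>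

text \<open>
  When the source of \<open>[v\<^sub>1, \<rho>\<^sub>1]\<close> is the range of \<open>[v\<^sub>2, \<rho>\<^sub>2]\<close>, the functional \<open>y \<mapsto> \<rho>\<^sub>2(v\<^sub>2\<^sup>* y w\<^sub>2)\<close> transforms on both
  sides under \<open>\<rho>\<^sub>1\<close>, so by averaging it is a multiple of \<open>\<rho>\<^sub>1\<close>.
\<close>

lemma ext_state_sandwich:
  assumes v: "v \<in> normalizers D A" "\<rho> \<in> characters D" "0 < \<alpha>" "\<rho> (adj v * v) = of_real \<alpha>"
    and w: "w \<in> normalizers D A" "0 < \<beta>" "\<rho> (adj w * w) = of_real \<beta>"
    and same: "coord D A v \<rho> = coord D A w \<rho>" and \<tau>: "eig_range D A (coord D A v \<rho>) = \<tau>"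
  shows "ext_state \<rho> (adj v * y * w) = ext_state \<tau> y * ext_state \<rho> (adj v * w)"
proof -
  have \<rho>: "\<rho> \<in> characters D"
    by fact
  have \<tau>_char: "\<tau> \<in> characters D"
    using coord_mem[OF v] eigenfunctionals1_iff \<tau> eigenD(2) by metis
  have left: "ext_state \<rho> (adj v * (d * z) * w) = \<tau> d * ext_state \<rho> (adj v * z * w)" if "d \<in> D" for d z
    using coord_range_left[OF v that, of "z * w"] \<tau> by (simp add: mult.assoc)
  have right: "ext_state \<rho> (adj v * (z * d) * w) = \<tau> d * ext_state \<rho> (adj v * z * w)" if d: "d \<in> D" for d z
  proof -
    have "ext_state \<rho> (adj w * adj d * (adj z * v)) = \<tau> (adj d) * ext_state \<rho> (adj w * (adj z * v))"
      using coord_range_left[OF w(1) \<rho> w(2,3), of "adj d" "adj z * v"] d \<tau> same by simp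
    then have "ext_state \<rho> (adj (adj v * (z * d) * w)) = cnj (\<tau> d) * ext_state \<rho> (adj (adj v * z * w))"
      using char_adj[OF \<tau>_char d] by (simp add: adj_mult adj_adj mult.assoc)
    then have "cnj (ext_state \<rho> (adj v * (z * d) * w)) = cnj (\<tau> d * ext_state \<rho> (adj v * z * w))"
      by (simp only: ext_adj[OF \<rho>] complex_cnj_mult)
    then show ?thesis
      by (simp only: complex_cnj_cancel_iff)
  qed
  have "ext_state \<rho> (adj v * expectation y * w) = ext_state \<rho> (adj v * y * w)"
  proof (rule functional_expectation[OF \<tau>_char])
    show "clinear_on UNIV (\<lambda>z. ext_state \<rho> (adj v * z * w))"
      by (simp add: clinear_on_def scaleC_complex_def distrib_left distrib_right mult_scaleC_left
          mult_scaleC_right ext_add[OF \<rho>] ext_scaleC[OF \<rho>])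
    show "cmod (ext_state \<rho> (adj v * z * w)) \<le> (norm v * norm w) * norm z" for z
    proof -
      have "norm (adj v * z * w) \<le> (norm v * norm z) * norm w"
        using norm_mult_ineq[of "adj v" z]
        by (intro order_trans[OF norm_mult_ineq] mult_right_mono) auto
      then show ?thesis
        using ext_norm_le[OF \<rho>, of "adj v * z * w"] by (simp add: mult_ac)
    qed
    show "ext_state \<rho> (adj v * (g * y * g) * w) = \<tau> (g * g) * ext_state \<rho> (adj v * y * w)" if g: "g \<in> D" for g
      using right[OF g, of "g * y"] left[OF g, of y] char_mult[OF \<tau>_char g g] by simp
  qed
  moreover have "ext_state \<rho> (adj v * expectation y * w) = ext_state \<tau> y * ext_state \<rho> (adj v * w)"
    using left[OF expectation_mem, of y 1] char_expectation[OF \<tau>_char, of y] by simp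
  ultimately show ?thesis
    by simp
qed

text \<open>
  The product is independent of the chosen normalizers: if \<open>[v\<^sub>1, \<rho>\<^sub>1] = [w\<^sub>1, \<rho>\<^sub>1]\<close> and \<open>[v\<^sub>2, \<rho>\<^sub>2] = [w\<^sub>2, \<rho>\<^sub>2]\<close>, then
  \<open>[v\<^sub>1 v\<^sub>2, \<rho>\<^sub>2]\<close> takes a positive multiple of \<open>\<rho>\<^sub>1(v\<^sub>1\<^sup>* w\<^sub>1) \<rho>\<^sub>2(v\<^sub>2\<^sup>* w\<^sub>2) > 0\<close> as its value at \<open>w\<^sub>1 w\<^sub>2\<close>, and an
  eigenfunctional is determined by its source and a normalizer at which it is positive.
\<close>

lemma eig_mult_coord:
  assumes v1: "v1 \<in> normalizers D A" and \<rho>1: "\<rho>1 \<in> characters D" and \<alpha>1: "0 < char_state D \<rho>1 (adj v1 * v1)"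
    and v2: "v2 \<in> normalizers D A" and \<rho>2: "\<rho>2 \<in> characters D" and \<alpha>2: "0 < char_state D \<rho>2 (adj v2 * v2)"
    and comp: "eig_range D A (coord D A v2 \<rho>2) = \<rho>1"
  shows "eig_mult D A (coord D A v1 \<rho>1) (coord D A v2 \<rho>2) = coord D A (v1 * v2) \<rho>2"
    and "0 < char_state D \<rho>2 (adj (v1 * v2) * (v1 * v2))"
proof -
  define a1 where "a1 = Re (\<rho>1 (adj v1 * v1))"
  define a2 where "a2 = Re (\<rho>2 (adj v2 * v2))"
  have real: "\<rho> (adj v * v) = of_real (Re (\<rho> (adj v * v)))" if "v \<in> normalizers D A" "\<rho> \<in> characters D" for v \<rho>
    using that normalizerD(4) by (intro char_herm_real) (auto simp: adj_mult adj_adj)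
  have a1: "0 < a1" "\<rho>1 (adj v1 * v1) = of_real a1" and a2: "0 < a2" "\<rho>2 (adj v2 * v2) = of_real a2"
    using \<alpha>1 \<alpha>2 real v1 v2 \<rho>1 \<rho>2 by (simp_all add: a1_def a2_def char_state_normalizer(2))
  have prod_pos: "0 < ext_state \<rho>2 (adj (v1 * v2) * (w1 * w2))"
    if w: "w1 \<in> normalizers D A" "w2 \<in> normalizers D A" "0 < Re (\<rho>1 (adj w1 * w1))" "0 < Re (\<rho>2 (adj w2 * w2))"
      and eq: "coord D A v1 \<rho>1 = coord D A w1 \<rho>1" "coord D A v2 \<rho>2 = coord D A w2 \<rho>2" for w1 w2
  proof -
    have pos: "0 < ext_state \<rho> (adj v * w)"
      if "v \<in> normalizers D A" "\<rho> \<in> characters D" "0 < a" "\<rho> (adj v * v) = of_real a" "w \<in> normalizers D A"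
        "0 < Re (\<rho> (adj w * w))" "coord D A v \<rho> = coord D A w \<rho>" for v w \<rho> a
    proof -
      have "ext_state \<rho> (adj v * w) / of_real (sqrt a) = of_real (sqrt (Re (\<rho> (adj w * w))))"
        using coord_apply[OF that(1-4) normalizerD(1)[OF that(5)]]
          coord_self[OF that(5,2,6) real[OF that(5,2)]] that(7) by simp
      then have "ext_state \<rho> (adj v * w) = of_real (sqrt (Re (\<rho> (adj w * w))) * sqrt a)"
        using that(3) by (simp add: field_simps)
      then show ?thesis
        using that(3,6) by (simp add: less_complex_def)
    qed
    have "adj (v1 * v2) * (w1 * w2) = adj v2 * (adj v1 * w1) * w2"
      by (simp add: adj_mult mult.assoc)
    moreover have "ext_state \<rho>2 (adj v2 * (adj v1 * w1) * w2)
        = ext_state \<rho>1 (adj v1 * w1) * ext_state \<rho>2 (adj v2 * w2)"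
      using ext_state_sandwich[OF v2 \<rho>2 a2 w(2,4) real[OF w(2) \<rho>2] eq(2) comp] .
    moreover have "0 < ext_state \<rho>1 (adj v1 * w1)" "0 < ext_state \<rho>2 (adj v2 * w2)"
      using pos[OF v1 \<rho>1 a1 w(1,3) eq(1)] pos[OF v2 \<rho>2 a2 w(2,4) eq(2)] by auto
    ultimately show ?thesis
      by (simp add: less_complex_def)
  qed
  have v12: "v1 * v2 \<in> normalizers D A"
    using v1 v2 by (rule normalizer_mult)
  have "0 < ext_state \<rho>2 (adj (v1 * v2) * (v1 * v2))"
    using v1 v2 a1 a2 by (intro prod_pos) auto
  then show pos12: "0 < char_state D \<rho>2 (adj (v1 * v2) * (v1 * v2))"
    by (simp add: char_state_eq[OF \<rho>2])
  define a where "a = Re (\<rho>2 (adj (v1 * v2) * (v1 * v2)))"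
  have a: "0 < a" "\<rho>2 (adj (v1 * v2) * (v1 * v2)) = of_real a"
    using pos12 real[OF v12 \<rho>2] char_state_normalizer(2)[OF v12 \<rho>2] by (simp_all add: a_def)
  show "eig_mult D A (coord D A v1 \<rho>1) (coord D A v2 \<rho>2) = coord D A (v1 * v2) \<rho>2"
    unfolding eig_mult_def
  proof (rule the_equality)
    show "\<exists>v1'\<in>normalizers D A. \<exists>v2'\<in>normalizers D A. \<exists>\<rho>1'\<in>characters D. \<exists>\<rho>2'\<in>characters D.
       0 < char_state D \<rho>1' (adj v1' * v1') \<and> coord D A v1 \<rho>1 = coord D A v1' \<rho>1' \<and>
       0 < char_state D \<rho>2' (adj v2' * v2') \<and> coord D A v2 \<rho>2 = coord D A v2' \<rho>2' \<and>
       coord D A (v1 * v2) \<rho>2 = coord D A (v1' * v2') \<rho>2'"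
      using assms by blast
  next
    fix \<psi>
    assume "\<exists>v1'\<in>normalizers D A. \<exists>v2'\<in>normalizers D A. \<exists>\<rho>1'\<in>characters D. \<exists>\<rho>2'\<in>characters D.
       0 < char_state D \<rho>1' (adj v1' * v1') \<and> coord D A v1 \<rho>1 = coord D A v1' \<rho>1' \<and>
       0 < char_state D \<rho>2' (adj v2' * v2') \<and> coord D A v2 \<rho>2 = coord D A v2' \<rho>2' \<and>
       \<psi> = coord D A (v1' * v2') \<rho>2'"
    then obtain w1 w2 \<tau>1 \<tau>2 where w: "w1 \<in> normalizers D A" "w2 \<in> normalizers D A"
      and \<tau>: "\<tau>1 \<in> characters D" "\<tau>2 \<in> characters D"
      and pos: "0 < char_state D \<tau>1 (adj w1 * w1)" "0 < char_state D \<tau>2 (adj w2 * w2)"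
      and eq: "coord D A v1 \<rho>1 = coord D A w1 \<tau>1" "coord D A v2 \<rho>2 = coord D A w2 \<tau>2"
      and \<psi>: "\<psi> = coord D A (w1 * w2) \<tau>2"
      by blast
    have b: "0 < Re (\<tau>1 (adj w1 * w1))" "0 < Re (\<tau>2 (adj w2 * w2))"
      using pos w \<tau> by (simp_all add: char_state_normalizer(2))
    have same: "\<tau>1 = \<rho>1" "\<tau>2 = \<rho>2"
      using coord_source[OF v1 \<rho>1 a1] coord_source[OF v2 \<rho>2 a2] eq
        coord_source[OF w(1) \<tau>(1) b(1) real[OF w(1) \<tau>(1)]] coord_source[OF w(2) \<tau>(2) b(2) real[OF w(2) \<tau>(2)]]
      by simp_all
    have w12: "w1 * w2 \<in> normalizers D A"
      using w by (rule normalizer_mult)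
    have "0 < ext_state \<rho>2 (adj (v1 * v2) * (w1 * w2))"
      using prod_pos[OF w] b eq same by simp
    then have "0 < coord D A (v1 * v2) \<rho>2 (w1 * w2)"
      using a by (simp add: coord_apply[OF v12 \<rho>2 a normalizerD(1)[OF w12]] less_complex_def)
    then have "coord D A (v1 * v2) \<rho>2 = coord D A (w1 * w2) (eig_source D A (coord D A (v1 * v2) \<rho>2))"
      by (rule eigenfunctional_is_coord(1)[OF coord_mem[OF v12 \<rho>2 a] w12])
    then show "\<psi> = coord D A (v1 * v2) \<rho>2"
      using coord_source[OF v12 \<rho>2 a] \<psi> same by simp
  qed
qed

end

section \<open>The bounded inverse theorem on closed subspaces\<close>

text \<open>
  By the Baire category theorem the closure of the image of some ball has interior points in \<open>B\<close>. So every
  \<open>y \<in> B\<close> has approximate preimages whose norms are bounded by a multiple of \<open>\<parallel>y\<parallel>\<close>; successive corrections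
  with halved errors produce the exact preimage.
\<close>

theorem bounded_inverse:
  fixes f :: "'a::banach \<Rightarrow> 'b::banach"
  assumes A: "subspace A" "closed A" and B: "subspace B" "closed B"
    and add: "\<And>x y. x \<in> A \<Longrightarrow> y \<in> A \<Longrightarrow> f (x + y) = f x + f y"
    and scale: "\<And>t x. x \<in> A \<Longrightarrow> f (t *\<^sub>R x) = t *\<^sub>R f x"
    and bij: "bij_betw f A B" and bound: "\<And>x. x \<in> A \<Longrightarrow> norm (f x) \<le> K * norm x"
  shows "\<exists>K. \<forall>x\<in>A. norm x \<le> K * norm (f x)"
proof -
  have A_add: "x + y \<in> A" and A_scale: "t *\<^sub>R x \<in> A" and A_diff: "x - y \<in> A" if "x \<in> A" "y \<in> A" for x y t
    using that A(1) by (auto simp: subspace_add subspace_scale subspace_diff)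
  have B_add: "x + y \<in> B" and B_scale: "t *\<^sub>R x \<in> B" and B_diff: "x - y \<in> B" if "x \<in> B" "y \<in> B" for x y t
    using that B(1) by (auto simp: subspace_add subspace_scale subspace_diff)
  have fB: "f x \<in> B" if "x \<in> A" for x
    using bij that by (auto simp: bij_betw_def)
  have diff: "f (x - y) = f x - f y" if "x \<in> A" "y \<in> A" for x y
    using add[of x "(-1) *\<^sub>R y"] scale[of y "-1"] A_scale[of y y "-1"] that by simp
  define F where "F n = closure (f ` {x \<in> A. norm x \<le> real n})" for n
  have FB: "F n \<subseteq> B" for n
    unfolding F_def using B(2) fB by (intro closure_minimal) auto
  have "\<exists>n. top_of_set B interior_of F n \<noteq> {}"
  proof (rule ccontr)
    assume none: "\<not> ?thesis"
    have "top_of_set B interior_of \<Union>(range F) = {}"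
    proof (rule Baire_category_alt)
      show "completely_metrizable_space (top_of_set B) \<or> locally_compact_space (top_of_set B) \<and> regular_space (top_of_set B)"
        using completely_metrizable_space_closedin[OF completely_metrizable_space_euclidean, of B] B(2)
        by simp
      show "closedin (top_of_set B) T \<and> top_of_set B interior_of T = {}" if "T \<in> range F" for T
        using that none FB by (auto simp: F_def intro!: closed_subset)
    qed simp
    moreover have "\<Union>(range F) = B"
    proof
      show "B \<subseteq> \<Union>(range F)"
      proof
        fix y assume "y \<in> B"
        then obtain x where x: "x \<in> A" "y = f x"
          using bij by (auto simp: bij_betw_def)
        obtain n :: nat where "norm x \<le> real n"
          using real_arch_simple by blast
        then have "y \<in> F n"
          using x closure_subset unfolding F_def by fast
        then show "y \<in> \<Union>(range F)"
          by blast
      qed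
    qed (use FB in blast)
    moreover have "top_of_set B interior_of B = B"
      using interior_of_topspace[of "top_of_set B"] by simp
    ultimately show False
      using subspace_0[OF B(1)] by auto
  qed
  then obtain n y0 where "y0 \<in> top_of_set B interior_of F n"
    by blast
  then obtain U where U: "openin (top_of_set B) U" "y0 \<in> U" "U \<subseteq> F n"
    unfolding interior_of_def by blast
  then have "\<exists>r>0. \<forall>y\<in>B. dist y y0 < r \<longrightarrow> y \<in> U"
    unfolding openin_euclidean_subtopology_iff by blast
  then obtain r where r: "r > 0" and ball: "\<And>y. y \<in> B \<Longrightarrow> dist y y0 < r \<Longrightarrow> y \<in> F n"
    using U(3) by blast
  have y0: "y0 \<in> F n" "y0 \<in> B"
    using U FB by auto
  have F_approx: "\<exists>x\<in>A. norm x \<le> real n \<and> norm (y - f x) < \<epsilon>" if "y \<in> F n" "\<epsilon> > 0" for y \<epsilon>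
    using that unfolding F_def closure_approachable by (fastforce simp: dist_norm norm_minus_commute)
  have small: "\<exists>x\<in>A. norm x \<le> 2 * real n \<and> norm (y - f x) < \<epsilon>" if y: "y \<in> B" "norm y < r" and \<epsilon>: "\<epsilon> > 0" for y \<epsilon>
  proof -
    have "y0 + y \<in> F n"
      using ball[of "y0 + y"] B_add[OF y0(2) y(1)] y(2) by (simp add: dist_norm)
    then obtain x1 where x1: "x1 \<in> A" "norm x1 \<le> real n" "norm ((y0 + y) - f x1) < \<epsilon>/2"
      using F_approx[of "y0 + y" "\<epsilon>/2"] \<epsilon> by auto
    obtain x2 where x2: "x2 \<in> A" "norm x2 \<le> real n" "norm (y0 - f x2) < \<epsilon>/2"
      using F_approx[of y0 "\<epsilon>/2"] y0 \<epsilon> by auto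
    have eq: "y - f (x1 - x2) = ((y0 + y) - f x1) - (y0 - f x2)"
      using x1 x2 by (simp add: diff)
    have "norm (y - f (x1 - x2)) < \<epsilon>"
      unfolding eq using norm_triangle_ineq4[of "(y0 + y) - f x1" "y0 - f x2"] x1(3) x2(3) by linarith
    moreover have "norm (x1 - x2) \<le> 2 * real n"
      using norm_triangle_ineq4[of x1 x2] x1(2) x2(2) by simp
    ultimately show ?thesis
      using A_diff[OF x1(1) x2(1)] by blast
  qed
  \<comment> \<open>The element \<open>y\<close> is scaled to norm \<open>r/2\<close>; its approximate preimage of norm at most \<open>2 n\<close> is scaled back.\<close>
  define C where "C = 4 * real n / r"
  have C: "C \<ge> 0"
    using r by (simp add: C_def)
  have step: "\<exists>x\<in>A. norm x \<le> C * norm y \<and> norm (y - f x) < \<epsilon>" if y: "y \<in> B" and \<epsilon>: "\<epsilon> > 0" for y \<epsilon>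
  proof (cases "y = 0")
    case True
    have "f 0 = 0"
      using scale[of 0 0] subspace_0[OF A(1)] by simp
    then show ?thesis
      using True \<epsilon> subspace_0[OF A(1)] by (intro bexI[of _ 0]) auto
  next
    case False
    define t where "t = r / (2 * norm y)"
    have t: "t > 0"
      using False r by (simp add: t_def)
    have "norm (t *\<^sub>R y) < r"
      using False r by (simp add: t_def)
    then obtain x where x: "x \<in> A" "norm x \<le> 2 * real n" "norm (t *\<^sub>R y - f x) < t * \<epsilon>"
      using small[of "t *\<^sub>R y" "t * \<epsilon>"] B_scale[OF y y] t \<epsilon> by auto
    have "y - f ((1/t) *\<^sub>R x) = (1/t) *\<^sub>R (t *\<^sub>R y - f x)"
      using x t by (simp add: scale scaleR_diff_right)
    then have "norm (y - f ((1/t) *\<^sub>R x)) = norm (t *\<^sub>R y - f x) / t"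
      using t by simp
    then have "norm (y - f ((1/t) *\<^sub>R x)) < \<epsilon>"
      using x(3) t by (simp add: divide_less_eq mult.commute)
    moreover have "norm ((1/t) *\<^sub>R x) \<le> C * norm y"
      using x(2) t r False by (simp add: C_def t_def field_simps)
    ultimately show ?thesis
      using A_scale[OF x(1) x(1)] by blast
  qed
  have solve: "\<exists>x\<in>A. f x = y \<and> norm x \<le> 2 * C * norm y" if y: "y \<in> B" "y \<noteq> 0" for y
  proof -
    define P where "P k z \<longleftrightarrow> z \<in> B \<and> norm z \<le> norm y * (1/2) ^ k" for k :: nat and z
    define Q where "Q k z z' \<longleftrightarrow> (\<exists>x\<in>A. norm x \<le> C * norm y * (1/2) ^ k \<and> z' = z - f x)" for k :: nat and z z'
    have "\<exists>Y. \<forall>k. P k (Y k) \<and> Q k (Y k) (Y (Suc k)) \<and> (k = 0 \<longrightarrow> Y k = y)"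
    proof -
      have "\<exists>Y. \<forall>k. (P k (Y k) \<and> (k = 0 \<longrightarrow> Y k = y)) \<and> Q k (Y k) (Y (Suc k))"
      proof (rule dependent_nat_choice)
        show "\<exists>z. P 0 z \<and> ((0::nat) = 0 \<longrightarrow> z = y)"
          using y by (auto simp: P_def)
        fix z k assume "P k z \<and> (k = 0 \<longrightarrow> z = y)"
        then have z: "z \<in> B" "norm z \<le> norm y * (1/2) ^ k"
          by (auto simp: P_def)
        obtain x where x: "x \<in> A" "norm x \<le> C * norm z" "norm (z - f x) < norm y * (1/2) ^ Suc k"
          using step[OF z(1), of "norm y * (1/2) ^ Suc k"] y by auto
        have "norm x \<le> C * norm y * (1/2) ^ k"
          using x(2) mult_left_mono[OF z(2) C] by (simp add: mult.assoc)
        then have "Q k z (z - f x)"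
          using x(1) by (auto simp: Q_def)
        moreover have "P (Suc k) (z - f x)"
          using x z B_diff[OF z(1) fB[OF x(1)]] by (simp add: P_def)
        ultimately show "\<exists>z'. (P (Suc k) z' \<and> (Suc k = 0 \<longrightarrow> z' = y)) \<and> Q k z z'"
          by blast
      qed
      then show ?thesis
        by blast
    qed
    then obtain Y where Y: "\<And>k. P k (Y k)" "\<And>k. Q k (Y k) (Y (Suc k))" "Y 0 = y"
      by blast
    from Y(2) obtain X where X: "\<And>k. X k \<in> A" "\<And>k. norm (X k) \<le> C * norm y * (1/2) ^ k" "\<And>k. Y (Suc k) = Y k - f (X k)"
      unfolding Q_def by metis
    have sum_A: "(\<Sum>k<m. X k) \<in> A" for m
      using X(1) A(1) by (intro subspace_sum)
    have f_sum: "f (\<Sum>k<m. X k) = y - Y m" for m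
    proof (induction m)
      case 0
      then show ?case
        using scale[of 0 0] subspace_0[OF A(1)] by (simp add: Y(3))
    next
      case (Suc m)
      then show ?case
        using add[OF sum_A X(1)] by (simp add: X(3))
    qed
    have geom: "summable (\<lambda>k. C * norm y * (1/2) ^ k)"
      by (intro summable_mult summable_geometric) simp
    have X_summable: "summable (\<lambda>k. norm (X k))"
      by (rule summable_comparison_test[OF _ geom]) (use X(2) in auto)
    define x where "x = suminf X"
    have lim: "(\<lambda>m. \<Sum>k<m. X k) \<longlonglongrightarrow> x"
      unfolding x_def by (rule summable_LIMSEQ[OF summable_norm_cancel[OF X_summable]])
    have xA: "x \<in> A"
      using closed_sequentially[OF A(2) _ lim] sum_A by blast
    have "norm x \<le> (\<Sum>k. norm (X k))"
      unfolding x_def by (rule summable_norm[OF X_summable])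
    also have "\<dots> \<le> (\<Sum>k. C * norm y * (1/2) ^ k)"
      by (intro suminf_le X(2) geom X_summable)
    also have "\<dots> = C * norm y * (\<Sum>k. (1/2) ^ k)"
      by (rule suminf_mult) (rule summable_geometric, simp)
    also have "(\<Sum>k. (1/2::real) ^ k) = 2"
      by (subst suminf_geometric) simp_all
    finally have norm_x: "norm x \<le> 2 * C * norm y"
      by simp
    have "(\<lambda>m. f (\<Sum>k<m. X k) - f x) \<longlonglongrightarrow> 0"
    proof (rule Lim_null_comparison)
      show "(\<lambda>m. K * norm ((\<Sum>k<m. X k) - x)) \<longlonglongrightarrow> 0"
        using tendsto_mult_right_zero[OF tendsto_norm_zero[OF LIM_zero[OF lim]], of K] .
      show "\<forall>\<^sub>F m in sequentially. norm (f (\<Sum>k<m. X k) - f x) \<le> K * norm ((\<Sum>k<m. X k) - x)"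
        using bound[OF A_diff[OF sum_A xA]] by (simp add: diff[OF sum_A xA])
    qed
    moreover have "(\<lambda>m. f (\<Sum>k<m. X k) - f x) \<longlonglongrightarrow> (y - 0) - f x"
    proof -
      have "Y \<longlonglongrightarrow> 0"
      proof (rule Lim_null_comparison)
        have "(\<lambda>k. (1/2::real) ^ k) \<longlonglongrightarrow> 0"
          by (rule LIMSEQ_realpow_zero) simp_all
        then show "(\<lambda>k. norm y * (1/2) ^ k) \<longlonglongrightarrow> 0"
          by (rule tendsto_mult_right_zero)
        show "\<forall>\<^sub>F k in sequentially. norm (Y k) \<le> norm y * (1/2) ^ k"
          using Y(1) by (simp add: P_def)
      qed
      then show ?thesis
        unfolding f_sum by (intro tendsto_intros)
    qed
    ultimately have "f x = y"
      using LIMSEQ_unique by fastforce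
    then show ?thesis
      using xA norm_x by blast
  qed
  have "norm x \<le> 2 * C * norm (f x)" if x: "x \<in> A" for x
  proof (cases "f x = 0")
    case True
    have "f 0 = 0"
      using scale[of 0 0] subspace_0[OF A(1)] by simp
    then have "x = 0"
      using True x subspace_0[OF A(1)] bij unfolding bij_betw_def inj_on_def by metis
    then show ?thesis
      using C by simp
  next
    case False
    then obtain x' where "x' \<in> A" "f x' = f x" "norm x' \<le> 2 * C * norm (f x)"
      using solve[OF fB[OF x]] by blast
    then show ?thesis
      using x bij unfolding bij_betw_def inj_on_def by metis
  qed
  then show ?thesis
    by blast
qed

section \<open>Transport along a bounded isomorphism\<close>

context regular_sub
begin

lemma source_square:
  assumes \<phi>: "\<phi> \<in> eigenfunctionals1 D A" and v: "v \<in> normalizers D A" "\<phi> v \<noteq> 0"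
  shows "eig_source D A \<phi> (adj v * v) = of_real ((cmod (\<phi> v))\<^sup>2)"
proof -
  have bf: "\<phi> \<in> bounded_functionals A" and \<rho>: "eig_source D A \<phi> \<in> characters D"
    using \<phi> eigenfunctionals1_iff eigenD by blast+
  define w where "w = cnj (\<phi> v) *\<^sub>C v"
  have w: "w \<in> normalizers D A"
    unfolding w_def by (rule normalizer_scaleC[OF v(1)])
  have \<phi>w: "\<phi> w = of_real ((cmod (\<phi> v))\<^sup>2)"
    unfolding w_def bf_scaleC[OF bf normalizerD(1)[OF v(1)]] by (simp only: complex_norm_square mult.commute)
  then have "0 < \<phi> w"
    using v by (simp add: less_complex_def)
  then have sq: "eig_source D A \<phi> (adj w * w) = of_real ((cmod (\<phi> w))\<^sup>2)"
    by (rule eigenfunctional_is_coord(2)[OF \<phi> w])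
  have "adj w * w = of_real ((cmod (\<phi> v))\<^sup>2) *\<^sub>C (adj v * v)"
    unfolding complex_norm_square
    by (simp add: w_def adj_scaleC mult_scaleC_left mult_scaleC_right scaleC_scaleC mult.commute)
  then have "of_real ((cmod (\<phi> v))\<^sup>2) * eig_source D A \<phi> (adj v * v) = of_real ((cmod (\<phi> w))\<^sup>2)"
    using sq char_scaleC[OF \<rho> normalizerD(4)[OF v(1)]] by simp
  moreover have "cmod (\<phi> w) = (cmod (\<phi> v))\<^sup>2"
    unfolding \<phi>w norm_of_real by simp
  ultimately show ?thesis
    using v(2) by (simp add: power2_eq_square)
qed

lemma eigenfunctional_pos_multiple:
  assumes \<phi>: "\<phi> \<in> eigenfunctionals1 D A" and \<psi>: "\<psi> \<in> eigenfunctionals1 D A"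
    and eq: "\<And>x. x \<in> A \<Longrightarrow> \<psi> x = of_real c * \<phi> x" and c: "c > 0"
  shows "\<psi> = \<phi>"
proof -
  have bf: "\<phi> \<in> bounded_functionals A" "\<psi> \<in> bounded_functionals A"
    and fn: "functional_norm A \<phi> = 1" "functional_norm A \<psi> = 1"
    using \<phi> \<psi> by (auto simp: eigenfunctionals1_def)
  have "functional_norm A \<psi> \<le> c"
  proof (rule functional_norm_le[OF A_zero])
    fix x assume x: "x \<in> A" "norm x \<le> 1"
    then have "cmod (\<phi> x) \<le> 1"
      using functional_norm_ge[OF bf(1) A_csubspace] fn by simp
    then show "cmod (\<psi> x) \<le> c"
      using eq[OF x(1)] c by (simp add: norm_mult mult_left_le)
  qed
  moreover have "functional_norm A \<phi> \<le> 1 / c"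
  proof (rule functional_norm_le[OF A_zero])
    fix x assume x: "x \<in> A" "norm x \<le> 1"
    then have "cmod (\<psi> x) \<le> 1"
      using functional_norm_ge[OF bf(2) A_csubspace] fn by simp
    then show "cmod (\<phi> x) \<le> 1 / c"
      using eq[OF x(1)] c by (simp add: norm_mult field_simps)
  qed
  ultimately have "c = 1"
    using fn c by (simp add: field_simps)
  then show ?thesis
    using eq bf bf_extensional by (intro extensionalityI[of _ A]) auto
qed

end

text \<open>
  If \<open>w K = F w\<close> with hermitian \<open>K\<close> and \<open>F\<close>, then \<open>w\<^sup>* e w K = w\<^sup>* e F w = w\<^sup>* F e w = K w\<^sup>* e w\<close>. When every
  \<open>w d\<close> is a limit of such elements \<open>w K\<close>, the element \<open>w\<^sup>* e w\<close> commutes with the maximal abelian algebra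
  \<open>D\<close>.
\<close>

lemma (in regular) intertwiner_conjugates:
  assumes K: "\<And>d. d \<in> D \<Longrightarrow> adj d = d \<Longrightarrow>
      \<exists>K F. (\<forall>n::nat. K n \<in> D \<and> adj (K n) = K n \<and> F n \<in> D \<and> adj (F n) = F n \<and> w * K n = F n * w)
        \<and> (\<lambda>n. w * K n) \<longlonglongrightarrow> w * d"
    and e: "e \<in> D"
  shows "adj w * e * w \<in> D"
proof (rule commutant_subset)
  define X where "X = adj w * e * w"
  have herm: "X * d = d * X" if d: "d \<in> D" "adj d = d" for d
  proof -
    obtain K F where KF: "\<And>n::nat. K n \<in> D" "\<And>n. adj (K n) = K n" "\<And>n. F n \<in> D" "\<And>n. adj (F n) = F n"
      "\<And>n. w * K n = F n * w" and lim: "(\<lambda>n. w * K n) \<longlonglongrightarrow> w * d"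
      using K[OF d] by blast
    have "adj w * e * (w * K n) = adj (w * K n) * e * w" for n
    proof -
      have "adj w * e * (w * K n) = adj w * (e * F n) * w"
        by (simp add: KF(5) mult.assoc)
      also have "e * F n = F n * e"
        by (rule commute[OF e KF(3)])
      also have "adj w * (F n * e) * w = adj (F n * w) * e * w"
        by (simp add: adj_mult KF(4) mult.assoc)
      finally show ?thesis
        by (simp add: KF(5))
    qed
    moreover have "(\<lambda>n. adj w * e * (w * K n)) \<longlonglongrightarrow> adj w * e * (w * d)"
      by (intro tendsto_intros lim)
    moreover have "(\<lambda>n. adj (w * K n) * e * w) \<longlonglongrightarrow> adj (w * d) * e * w"
      by (intro tendsto_intros lim)
    ultimately have "adj w * e * (w * d) = adj (w * d) * e * w"
      using LIMSEQ_unique by fastforce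
    then show ?thesis
      using d by (simp add: X_def adj_mult mult.assoc)
  qed
  fix d assume d: "d \<in> D"
  have "X * (re_part d + \<i> *\<^sub>C im_part d) = (re_part d + \<i> *\<^sub>C im_part d) * X"
    using herm[of "re_part d"] herm[of "im_part d"] d
    by (simp add: distrib_left distrib_right mult_scaleC_left mult_scaleC_right)
  then show "adj w * e * w * d = d * (adj w * e * w)"
    by (simp add: X_def flip: re_im_decomp)
qed

lemma (in regular) normalizer_approximate_unit:
  assumes v: "v \<in> normalizers D UNIV"
  obtains x where "\<And>n::nat. x n \<in> D" "\<And>n. adj (x n) = x n" "(\<lambda>n. v * (x n * (adj v * v))) \<longlonglongrightarrow> v"
proof -
  define a where "a = adj v * v"
  have "adj v * 1 * v \<in> D"
    using v one_mem unfolding normalizers_def by blast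
  then have a: "a \<in> D" "pos a"
    using pos_adj_mult by (auto simp: a_def)
  have "\<exists>x\<in>D. adj x = x \<and> norm ((1 - x * a) * a * (1 - x * a)) \<le> inverse (real (Suc n))" for n
    using approximate_unit[OF a, of "inverse (real (Suc n))"] by (metis inverse_positive_iff_positive of_nat_0_less_iff zero_less_Suc)
  then obtain x where x: "\<And>n. x n \<in> D" "\<And>n. adj (x n) = x n"
    and small: "\<And>n. norm ((1 - x n * a) * a * (1 - x n * a)) \<le> inverse (real (Suc n))"
    by metis
  have le: "norm (v * (x n * a) - v) \<le> sqrt (inverse (real (Suc n)))" for n
  proof -
    define h where "h = 1 - x n * a"
    have herm: "adj h = h"
      using x a by (simp add: h_def adj_diff adj_mult_herm pos_herm)
    have "adj (v * h) * (v * h) = h * a * h"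
      by (simp add: adj_mult herm a_def mult.assoc)
    then have "(norm (v * h))\<^sup>2 = norm (h * a * h)"
      by (metis cstar_identity)
    then have "norm (v * h) \<le> sqrt (inverse (real (Suc n)))"
      using small[of n] by (intro real_le_rsqrt) (simp add: h_def)
    then show ?thesis
      by (simp add: h_def right_diff_distrib norm_minus_commute)
  qed
  have "(\<lambda>n. sqrt (inverse (real (Suc n)))) \<longlonglongrightarrow> 0"
    using tendsto_real_sqrt[OF LIMSEQ_inverse_real_of_nat] by simp
  then have "(\<lambda>n. v * (x n * a) - v) \<longlonglongrightarrow> 0"
    by (rule Lim_null_comparison[OF always_eventually, rotated]) (use le in blast)
  then have "(\<lambda>n. v * (x n * a)) \<longlonglongrightarrow> v"
    by (rule LIM_zero_cancel)
  then show thesis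
    using that[of x] x unfolding a_def by blast
qed

text \<open>
  The relation is \<open>v (h v\<^sup>* v) = (v h v\<^sup>*) v\<close> for \<open>h = x\<^sub>n d\<close>, where the elements \<open>x\<^sub>n v\<^sup>* v\<close> form an approximate unit
  for \<open>v\<close>.
\<close>

lemma (in regular) normalizer_intertwines:
  assumes v: "v \<in> normalizers D UNIV" and d: "d \<in> D" "adj d = d"
  obtains k f where "\<And>n::nat. k n \<in> D" "\<And>n. adj (k n) = k n" "\<And>n. f n \<in> D" "\<And>n. adj (f n) = f n"
    "\<And>n. v * k n = f n * v" "(\<lambda>n. v * k n) \<longlonglongrightarrow> v * d"
proof -
  have vD: "v * c * adj v \<in> D" "adj v * c * v \<in> D" if "c \<in> D" for c
    using v that by (auto simp: normalizers_def)
  define a where "a = adj v * v"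
  have a: "a \<in> D" "adj a = a"
    using vD(2)[OF one_mem] by (auto simp: a_def adj_mult adj_adj)
  obtain x where x: "\<And>n. x n \<in> D" "\<And>n. adj (x n) = x n" and lim: "(\<lambda>n. v * (x n * a)) \<longlonglongrightarrow> v"
    using normalizer_approximate_unit[OF v] unfolding a_def by blast
  define k where "k n = (x n * d) * a" for n
  define f where "f n = v * (x n * d) * adj v" for n
  have xd: "x n * d \<in> D" "adj (x n * d) = x n * d" for n
    using x d by (auto simp: adj_mult_herm)
  have "k n \<in> D" "adj (k n) = k n" for n
    using xd a by (simp_all add: k_def adj_mult_herm del: mult.assoc)
  moreover have "f n \<in> D" "adj (f n) = f n" for n
  proof -
    show "f n \<in> D"
      unfolding f_def by (rule vD(1)[OF xd(1)])
    have "adj (v * c * adj v) = v * adj c * adj v" for c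
      by (simp add: adj_mult adj_adj mult.assoc)
    then show "adj (f n) = f n"
      by (simp only: f_def xd(2))
  qed
  moreover have "v * k n = f n * v" for n
    by (simp add: k_def f_def a_def mult.assoc)
  moreover have "(\<lambda>n. v * k n) \<longlonglongrightarrow> v * d"
  proof -
    have "v * (x n * a) * d = v * k n" for n
      using commute[OF a(1) d(1)] by (simp add: k_def mult.assoc)
    moreover have "(\<lambda>n. v * (x n * a) * d) \<longlonglongrightarrow> v * d"
      by (intro tendsto_intros lim)
    ultimately show ?thesis
      by simp
  qed
  ultimately show thesis
    using that by blast
qed

locale bounded_isomorphism =
  S: regular_sub D1 A1 + T: regular_sub D2 A2
  for D1 A1 :: "'a::cstar_algebra set" and D2 A2 :: "'b::cstar_algebra set" +
  fixes \<theta> :: "'a \<Rightarrow> 'b"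
  assumes iso: "bounded_algebra_isomorphism A1 A2 \<theta>" and image_D: "\<theta> ` D1 = D2"
begin

lemma bij: "bij_betw \<theta> A1 A2" and inj: "inj_on \<theta> A1" and image_A: "\<theta> ` A1 = A2"
  using iso by (auto simp: bounded_algebra_isomorphism_def bij_betw_def)

lemma \<theta>_A [simp]: "x \<in> A1 \<Longrightarrow> \<theta> x \<in> A2" and \<theta>_D [simp]: "x \<in> D1 \<Longrightarrow> \<theta> x \<in> D2"
  using image_A image_D by auto

lemma \<theta>_add: "x \<in> A1 \<Longrightarrow> y \<in> A1 \<Longrightarrow> \<theta> (x + y) = \<theta> x + \<theta> y"
  and \<theta>_scaleC: "x \<in> A1 \<Longrightarrow> \<theta> (c *\<^sub>C x) = c *\<^sub>C \<theta> x"
  and \<theta>_mult: "x \<in> A1 \<Longrightarrow> y \<in> A1 \<Longrightarrow> \<theta> (x * y) = \<theta> x * \<theta> y"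
  using iso by (simp_all add: bounded_algebra_isomorphism_def clinear_on_def)

lemma \<theta>_diff: "x \<in> A1 \<Longrightarrow> y \<in> A1 \<Longrightarrow> \<theta> (x - y) = \<theta> x - \<theta> y"
  using \<theta>_add[of x "(-1) *\<^sub>C y"] \<theta>_scaleC[of y "-1"] S.A_scaleC[of y "-1"] by simp

lemma \<theta>_bound: obtains K where "\<And>x. x \<in> A1 \<Longrightarrow> norm (\<theta> x) \<le> K * norm x"
  using iso by (auto simp: bounded_algebra_isomorphism_def bounded_on_def)

lemma \<theta>_tendsto:
  assumes "\<And>n. s n \<in> A1" "l \<in> A1" "s \<longlonglongrightarrow> l"
  shows "(\<lambda>n. \<theta> (s n)) \<longlonglongrightarrow> \<theta> l"
proof -
  obtain K where K: "\<And>x. x \<in> A1 \<Longrightarrow> norm (\<theta> x) \<le> K * norm x"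
    using \<theta>_bound by blast
  have "(\<lambda>n. \<theta> (s n) - \<theta> l) \<longlonglongrightarrow> 0"
  proof (rule Lim_null_comparison)
    show "(\<lambda>n. K * norm (s n - l)) \<longlonglongrightarrow> 0"
      by (rule tendsto_mult_right_zero[OF tendsto_norm_zero[OF LIM_zero[OF assms(3)]]])
    show "\<forall>\<^sub>F n in sequentially. norm (\<theta> (s n) - \<theta> l) \<le> K * norm (s n - l)"
      using K[OF cvs.subspace_diff[OF S.A_csubspace assms(1,2)]] \<theta>_diff[OF assms(1,2)] by simp
  qed
  then show ?thesis
    by (rule LIM_zero_cancel)
qed

lemma \<theta>_one [simp]: "\<theta> 1 = 1"
proof -
  obtain e where e: "e \<in> D1" "\<theta> e = 1"
    using image_D T.one_mem by (metis imageE)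
  then have "\<theta> (1 * e) = \<theta> 1 * \<theta> e"
    by (intro \<theta>_mult S.A_D) simp_all
  then show ?thesis
    using e by simp
qed

definition \<theta>' :: "'b \<Rightarrow> 'a" where
  "\<theta>' = inv_into A1 \<theta>"

lemma \<theta>'_\<theta> [simp]: "x \<in> A1 \<Longrightarrow> \<theta>' (\<theta> x) = x"
  unfolding \<theta>'_def using inj by simp

lemma \<theta>_\<theta>' [simp]: "y \<in> A2 \<Longrightarrow> \<theta> (\<theta>' y) = y"
  unfolding \<theta>'_def using image_A by (simp add: f_inv_into_f)

lemma \<theta>'_A [simp]: "y \<in> A2 \<Longrightarrow> \<theta>' y \<in> A1"
  unfolding \<theta>'_def using image_A by (simp add: inv_into_into)

lemma \<theta>'_D [simp]: "y \<in> D2 \<Longrightarrow> \<theta>' y \<in> D1"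
  using image_D S.A_D by auto

lemma \<theta>'_mult: "x \<in> A2 \<Longrightarrow> y \<in> A2 \<Longrightarrow> \<theta>' (x * y) = \<theta>' x * \<theta>' y"
  using \<theta>_mult[of "\<theta>' x" "\<theta>' y"] \<theta>'_\<theta>[of "\<theta>' x * \<theta>' y"] S.A_mult by simp

lemma \<theta>'_add: "x \<in> A2 \<Longrightarrow> y \<in> A2 \<Longrightarrow> \<theta>' (x + y) = \<theta>' x + \<theta>' y"
  using \<theta>_add[of "\<theta>' x" "\<theta>' y"] \<theta>'_\<theta>[of "\<theta>' x + \<theta>' y"] S.A_add by simp

lemma \<theta>'_scaleC: "x \<in> A2 \<Longrightarrow> \<theta>' (c *\<^sub>C x) = c *\<^sub>C \<theta>' x"
  using \<theta>_scaleC[of "\<theta>' x" c] \<theta>'_\<theta>[of "c *\<^sub>C \<theta>' x"] S.A_scaleC by simp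

lemma \<theta>'_bounded: "bounded_on A2 \<theta>'"
proof -
  have subspace: "subspace X" if "csubspace X" for X :: "'c::cstar_algebra set"
    using that unfolding cvs.subspace_def real_vector.subspace_def by (simp add: scaleR_eq_scaleC[where 'a = 'c])
  obtain K0 where K0: "\<And>x. x \<in> A1 \<Longrightarrow> norm (\<theta> x) \<le> K0 * norm x"
    using \<theta>_bound by blast
  have "\<exists>K. \<forall>x\<in>A1. norm x \<le> K * norm (\<theta> x)"
  proof (rule bounded_inverse[OF _ S.A_closed _ T.A_closed \<theta>_add _ bij K0])
    show "subspace A1" "subspace A2"
      using subspace S.A_csubspace T.A_csubspace by blast+
    show "\<theta> (t *\<^sub>R x) = t *\<^sub>R \<theta> x" if "x \<in> A1" for t x
      using \<theta>_scaleC[OF that, of "of_real t"] by (simp only: scaleC_of_real)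
  qed
  then obtain K where "\<And>x. x \<in> A1 \<Longrightarrow> norm x \<le> K * norm (\<theta> x)"
    by blast
  then have "\<forall>y\<in>A2. norm (\<theta>' y) \<le> K * norm y"
    by (metis \<theta>'_A \<theta>_\<theta>')
  then show ?thesis
    by (auto simp: bounded_on_def)
qed

lemma inverse: "bounded_isomorphism D2 A2 D1 A1 \<theta>'"
proof unfold_locales
  have bij': "bij_betw \<theta>' A2 A1"
    unfolding \<theta>'_def by (rule bij_betw_inv_into[OF bij])
  show "bounded_algebra_isomorphism A2 A1 \<theta>'"
    using \<theta>'_bounded bij' by (simp add: bounded_algebra_isomorphism_def clinear_on_def \<theta>'_add \<theta>'_scaleC \<theta>'_mult)
  have "\<theta>' ` (\<theta> ` D1) = D1"
    using S.A_D by (auto simp: image_image)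
  then show "\<theta>' ` D2 = D1"
    by (simp add: image_D)
qed

subsection \<open>Characters and normalizers\<close>

lemma pullback_A: "y \<in> A2 \<Longrightarrow> pullback_inv \<theta> A1 \<phi> y = \<phi> (\<theta>' y)"
  by (simp add: pullback_inv_def \<theta>'_def image_A)

lemma pullback_D:
  assumes "y \<in> D2"
  shows "pullback_inv \<theta> D1 \<rho> y = \<rho> (\<theta>' y)"
proof -
  obtain d where d: "d \<in> D1" "y = \<theta> d"
    using assms image_D by blast
  have "inj_on \<theta> D1"
    using inj S.DA by (rule inj_on_subset)
  then have "inv_into D1 \<theta> y = d"
    using d by simp
  then show ?thesis
    using assms d S.A_D by (simp add: pullback_inv_def image_D)
qed

lemma pullback_extensional: "pullback_inv \<theta> A1 \<phi> \<in> extensional A2" "pullback_inv \<theta> D1 \<rho> \<in> extensional D2"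
  by (simp_all add: pullback_inv_def image_A image_D)

lemma pullback_character:
  assumes \<rho>: "\<rho> \<in> characters D1"
  shows "pullback_inv \<theta> D1 \<rho> \<in> characters D2"
proof -
  have "pullback_inv \<theta> D1 \<rho> 1 = 1"
    using S.char_one[OF \<rho>] \<theta>'_\<theta>[of 1] S.A_D[of 1] by (simp add: pullback_D)
  then have "\<exists>x\<in>D2. pullback_inv \<theta> D1 \<rho> x \<noteq> 0"
    using T.one_mem by (metis zero_neq_one)
  then show ?thesis
    using S.char_add[OF \<rho>] S.char_scaleC[OF \<rho>] S.char_mult[OF \<rho>] pullback_extensional(2)
    by (simp add: characters_def clinear_on_def scaleC_complex_def pullback_D \<theta>'_add \<theta>'_scaleC \<theta>'_mult T.A_D)
qed

end

context bounded_isomorphism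
begin

interpretation inv: bounded_isomorphism D2 A2 D1 A1 \<theta>'
  by (rule inverse)

lemma inv_\<theta>' [simp]: "x \<in> A1 \<Longrightarrow> inv.\<theta>' x = \<theta> x"
  by (metis \<theta>'_\<theta> \<theta>_A inv.\<theta>'_\<theta>)

text \<open>
  Characters of abelian C*-algebras respect adjoints whatever homomorphism they are composed with, and they
  separate points; so an algebra isomorphism between such algebras is automatically a *-isomorphism.
\<close>

lemma \<theta>_adj:
  assumes d: "d \<in> D1"
  shows "\<theta> (adj d) = adj (\<theta> d)"
proof (rule T.eq_if_char_eq)
  fix \<tau> assume \<tau>: "\<tau> \<in> characters D2"
  define \<rho> where "\<rho> = pullback_inv \<theta>' D2 \<tau>"
  have \<rho>: "\<rho> \<in> characters D1"
    unfolding \<rho>_def by (rule inv.pullback_character[OF \<tau>])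
  have eq: "\<rho> x = \<tau> (\<theta> x)" if "x \<in> D1" for x
    using that S.A_D by (simp add: \<rho>_def inv.pullback_D)
  show "\<tau> (\<theta> (adj d)) = \<tau> (adj (\<theta> d))"
    using S.char_adj[OF \<rho> d] T.char_adj[OF \<tau> \<theta>_D[OF d]] d by (simp flip: eq)
qed (use d in auto)

text \<open>
  As \<open>v\<^sup>*\<close> need not belong to \<open>A\<^sub>1\<close>, the conditions \<open>v d v\<^sup>*, v\<^sup>* d v \<in> D\<^sub>1\<close> cannot be transported directly. But
  relations \<open>v K = F v\<close> with hermitian \<open>K, F \<in> D\<^sub>1\<close>, and limits of such products, are preserved by
  \<open>\<theta>\<close>, which is multiplicative, continuous, and a *-isomorphism on \<open>D\<^sub>1\<close>, and such relations make \<open>\<theta>(v)\<close> a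
  normalizer.
\<close>

lemma \<theta>_normalizer:
  assumes v: "v \<in> normalizers D1 A1"
  shows "\<theta> v \<in> normalizers D2 A2"
proof -
  note vA = S.normalizerD(1)[OF v]
  define w where "w = \<theta> v"
  have herm: "adj (\<theta> d) = \<theta> d" if "d \<in> D1" "adj d = d" for d
    using \<theta>_adj[OF that(1)] that(2) by simp
  have preimage: "\<theta>' d \<in> D1" "adj (\<theta>' d) = \<theta>' d" "\<theta> (\<theta>' d) = d" if d: "d \<in> D2" "adj d = d" for d
  proof -
    show \<theta>'d: "\<theta>' d \<in> D1" "\<theta> (\<theta>' d) = d"
      using d T.A_D by auto
    have "\<theta> (adj (\<theta>' d)) = \<theta> (\<theta>' d)"
      using \<theta>_adj[OF \<theta>'d(1)] \<theta>'d(2) d(2) by simp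
    then show "adj (\<theta>' d) = \<theta>' d"
      using inj_onD[OF inj] S.A_D \<theta>'d(1) by simp
  qed
  have vN: "v \<in> normalizers D1 UNIV" "adj v \<in> normalizers D1 UNIV"
    using v by (auto simp: normalizers_def adj_adj)
  have \<theta>_vd: "\<theta> (v * d) = w * \<theta> d" "\<theta> (d * v) = \<theta> d * w" "v * d \<in> A1" "d * v \<in> A1" if "d \<in> D1" for d
    using \<theta>_mult[OF vA S.A_D[OF that]] \<theta>_mult[OF S.A_D[OF that] vA] S.A_mult vA S.A_D[OF that]
    by (simp_all add: w_def)
  have "adj w * e * w \<in> D2" if e: "e \<in> D2" for e
  proof (rule T.intertwiner_conjugates[OF _ e])
    fix d assume d: "d \<in> D2" "adj d = d"
    note d' = preimage[OF d]
    obtain k f where k: "\<And>n::nat. k n \<in> D1" "\<And>n. adj (k n) = k n"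
      and f: "\<And>n. f n \<in> D1" "\<And>n. adj (f n) = f n"
      and kf: "\<And>n. v * k n = f n * v" and lim: "(\<lambda>n. v * k n) \<longlonglongrightarrow> v * \<theta>' d"
      using S.normalizer_intertwines[OF vN(1) d'(1,2)] by blast
    have "w * \<theta> (k n) = \<theta> (f n) * w" for n
      using arg_cong[OF kf[of n], of \<theta>] by (simp only: \<theta>_vd k(1) f(1))
    moreover have "(\<lambda>n. w * \<theta> (k n)) \<longlonglongrightarrow> w * d"
      using \<theta>_tendsto[OF \<theta>_vd(3)[OF k(1)] \<theta>_vd(3)[OF d'(1)] lim]
      by (simp only: \<theta>_vd(1)[OF k(1)] \<theta>_vd(1)[OF d'(1)] d'(3))
    ultimately show "\<exists>K F. (\<forall>n::nat. K n \<in> D2 \<and> adj (K n) = K n \<and> F n \<in> D2 \<and> adj (F n) = F n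
        \<and> w * K n = F n * w) \<and> (\<lambda>n. w * K n) \<longlonglongrightarrow> w * d"
      using k f herm by (intro exI[of _ "\<lambda>n. \<theta> (k n)"] exI[of _ "\<lambda>n. \<theta> (f n)"]) simp
  qed
  moreover have "adj (adj w) * e * adj w \<in> D2" if e: "e \<in> D2" for e
  proof (rule T.intertwiner_conjugates[OF _ e])
    fix d assume d: "d \<in> D2" "adj d = d"
    note d' = preimage[OF d]
    obtain k f where k: "\<And>n::nat. k n \<in> D1" "\<And>n. adj (k n) = k n"
      and f: "\<And>n. f n \<in> D1" "\<And>n. adj (f n) = f n"
      and kf: "\<And>n. adj v * k n = f n * adj v" and lim: "(\<lambda>n. adj v * k n) \<longlonglongrightarrow> adj v * \<theta>' d"
      using S.normalizer_intertwines[OF vN(2) d'(1,2)] by blast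
    \<comment> \<open>Only \<open>v\<close> itself lies in the domain of \<open>\<theta>\<close>, so the relations are transported in adjoint form.\<close>
    have kv: "k n * v = v * f n" for n
      using arg_cong[OF kf[of n], of adj] k f by (simp add: adj_mult adj_adj)
    have "(\<lambda>n. k n * v) \<longlonglongrightarrow> \<theta>' d * v"
      using tendsto_adj[OF lim] k d'(2) by (simp add: adj_mult adj_adj)
    then have "(\<lambda>n. \<theta> (k n) * w) \<longlonglongrightarrow> d * w"
      using \<theta>_tendsto[OF \<theta>_vd(4)[OF k(1)] \<theta>_vd(4)[OF d'(1)]]
      by (simp only: \<theta>_vd(2)[OF k(1)] \<theta>_vd(2)[OF d'(1)] d'(3))
    then have "(\<lambda>n. adj w * \<theta> (k n)) \<longlonglongrightarrow> adj w * d"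
      using tendsto_adj[of "\<lambda>n. \<theta> (k n) * w" "d * w"] herm[OF k] d by (simp add: adj_mult)
    moreover have wk: "\<theta> (k n) * w = w * \<theta> (f n)" for n
      using arg_cong[OF kv[of n], of \<theta>] by (simp only: \<theta>_vd k(1) f(1))
    have "adj w * \<theta> (k n) = \<theta> (f n) * adj w" for n
      using arg_cong[OF wk[of n], of adj] herm[OF k] herm[OF f] by (simp add: adj_mult)
    ultimately show "\<exists>K F. (\<forall>n::nat. K n \<in> D2 \<and> adj (K n) = K n \<and> F n \<in> D2 \<and> adj (F n) = F n
        \<and> adj w * K n = F n * adj w) \<and> (\<lambda>n. adj w * K n) \<longlonglongrightarrow> adj w * d"
      using k f herm by (intro exI[of _ "\<lambda>n. \<theta> (k n)"] exI[of _ "\<lambda>n. \<theta> (f n)"]) simp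
  qed
  ultimately show ?thesis
    using vA by (simp add: normalizers_def w_def adj_adj)
qed

end

context bounded_isomorphism
begin

interpretation inv: bounded_isomorphism D2 A2 D1 A1 \<theta>'
  by (rule inverse)

subsection \<open>Transport of eigenfunctionals\<close>

definition transport :: "('a \<Rightarrow> complex) \<Rightarrow> 'b \<Rightarrow> complex" where
  "transport \<phi> = (\<lambda>y\<in>A2. pullback_inv \<theta> A1 \<phi> y / of_real (functional_norm A2 (pullback_inv \<theta> A1 \<phi>)))"

lemma pullback_bounded:
  assumes bf: "\<phi> \<in> bounded_functionals A1"
  shows "pullback_inv \<theta> A1 \<phi> \<in> bounded_functionals A2"
proof -
  obtain K where K: "\<And>y. y \<in> A2 \<Longrightarrow> norm (\<theta>' y) \<le> K * norm y"
    using inv.\<theta>_bound by blast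
  define M where "M = functional_norm A1 \<phi>"
  have "0 \<le> M"
    using functional_norm_ge[OF bf S.A_csubspace S.A_zero] by (simp add: M_def S.bf_zero[OF bf])
  show ?thesis
  proof (rule bounded_functionalsI)
    show "clinear_on A2 (pullback_inv \<theta> A1 \<phi>)"
      by (simp add: clinear_on_def scaleC_complex_def pullback_A \<theta>'_add \<theta>'_scaleC T.A_add T.A_scaleC
          S.bf_add[OF bf] S.bf_scaleC[OF bf])
    show "cmod (pullback_inv \<theta> A1 \<phi> y) \<le> (M * K) * norm y" if y: "y \<in> A2" for y
    proof -
      have "cmod (\<phi> (\<theta>' y)) \<le> M * norm (\<theta>' y)"
        unfolding M_def by (rule functional_norm_bound[OF bf S.A_csubspace]) (use y in simp)
      also have "\<dots> \<le> M * (K * norm y)"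
        using \<open>0 \<le> M\<close> K[OF y] by (rule mult_left_mono[rotated])
      finally show ?thesis
        using y by (simp add: pullback_A mult.assoc)
    qed
  qed (rule pullback_extensional)
qed

lemma pullback_eigen:
  assumes e: "S.eigen \<phi> \<sigma> \<rho>"
  shows "T.eigen (pullback_inv \<theta> A1 \<phi>) (pullback_inv \<theta> D1 \<sigma>) (pullback_inv \<theta> D1 \<rho>)"
  unfolding T.eigen_def
proof (intro conjI ballI)
  show "pullback_inv \<theta> A1 \<phi> \<in> bounded_functionals A2"
    by (rule pullback_bounded[OF S.eigenD(1)[OF e]])
  show "pullback_inv \<theta> D1 \<sigma> \<in> characters D2" "pullback_inv \<theta> D1 \<rho> \<in> characters D2"
    by (rule pullback_character S.eigenD(2)[OF e] S.eigenD(3)[OF e])+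
  fix d y assume dy: "d \<in> D2" "y \<in> A2"
  show "pullback_inv \<theta> A1 \<phi> (d * y) = pullback_inv \<theta> D1 \<sigma> d * pullback_inv \<theta> A1 \<phi> y"
    using S.eigenD(4)[OF e \<theta>'_D[OF dy(1)] \<theta>'_A[OF dy(2)]] dy T.A_D T.A_mult
    by (simp add: pullback_A pullback_D \<theta>'_mult)
  show "pullback_inv \<theta> A1 \<phi> (y * d) = pullback_inv \<theta> A1 \<phi> y * pullback_inv \<theta> D1 \<rho> d"
    using S.eigenD(5)[OF e \<theta>'_D[OF dy(1)] \<theta>'_A[OF dy(2)]] dy T.A_D T.A_mult
    by (simp add: pullback_A pullback_D \<theta>'_mult)
qed

lemma pullback_norm_pos:
  assumes \<phi>: "\<phi> \<in> eigenfunctionals1 D1 A1"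
  shows "0 < functional_norm A2 (pullback_inv \<theta> A1 \<phi>)"
proof -
  have bf: "\<phi> \<in> bounded_functionals A1" and fn: "functional_norm A1 \<phi> = 1"
    using \<phi> by (auto simp: eigenfunctionals1_def)
  obtain x where x: "x \<in> A1" "\<phi> x \<noteq> 0"
    using S.norm_one_nonzero[OF fn] .
  have "cmod (\<phi> x) \<le> functional_norm A2 (pullback_inv \<theta> A1 \<phi>) * norm (\<theta> x)"
    using functional_norm_bound[OF pullback_bounded[OF bf] T.A_csubspace \<theta>_A[OF x(1)]] x
    by (simp add: pullback_A)
  then have "0 < functional_norm A2 (pullback_inv \<theta> A1 \<phi>) * norm (\<theta> x)"
    using x(2) by (smt (verit) zero_less_norm_iff)
  then show ?thesis
    by (simp add: zero_less_mult_iff)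
qed

lemma transport_apply:
  "x \<in> A1 \<Longrightarrow> transport \<phi> (\<theta> x) = \<phi> x / of_real (functional_norm A2 (pullback_inv \<theta> A1 \<phi>))"
  by (simp add: transport_def pullback_A)

lemma transport_mem:
  assumes \<phi>: "\<phi> \<in> eigenfunctionals1 D1 A1"
  shows "transport \<phi> \<in> eigenfunctionals1 D2 A2"
    and "eig_range D2 A2 (transport \<phi>) = pullback_inv \<theta> D1 (eig_range D1 A1 \<phi>)"
    and "eig_source D2 A2 (transport \<phi>) = pullback_inv \<theta> D1 (eig_source D1 A1 \<phi>)"
proof -
  define \<psi> where "\<psi> = pullback_inv \<theta> A1 \<phi>"
  define N where "N = functional_norm A2 \<psi>"
  have N: "0 < N"
    unfolding N_def \<psi>_def by (rule pullback_norm_pos[OF \<phi>])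
  have e: "T.eigen \<psi> (pullback_inv \<theta> D1 (eig_range D1 A1 \<phi>)) (pullback_inv \<theta> D1 (eig_source D1 A1 \<phi>))"
    unfolding \<psi>_def using \<phi> S.eigenfunctionals1_iff by (intro pullback_eigen) blast
  note bf = T.eigenD(1)[OF e]
  have eq: "transport \<phi> y = \<psi> y / of_real N" if "y \<in> A2" for y
    using that by (simp add: transport_def \<psi>_def N_def)
  have le: "cmod (transport \<phi> y) \<le> 1 * norm y" if "y \<in> A2" for y
    using functional_norm_bound[OF bf T.A_csubspace that] N
    by (simp add: eq[OF that] norm_divide N_def divide_le_eq mult.commute)
  have bf': "transport \<phi> \<in> bounded_functionals A2"
  proof (rule bounded_functionalsI[OF _ _ le])
    show "transport \<phi> \<in> extensional A2"
      by (simp add: transport_def)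
    show "clinear_on A2 (transport \<phi>)"
      by (simp add: clinear_on_def scaleC_complex_def eq T.A_add T.A_scaleC T.bf_add[OF bf] T.bf_scaleC[OF bf]
          add_divide_distrib)
  qed
  have "T.eigen (transport \<phi>) (pullback_inv \<theta> D1 (eig_range D1 A1 \<phi>)) (pullback_inv \<theta> D1 (eig_source D1 A1 \<phi>))"
    using bf' T.eigenD(2-5)[OF e] T.A_mult T.A_D by (simp add: T.eigen_def eq)
  moreover have "functional_norm A2 (transport \<phi>) = 1"
  proof (rule antisym)
    show "functional_norm A2 (transport \<phi>) \<le> 1"
      by (rule functional_norm_le[OF T.A_zero]) (use le in \<open>auto intro: order_trans\<close>)
    have "functional_norm A2 \<psi> \<le> N * functional_norm A2 (transport \<phi>)"
    proof (rule functional_norm_le[OF T.A_zero])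
      fix y assume y: "y \<in> A2" "norm y \<le> 1"
      have "cmod (\<psi> y) = N * cmod (transport \<phi> y)"
        using N by (simp add: eq[OF y(1)] norm_divide)
      also have "\<dots> \<le> N * functional_norm A2 (transport \<phi>)"
        using N functional_norm_ge[OF bf' T.A_csubspace y] by (intro mult_left_mono) auto
      finally show "cmod (\<psi> y) \<le> N * functional_norm A2 (transport \<phi>)" .
    qed
    then show "1 \<le> functional_norm A2 (transport \<phi>)"
      using N by (simp flip: N_def)
  qed
  ultimately show "transport \<phi> \<in> eigenfunctionals1 D2 A2"
    "eig_range D2 A2 (transport \<phi>) = pullback_inv \<theta> D1 (eig_range D1 A1 \<phi>)"
    "eig_source D2 A2 (transport \<phi>) = pullback_inv \<theta> D1 (eig_source D1 A1 \<phi>)"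
    using T.eigenfunctionals1I by blast+
qed

text \<open>
  The transported functional is positive at \<open>\<theta>(v)\<close> because \<open>\<phi>\<close> is positive at \<open>v\<close>; so it is the coordinate of
  \<open>\<theta>(v)\<close> at its source.
\<close>

lemma transport_coord:
  assumes \<phi>: "\<phi> \<in> eigenfunctionals1 D1 A1" and v: "v \<in> normalizers D1 A1" and pos: "0 < \<phi> v"
  shows "0 < char_state D2 (pullback_inv \<theta> D1 (eig_source D1 A1 \<phi>)) (adj (\<theta> v) * \<theta> v)"
    and "transport \<phi> = coord D2 A2 (\<theta> v) (pullback_inv \<theta> D1 (eig_source D1 A1 \<phi>))"
proof -
  note w = \<theta>_normalizer[OF v]
  have wpos: "0 < transport \<phi> (\<theta> v)"
    using pos pullback_norm_pos[OF \<phi>] S.normalizerD(1)[OF v]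
    by (simp add: transport_apply less_complex_def)
  note coord = T.eigenfunctional_is_coord[OF transport_mem(1)[OF \<phi>] w wpos, unfolded transport_mem(3)[OF \<phi>]]
  show "transport \<phi> = coord D2 A2 (\<theta> v) (pullback_inv \<theta> D1 (eig_source D1 A1 \<phi>))"
    by (rule coord(1))
  have \<rho>: "pullback_inv \<theta> D1 (eig_source D1 A1 \<phi>) \<in> characters D2"
    using \<phi> S.eigenfunctionals1_iff S.eigenD(3) pullback_character by blast
  have "transport \<phi> (\<theta> v) \<noteq> 0"
    using wpos by auto
  then show "0 < char_state D2 (pullback_inv \<theta> D1 (eig_source D1 A1 \<phi>)) (adj (\<theta> v) * \<theta> v)"
    unfolding T.char_state_normalizer(2)[OF w \<rho>] coord(2) by simp
qed

lemma transport_mult: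
  assumes \<phi>: "\<phi> \<in> eigenfunctionals1 D1 A1" and \<psi>: "\<psi> \<in> eigenfunctionals1 D1 A1"
    and comp: "eig_source D1 A1 \<phi> = eig_range D1 A1 \<psi>"
  shows "transport (eig_mult D1 A1 \<phi> \<psi>) = eig_mult D2 A2 (transport \<phi>) (transport \<psi>)"
proof -
  have real: "\<rho> (adj v * v) = of_real (Re (\<rho> (adj v * v)))" if "v \<in> normalizers D1 A1" "\<rho> \<in> characters D1" for v \<rho>
    using that S.normalizerD(4) by (intro S.char_herm_real) (auto simp: adj_mult adj_adj)
  obtain v1 where v1: "v1 \<in> normalizers D1 A1" "0 < \<phi> v1"
    using S.eigenfunctional_coord_ex[OF \<phi>] .
  obtain v2 where v2: "v2 \<in> normalizers D1 A1" "0 < \<psi> v2"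
    using S.eigenfunctional_coord_ex[OF \<psi>] .
  define \<rho>1 where "\<rho>1 = eig_source D1 A1 \<phi>"
  define \<rho>2 where "\<rho>2 = eig_source D1 A1 \<psi>"
  have \<rho>: "\<rho>1 \<in> characters D1" "\<rho>2 \<in> characters D1"
    using \<phi> \<psi> S.eigenfunctionals1_iff S.eigenD(3) by (auto simp: \<rho>1_def \<rho>2_def)
  note \<phi>_coord = S.eigenfunctional_is_coord[OF \<phi> v1, folded \<rho>1_def]
    and \<psi>_coord = S.eigenfunctional_is_coord[OF \<psi> v2, folded \<rho>2_def]
  have "\<phi> v1 \<noteq> 0" "\<psi> v2 \<noteq> 0"
    using v1 v2 by auto
  then have pos: "0 < char_state D1 \<rho>1 (adj v1 * v1)" "0 < char_state D1 \<rho>2 (adj v2 * v2)"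
    unfolding S.char_state_normalizer(2)[OF v1(1) \<rho>(1)] S.char_state_normalizer(2)[OF v2(1) \<rho>(2)]
      \<phi>_coord(2) \<psi>_coord(2) by simp_all
  have "eig_range D1 A1 (coord D1 A1 v2 \<rho>2) = \<rho>1"
    using comp \<psi>_coord(1) by (simp add: \<rho>1_def)
  note prod = S.eig_mult_coord[OF v1(1) \<rho>(1) pos(1) v2(1) \<rho>(2) pos(2) this, folded \<phi>_coord(1) \<psi>_coord(1)]
  have v12: "v1 * v2 \<in> normalizers D1 A1"
    using v1(1) v2(1) by (rule S.normalizer_mult)
  have a: "0 < Re (\<rho>2 (adj (v1 * v2) * (v1 * v2)))"
    using prod(2) S.char_state_normalizer(2)[OF v12 \<rho>(2)] by simp
  note mem = S.coord_mem[OF v12 \<rho>(2) a real[OF v12 \<rho>(2)]]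
    and source = S.coord_source[OF v12 \<rho>(2) a real[OF v12 \<rho>(2)]]
  have "0 < coord D1 A1 (v1 * v2) \<rho>2 (v1 * v2)"
    unfolding S.coord_self[OF v12 \<rho>(2) a real[OF v12 \<rho>(2)]] using a by (simp add: less_complex_def)
  then have "transport (coord D1 A1 (v1 * v2) \<rho>2) = coord D2 A2 (\<theta> (v1 * v2)) (pullback_inv \<theta> D1 \<rho>2)"
    using transport_coord(2)[OF mem v12] source by simp
  also have "\<theta> (v1 * v2) = \<theta> v1 * \<theta> v2"
    using S.normalizerD(1) v1 v2 by (intro \<theta>_mult) auto
  also have "coord D2 A2 (\<theta> v1 * \<theta> v2) (pullback_inv \<theta> D1 \<rho>2) = eig_mult D2 A2 (transport \<phi>) (transport \<psi>)"
  proof -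
    note t\<phi> = transport_coord[OF \<phi> v1, folded \<rho>1_def] and t\<psi> = transport_coord[OF \<psi> v2, folded \<rho>2_def]
    have "eig_range D2 A2 (coord D2 A2 (\<theta> v2) (pullback_inv \<theta> D1 \<rho>2)) = pullback_inv \<theta> D1 \<rho>1"
      using transport_mem(2)[OF \<psi>] comp by (simp add: \<rho>1_def flip: t\<psi>(2))
    then show ?thesis
      unfolding t\<phi>(2) t\<psi>(2)
      by (intro T.eig_mult_coord(1)[symmetric] \<theta>_normalizer v1 v2 pullback_character \<rho> t\<phi>(1) t\<psi>(1))
  qed
  finally show ?thesis
    by (simp only: prod(1))
qed

subsection \<open>Continuity\<close>

lemma topspace_eigenfunctionals:
  "topspace (weak_star_topology A1 (eigenfunctionals1 D1 A1)) = eigenfunctionals1 D1 A1"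
proof -
  have "\<phi> \<in> extensional A1" if "\<phi> \<in> eigenfunctionals1 D1 A1" for \<phi>
    using that by (auto simp: eigenfunctionals1_def bounded_functionals_def)
  then show ?thesis
    by (auto simp: weak_star_topology_def PiE_def)
qed

text \<open>
  Near an eigenfunctional with \<open>\<phi>(v) \<noteq> 0\<close> the normalizing constant is an explicit continuous function of two
  values of \<open>\<phi>\<close>: the squared modulus of the transported functional at \<open>\<theta>(v)\<close> equals the value of its source at
  \<open>\<theta>(v)\<^sup>* \<theta>(v)\<close>, and the source is determined by the values of \<open>\<phi>\<close>.
\<close>

lemma transport_formula:
  assumes \<phi>: "\<phi> \<in> eigenfunctionals1 D1 A1" and v: "v \<in> normalizers D1 A1" "\<phi> v \<noteq> 0" and y: "y \<in> A2"
  shows "transport \<phi> y = \<phi> (\<theta>' y) *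
    of_real (sqrt (cmod (\<phi> (v * \<theta>' (adj (\<theta> v) * \<theta> v)) / \<phi> v)) / cmod (\<phi> v))"
proof -
  define N where "N = functional_norm A2 (pullback_inv \<theta> A1 \<phi>)"
  define b where "b = adj (\<theta> v) * \<theta> v"
  have N: "0 < N"
    unfolding N_def by (rule pullback_norm_pos[OF \<phi>])
  note w = \<theta>_normalizer[OF v(1)]
  have b: "b \<in> D2"
    unfolding b_def by (rule T.normalizerD(4)[OF w])
  have vA: "v \<in> A1"
    by (rule S.normalizerD(1)[OF v(1)])
  have val: "cmod (transport \<phi> (\<theta> v)) = cmod (\<phi> v) / N"
    using transport_apply[OF vA, of \<phi>] N by (simp add: N_def norm_divide)
  then have nz: "transport \<phi> (\<theta> v) \<noteq> 0"
    using v(2) N by auto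
  have "eig_source D2 A2 (transport \<phi>) b = of_real ((cmod (transport \<phi> (\<theta> v)))\<^sup>2)"
    unfolding b_def by (rule T.source_square[OF transport_mem(1)[OF \<phi>] w nz])
  moreover have "eig_source D2 A2 (transport \<phi>) b = eig_source D1 A1 \<phi> (\<theta>' b)"
    using b by (simp add: transport_mem(3)[OF \<phi>] pullback_D)
  moreover have "\<phi> (v * \<theta>' b) = \<phi> v * eig_source D1 A1 \<phi> (\<theta>' b)"
    using \<phi> S.eigenfunctionals1_iff S.eigenD(5)[OF _ \<theta>'_D[OF b] vA] by blast
  ultimately have "\<phi> (v * \<theta>' b) / \<phi> v = of_real ((cmod (\<phi> v) / N)\<^sup>2)"
    using v(2) by (simp add: val)
  then have "sqrt (cmod (\<phi> (v * \<theta>' b) / \<phi> v)) = cmod (\<phi> v) / N"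
    using N by (simp only: norm_of_real) simp
  then have "sqrt (cmod (\<phi> (v * \<theta>' b) / \<phi> v)) / cmod (\<phi> v) = 1 / N"
    using v(2) by simp
  then show ?thesis
    using y by (simp add: transport_def pullback_A N_def b_def)
qed

lemma transport_continuous:
  "continuous_map (weak_star_topology A1 (eigenfunctionals1 D1 A1))
     (weak_star_topology A2 (eigenfunctionals1 D2 A2)) transport"
proof -
  define X where "X = weak_star_topology A1 (eigenfunctionals1 D1 A1)"
  have top: "topspace X = eigenfunctionals1 D1 A1"
    unfolding X_def by (rule topspace_eigenfunctionals)
  have eval: "continuous_map X euclidean (\<lambda>\<phi>. \<phi> x)" if "x \<in> A1" for x
    unfolding X_def weak_star_topology_def
    by (intro continuous_map_from_subtopology continuous_map_product_projection that)
  have "continuous_map X euclidean (\<lambda>\<phi>. transport \<phi> y)" if y: "y \<in> A2" for y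
    unfolding continuous_map_atin
  proof
    fix \<phi>0 assume "\<phi>0 \<in> topspace X"
    then have \<phi>0: "\<phi>0 \<in> eigenfunctionals1 D1 A1"
      by (simp add: top)
    obtain v where v: "v \<in> normalizers D1 A1" "0 < \<phi>0 v"
      using S.eigenfunctional_coord_ex[OF \<phi>0] .
    then have nz: "\<phi>0 v \<noteq> 0"
      by auto
    define b where "b = \<theta>' (adj (\<theta> v) * \<theta> v)"
    have vA: "v \<in> A1"
      by (rule S.normalizerD(1)[OF v(1)])
    have "b \<in> D1"
      unfolding b_def by (rule \<theta>'_D[OF T.normalizerD(4)[OF \<theta>_normalizer[OF v(1)]]])
    then have vb: "v * b \<in> A1"
      using S.A_mult[OF vA S.A_D] by blast
    have lim: "((\<lambda>\<phi>. \<phi> x) \<longlongrightarrow> \<phi>0 x) (atin X \<phi>0)" if "x \<in> A1" for x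
      using eval[OF that] \<phi>0 top by (simp add: continuous_map_atin)
    define f where "f \<phi> = \<phi> (\<theta>' y) * of_real (sqrt (cmod (\<phi> (v * b) / \<phi> v)) / cmod (\<phi> v))" for \<phi> :: "'a \<Rightarrow> complex"
    have lim_f: "(f \<longlongrightarrow> f \<phi>0) (atin X \<phi>0)"
      unfolding f_def using nz by (intro tendsto_intros lim vb vA \<theta>'_A y) auto
    have "\<forall>\<^sub>F \<phi> in atin X \<phi>0. \<phi> \<in> eigenfunctionals1 D1 A1"
      unfolding eventually_atin using \<phi>0 top by (metis DiffE openin_topspace)
    moreover have "\<forall>\<^sub>F \<phi> in atin X \<phi>0. \<phi> v \<noteq> 0"
      by (rule tendsto_imp_eventually_ne[OF lim[OF vA] nz])
    ultimately have "\<forall>\<^sub>F \<phi> in atin X \<phi>0. f \<phi> = transport \<phi> y"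
      by eventually_elim (simp add: f_def b_def transport_formula[OF _ v(1) _ y])
    with lim_f have "((\<lambda>\<phi>. transport \<phi> y) \<longlongrightarrow> f \<phi>0) (atin X \<phi>0)"
      by (rule Lim_transform_eventually)
    then show "limitin euclidean (\<lambda>\<phi>. transport \<phi> y) (transport \<phi>0 y) (atin X \<phi>0)"
      using transport_formula[OF \<phi>0 v(1) nz y] by (simp add: f_def b_def)
  qed
  moreover have "transport \<phi> \<in> extensional A2" for \<phi>
    by (simp add: transport_def)
  ultimately have "continuous_map X (product_topology (\<lambda>_. euclidean) A2) transport"
    by (auto simp: continuous_map_componentwise)
  then show ?thesis
    unfolding weak_star_topology_def[of A2] X_def[symmetric] using transport_mem(1)
    by (auto simp: continuous_map_in_subtopology top)
qed

lemma topspace_characters: "topspace (weak_star_topology D1 (characters D1)) = characters D1"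
  by (auto simp: weak_star_topology_def PiE_def characters_def)

lemma pullback_continuous:
  "continuous_map (weak_star_topology D1 (characters D1)) (weak_star_topology D2 (characters D2))
     (pullback_inv \<theta> D1)"
proof -
  define X where "X = weak_star_topology D1 (characters D1)"
  have top: "topspace X = characters D1"
    unfolding X_def by (rule topspace_characters)
  have "continuous_map X euclidean (\<lambda>\<rho>. pullback_inv \<theta> D1 \<rho> d)" if "d \<in> D2" for d
  proof -
    have "continuous_map X euclidean (\<lambda>\<rho>. \<rho> (\<theta>' d))"
      unfolding X_def weak_star_topology_def
      by (intro continuous_map_from_subtopology continuous_map_product_projection \<theta>'_D that)
    then show ?thesis
      by (simp add: pullback_D[OF that])
  qed
  then have "continuous_map X (product_topology (\<lambda>_. euclidean) D2) (pullback_inv \<theta> D1)"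
    using pullback_extensional(2) by (auto simp: continuous_map_componentwise)
  then show ?thesis
    unfolding weak_star_topology_def[of D2] X_def[symmetric] using pullback_character
    by (auto simp: continuous_map_in_subtopology top)
qed

end

context bounded_isomorphism
begin

interpretation inv: bounded_isomorphism D2 A2 D1 A1 \<theta>'
  by (rule inverse)

text \<open>
  Both compositions multiply an eigenfunctional of norm one by a positive constant and return a functional of
  norm one.
\<close>

lemma transport_inverse:
  shows "\<phi> \<in> eigenfunctionals1 D1 A1 \<Longrightarrow> inv.transport (transport \<phi>) = \<phi>"
    and "\<psi> \<in> eigenfunctionals1 D2 A2 \<Longrightarrow> transport (inv.transport \<psi>) = \<psi>"
proof -
  assume \<phi>: "\<phi> \<in> eigenfunctionals1 D1 A1"
  define M where "M = functional_norm A1 (pullback_inv \<theta>' A2 (transport \<phi>))"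
  define N where "N = functional_norm A2 (pullback_inv \<theta> A1 \<phi>)"
  have M: "0 < M"
    unfolding M_def by (rule inv.pullback_norm_pos[OF transport_mem(1)[OF \<phi>]])
  have N: "0 < N"
    unfolding N_def by (rule pullback_norm_pos[OF \<phi>])
  show "inv.transport (transport \<phi>) = \<phi>"
  proof (rule S.eigenfunctional_pos_multiple[OF \<phi> inv.transport_mem(1)[OF transport_mem(1)[OF \<phi>]]])
    show "inv.transport (transport \<phi>) x = of_real (1 / (M * N)) * \<phi> x" if x: "x \<in> A1" for x
      using inv.transport_apply[OF \<theta>_A[OF x], of "transport \<phi>"] transport_apply[OF x, of \<phi>] x
      by (simp add: M_def N_def)
  qed (use M N in simp)
next
  assume \<psi>: "\<psi> \<in> eigenfunctionals1 D2 A2"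
  define M where "M = functional_norm A1 (pullback_inv \<theta>' A2 \<psi>)"
  define N where "N = functional_norm A2 (pullback_inv \<theta> A1 (inv.transport \<psi>))"
  have M: "0 < M"
    unfolding M_def by (rule inv.pullback_norm_pos[OF \<psi>])
  have N: "0 < N"
    unfolding N_def by (rule pullback_norm_pos[OF inv.transport_mem(1)[OF \<psi>]])
  show "transport (inv.transport \<psi>) = \<psi>"
  proof (rule T.eigenfunctional_pos_multiple[OF \<psi> transport_mem(1)[OF inv.transport_mem(1)[OF \<psi>]]])
    show "transport (inv.transport \<psi>) y = of_real (1 / (M * N)) * \<psi> y" if y: "y \<in> A2" for y
      using transport_apply[OF \<theta>'_A[OF y], of "inv.transport \<psi>"] inv.transport_apply[OF y, of \<psi>] y
      by (simp add: M_def N_def)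
  qed (use M N in simp)
qed

lemma pullback_inverse:
  shows "\<rho> \<in> characters D1 \<Longrightarrow> pullback_inv \<theta>' D2 (pullback_inv \<theta> D1 \<rho>) = \<rho>"
    and "\<tau> \<in> characters D2 \<Longrightarrow> pullback_inv \<theta> D1 (pullback_inv \<theta>' D2 \<tau>) = \<tau>"
proof -
  assume \<rho>: "\<rho> \<in> characters D1"
  show "pullback_inv \<theta>' D2 (pullback_inv \<theta> D1 \<rho>) = \<rho>"
  proof (rule extensionalityI[of _ D1])
    show "pullback_inv \<theta>' D2 (pullback_inv \<theta> D1 \<rho>) x = \<rho> x" if "x \<in> D1" for x
      using that S.A_D by (simp add: inv.pullback_D pullback_D)
  qed (use \<rho> inv.pullback_extensional(2) in \<open>auto simp: characters_def\<close>)
next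
  assume \<tau>: "\<tau> \<in> characters D2"
  show "pullback_inv \<theta> D1 (pullback_inv \<theta>' D2 \<tau>) = \<tau>"
  proof (rule extensionalityI[of _ D2])
    show "pullback_inv \<theta> D1 (pullback_inv \<theta>' D2 \<tau>) y = \<tau> y" if "y \<in> D2" for y
      using that T.A_D by (simp add: inv.pullback_D pullback_D)
  qed (use \<tau> pullback_extensional(2) in \<open>auto simp: characters_def\<close>)
qed

theorem transport_bicontinuous: "bicontinuous_isomorphism D1 A1 D2 A2 transport"
  unfolding bicontinuous_isomorphism_def
proof (intro conjI ballI allI impI)
  have "homeomorphic_maps (weak_star_topology A1 (eigenfunctionals1 D1 A1))
      (weak_star_topology A2 (eigenfunctionals1 D2 A2)) transport inv.transport"
    unfolding homeomorphic_maps_def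
    using transport_continuous inv.transport_continuous transport_inverse
    by (simp add: topspace_eigenfunctionals inv.topspace_eigenfunctionals)
  then show "homeomorphic_map (weak_star_topology A1 (eigenfunctionals1 D1 A1))
      (weak_star_topology A2 (eigenfunctionals1 D2 A2)) transport"
    using homeomorphic_map_maps by blast
next
  fix c :: complex and \<phi> assume \<phi>: "\<phi> \<in> eigenfunctionals1 D1 A1" and c: "cmod c = 1"
  have pull: "pullback_inv \<theta> A1 (circle_action A1 c \<phi>) y = c * pullback_inv \<theta> A1 \<phi> y" if "y \<in> A2" for y
    using that by (simp add: pullback_A circle_action_def)
  then have "cmod (pullback_inv \<theta> A1 (circle_action A1 c \<phi>) y) = cmod (pullback_inv \<theta> A1 \<phi> y)" if "y \<in> A2" for y
    using that c by (simp add: norm_mult)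
  then have "functional_norm A2 (pullback_inv \<theta> A1 (circle_action A1 c \<phi>)) = functional_norm A2 (pullback_inv \<theta> A1 \<phi>)"
    unfolding functional_norm_def
    by (intro arg_cong[of _ _ Sup] Collect_cong ex_cong1) auto
  then show "transport (circle_action A1 c \<phi>) = circle_action A2 c (transport \<phi>)"
    using pull by (auto simp: transport_def circle_action_def restrict_def)
next
  have "homeomorphic_maps (weak_star_topology D1 (characters D1))
      (weak_star_topology D2 (characters D2)) (pullback_inv \<theta> D1) (pullback_inv \<theta>' D2)"
    unfolding homeomorphic_maps_def
    using pullback_continuous inv.pullback_continuous pullback_inverse
    by (simp add: topspace_characters inv.topspace_characters)
  then have "homeomorphic_map (weak_star_topology D1 (characters D1))
      (weak_star_topology D2 (characters D2)) (pullback_inv \<theta> D1)"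
    using homeomorphic_map_maps by blast
  then show "\<exists>h. homeomorphic_map (weak_star_topology D1 (characters D1))
            (weak_star_topology D2 (characters D2)) h \<and>
        (\<forall>\<phi>\<in>eigenfunctionals1 D1 A1.
           eig_range D2 A2 (transport \<phi>) = h (eig_range D1 A1 \<phi>) \<and>
           eig_source D2 A2 (transport \<phi>) = h (eig_source D1 A1 \<phi>))"
    using transport_mem(2,3) by blast
next
  show "transport (eig_mult D1 A1 \<phi> \<psi>) = eig_mult D2 A2 (transport \<phi>) (transport \<psi>)"
    if "\<phi> \<in> eigenfunctionals1 D1 A1" "\<psi> \<in> eigenfunctionals1 D1 A1" "eig_source D1 A1 \<phi> = eig_range D1 A1 \<psi>" for \<phi> \<psi>
    using that by (rule transport_mult)
qed

end

theorem theorem6p3: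
  fixes D1 A1 :: "'a::cstar_algebra set" and D2 A2 :: "'b::cstar_algebra set"
    and \<theta> :: "'a \<Rightarrow> 'b"
  assumes "regular_inclusion D1" and "regular_inclusion D2"
    and "norm_closed_subalgebra A1" and "D1 \<subseteq> A1"
    and "norm_closed_subalgebra A2" and "D2 \<subseteq> A2"
    and "bounded_algebra_isomorphism A1 A2 \<theta>"
    and "\<theta> ` D1 = D2"
  shows "\<exists>\<gamma>. bicontinuous_isomorphism D1 A1 D2 A2 \<gamma> \<and>
    (\<forall>\<phi>\<in>eigenfunctionals1 D1 A1.
       \<gamma> \<phi> = (\<lambda>y\<in>A2. pullback_inv \<theta> A1 \<phi> y /
                of_real (functional_norm A2 (pullback_inv \<theta> A1 \<phi>)))) \<and>
    (\<forall>\<phi>\<in>eigenfunctionals1 D1 A1. \<forall>v\<in>normalizers D1 A1. \<forall>\<rho>\<in>characters D1.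
       0 < char_state D1 \<rho> (adj v * v) \<longrightarrow> \<phi> = coord D1 A1 v \<rho> \<longrightarrow>
       \<theta> v \<in> normalizers D2 A2 \<and>
       char_state D2 (pullback_inv \<theta> D1 \<rho>) (adj (\<theta> v) * \<theta> v) \<noteq> 0 \<and>
       \<gamma> \<phi> = coord D2 A2 (\<theta> v) (pullback_inv \<theta> D1 \<rho>))"
proof -
  interpret bounded_isomorphism D1 A1 D2 A2 \<theta>
    using assms by unfold_locales auto
  show ?thesis
  proof (intro exI[of _ transport] conjI ballI impI)
    show "bicontinuous_isomorphism D1 A1 D2 A2 transport"
      by (rule transport_bicontinuous)
    show "transport \<phi> = (\<lambda>y\<in>A2. pullback_inv \<theta> A1 \<phi> y / of_real (functional_norm A2 (pullback_inv \<theta> A1 \<phi>)))" for \<phi>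
      by (rule transport_def)
  next
    fix \<phi> v \<rho>
    assume \<phi>: "\<phi> \<in> eigenfunctionals1 D1 A1" and v: "v \<in> normalizers D1 A1" and \<rho>: "\<rho> \<in> characters D1"
      and pos: "0 < char_state D1 \<rho> (adj v * v)" and eq: "\<phi> = coord D1 A1 v \<rho>"
    show "\<theta> v \<in> normalizers D2 A2"
      by (rule \<theta>_normalizer[OF v])
    define \<alpha> where "\<alpha> = Re (\<rho> (adj v * v))"
    have \<alpha>: "0 < \<alpha>"
      using pos S.char_state_normalizer(2)[OF v \<rho>] by (simp add: \<alpha>_def)
    have "\<rho> (adj v * v) = of_real \<alpha>"
      unfolding \<alpha>_def using S.normalizerD(4)[OF v] by (intro S.char_herm_real[OF \<rho>]) (auto simp: adj_mult adj_adj)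
    note coord = S.coord_source[OF v \<rho> \<alpha> this] S.coord_self[OF v \<rho> \<alpha> this]
    have "eig_source D1 A1 \<phi> = \<rho>" "0 < \<phi> v"
      using coord \<alpha> by (simp_all add: eq less_complex_def)
    then show "char_state D2 (pullback_inv \<theta> D1 \<rho>) (adj (\<theta> v) * \<theta> v) \<noteq> 0"
      "transport \<phi> = coord D2 A2 (\<theta> v) (pullback_inv \<theta> D1 \<rho>)"
      using transport_coord[OF \<phi> v] by auto
  qed
qed

end
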